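(* For any integers $n\ge 0$ and $C_1, C_2\ge 1$, $$\mathscr{H}(C_1,C_2,\underbrace{1,1,\ldots,1}_{n})=2(C_1C_2+n).$$
   Context: Networks are finite loopless graphs (parallel edges allowed). A source is a vertex incident only with outgoing edges, a sink is a vertex incident only with incoming edges; sources and sinks are called terminal vertices. A hub is a non-terminal vertex of degree at least $3$ (degree = total number of incident edges). For positive integers $C_1,\ldots,C_m$, let $\mathcal{N}(C_1,\ldots,C_m)$ be the set of all finite networks $G$ such that: (1) $G$ has $m$ sources $S_1,\ldots,S_m$ and $m$ sinks $R_1,\ldots,R_m$ (all distinct); (2) all edges of $G$ except those incident with a source or a sink are undirected (equivalently, bi-directional), while edges incident with a source or sink are directed out of the source, respectively into the sink; (3) for each $i$, the minimum vertex-cut from $S_i$ to $R_i$ is $C_i$, i.e. (Menger) the maximum number of paths from $S_i$ to $R_i$ (respecting the directions of directed edges) that pairwise share no vertices other than $S_i,R_i$ equals $C_i$. Define $$\mathscr{H}(C_1,\ldots,C_m)=\sup_{G\in\mathcal{N}(C_1,\ldots,C_m)}\ \min_{\widehat{G}\subset G,\ \widehat{G}\in\mathcal{N}(C_1,\ldots,C_m)}\mathcal{H}(\widehat{G}),$$ where $\widehat G$ ranges over subgraphs of $G$ (with the same terminals $S_i,R_i$) and $\mathcal{H}(\widehat{G})$ is the number of hubs in $\widehat{G}$. *)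

theory Defs
  imports Main "HOL-Library.Extended_Nat"
begin

text \<open>Multigraphs in which every edge is either directed (from its tail to its head) or
  undirected. For an undirected edge the order of tail and head carries no meaning.\<close>

record ('v, 'e) mixed_graph =
  verts :: "'v set"
  edges :: "'e set"
  tail :: "'e \<Rightarrow> 'v"
  head :: "'e \<Rightarrow> 'v"
  undirected :: "'e \<Rightarrow> bool"

definition finite_loopless :: "('v, 'e) mixed_graph \<Rightarrow> bool" where
  "finite_loopless G \<longleftrightarrow> finite (verts G) \<and> finite (edges G) \<and>
     (\<forall>e\<in>edges G. tail G e \<in> verts G \<and> head G e \<in> verts G \<and> tail G e \<noteq> head G e)"

definition subgraph :: "('v, 'e) mixed_graph \<Rightarrow> ('v, 'e) mixed_graph \<Rightarrow> bool" where
  "subgraph H G \<longleftrightarrow> verts H \<subseteq> verts G \<and> edges H \<subseteq> edges G \<and>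
     (\<forall>e\<in>edges H. tail H e = tail G e \<and> head H e = head G e \<and>
        (undirected H e \<longleftrightarrow> undirected G e))"

definition incident :: "('v, 'e) mixed_graph \<Rightarrow> 'v \<Rightarrow> 'e set" where
  "incident G v = {e \<in> edges G. tail G e = v \<or> head G e = v}"

definition degree :: "('v, 'e) mixed_graph \<Rightarrow> 'v \<Rightarrow> nat" where
  "degree G v = card (incident G v)"

text \<open>Isolated vertices are neither sources nor sinks.\<close>

definition sources :: "('v, 'e) mixed_graph \<Rightarrow> 'v set" where
  "sources G = {v \<in> verts G. incident G v \<noteq> {} \<and>
     (\<forall>e\<in>incident G v. \<not> undirected G e \<and> tail G e = v)}"

definition sinks :: "('v, 'e) mixed_graph \<Rightarrow> 'v set" where
  "sinks G = {v \<in> verts G. incident G v \<noteq> {} \<and>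
     (\<forall>e\<in>incident G v. \<not> undirected G e \<and> head G e = v)}"

definition terminals :: "('v, 'e) mixed_graph \<Rightarrow> 'v set" where
  "terminals G = sources G \<union> sinks G"

definition hubs :: "('v, 'e) mixed_graph \<Rightarrow> 'v set" where
  "hubs G = {v \<in> verts G. v \<notin> terminals G \<and> degree G v \<ge> 3}"

definition traverses :: "('v, 'e) mixed_graph \<Rightarrow> 'v \<Rightarrow> 'e \<Rightarrow> 'v \<Rightarrow> bool" where
  "traverses G u e v \<longleftrightarrow> e \<in> edges G \<and>
     (tail G e = u \<and> head G e = v \<or> undirected G e \<and> tail G e = v \<and> head G e = u)"

text \<open>A path is given by its vertices together with its edges, so that parallel edges from
  \<open>s\<close> to \<open>t\<close> give different paths.\<close>

definition paths :: "('v, 'e) mixed_graph \<Rightarrow> 'v \<Rightarrow> 'v \<Rightarrow> ('v list \<times> 'e list) set" where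
  "paths G s t = {(vs, es). length vs = Suc (length es) \<and> distinct vs \<and>
     hd vs = s \<and> last vs = t \<and>
     (\<forall>i<length es. traverses G (vs ! i) (es ! i) (vs ! Suc i))}"

definition disjoint_paths ::
  "('v, 'e) mixed_graph \<Rightarrow> 'v \<Rightarrow> 'v \<Rightarrow> ('v list \<times> 'e list) set \<Rightarrow> bool" where
  "disjoint_paths G s t P \<longleftrightarrow> P \<subseteq> paths G s t \<and>
     (\<forall>p\<in>P. \<forall>q\<in>P. p \<noteq> q \<longrightarrow> set (fst p) \<inter> set (fst q) \<subseteq> {s, t})"

text \<open>In a finite graph there are only finitely many paths, so the maximum is over a finite
  nonempty set.\<close>

definition min_vertex_cut :: "('v, 'e) mixed_graph \<Rightarrow> 'v \<Rightarrow> 'v \<Rightarrow> nat" where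
  "min_vertex_cut G s t = Max {card P | P. disjoint_paths G s t P}"

text \<open>The networks with prescribed cuts, together with the enumeration of their sources and
  sinks. Vertices and edges are named by natural numbers, which covers every finite graph up
  to isomorphism. That edges at a source (sink) are directed out of (into) it is part of the
  definition of sources and sinks.\<close>

definition networks ::
  "nat list \<Rightarrow> ((nat, nat) mixed_graph \<times> nat list \<times> nat list) set" where
  "networks C = {(G, S, R). finite_loopless G \<and>
     length S = length C \<and> length R = length C \<and> distinct (S @ R) \<and>
     sources G = set S \<and> sinks G = set R \<and>
     (\<forall>e\<in>edges G. tail G e \<notin> terminals G \<and> head G e \<notin> terminals G \<longrightarrow> undirected G e) \<and>
     (\<forall>i<length C. min_vertex_cut G (S ! i) (R ! i) = C ! i)}"

text \<open>The supremum is taken in \<^typ>\<open>enat\<close>, so that a finite value includes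
  boundedness; the infimum is over a nonempty set (it contains \<open>G\<close>) and hence a minimum.\<close>

definition hub_number :: "nat list \<Rightarrow> enat" where
  "hub_number C = (SUP (G, S, R) \<in> networks C.
     INF H \<in> {H. subgraph H G \<and> (H, S, R) \<in> networks C}. enat (card (hubs H)))"

end

theory Submission
  imports Defs "HOL-Library.Countable"
begin

text \<open>Upper bound: take an edge-minimal set containing \<open>C\<^sub>1\<close> disjoint paths for the first pair and
  \<open>C\<^sub>2\<close> for the second. Group the vertices common to both path systems into units, the maximal
  segments of shared edges; only the two ends of a unit can have degree at least 3. By minimality
  neither system can be rerouted along the other, which excludes cycles in a residual relation on
  units. Hence both systems can be ranked monotonically, the units behave like the crossings of two
  families of monotone curves, and a bilinear double count bounds their number by the product of the
  numbers of curves. Applied to each connected component this gives at most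
  \<open>C\<^sub>1 C\<^sub>2 + 1 - c\<close> units when there are \<open>c\<close> components. A path for a further pair that uses as few new edges as
  possible meets each component in an interval, so it raises hubs plus twice the number of components
  by at most 2.

  Lower bound: in a \<open>C\<^sub>1\<close> by \<open>C\<^sub>2\<close> grid whose crossings are stretched to segments, with \<open>2 n\<close> further
  vertices attached to the first row, every edge is indispensable, because without it some cut has one
  vertex less.\<close>

section \<open>Counting crossings\<close>

text \<open>The graph need not be planar, and the two systems may run through an undirected edge in
  opposite directions, so no geometric order of crossings is available. The only order comes from
  minimality: acyclicity of \<open>residual PN QN\<close> ranks the links of the second system so
  that ranks rise along the first, and acyclicity of \<open>residual QN PN\<close> does the
  converse. The bound obtained from the two rankings concerns the total number of units; no bound on
  the meetings of a single pair of curves is proved or used. In the double count each factor ranges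
  over 0 to 4, a jump of 2 for each of the two links at a unit, which is the origin of 16 = 4 * 4 on
  both sides. The bookkeeping carries hubs plus twice the number of components. It is at most 2 (C1
  C2 + 1) for a minimal pair and grows by at most 2 with each further pair; as soon as there is a
  hub there is a component, and this returns the surplus 2.\<close>

text \<open>The units \<open>U\<close> are crossings of two path systems whose edges are \<open>E\<close> and \<open>F\<close>; the rank \<open>x\<close> of the
  edges of one system increases along the other system, and likewise \<open>y\<close>.\<close>

locale crossing =
  fixes U :: "'u set" and E :: "'e set" and F :: "'f set"
    and ein eout :: "'u \<Rightarrow> 'e" and fin fout :: "'u \<Rightarrow> 'f"
    and x :: "'f \<Rightarrow> nat" and y :: "'e \<Rightarrow> nat"
  assumes finU: "finite U" and finE: "finite E" and finF: "finite F"
    and ein: "ein ` U \<subseteq> E" "inj_on ein U" and eout: "eout ` U \<subseteq> E" "inj_on eout U"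
    and fin: "fin ` U \<subseteq> F" "inj_on fin U" and fout: "fout ` U \<subseteq> F" "inj_on fout U"
    and KP: "\<lbrakk>v \<in> U; v' \<in> U; eout v = ein v'; f \<in> {fin v, fout v}; g \<in> {fin v', fout v'}\<rbrakk> \<Longrightarrow> x f < x g"
    and KQ: "\<lbrakk>v \<in> U; v' \<in> U; fout v = fin v'; e \<in> {ein v, eout v}; e' \<in> {ein v', eout v'}\<rbrakk> \<Longrightarrow> y e < y e'"
begin

text \<open>\<open>s\<close> is twice the Heaviside function, with the value 1/2 at the jump, so that \<open>A\<close> and \<open>B\<close>
  record on which side of an edge a unit lies. The differences of values at tail and head cancel on summation,
  which is the content of \<open>identity\<close>; the constant 4 at the final edges \<open>E0\<close>, \<open>F0\<close> produces the main term.\<close>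

definition s :: "nat \<Rightarrow> nat \<Rightarrow> int" where "s a b = (if b < a then 2 else if a = b then 1 else 0)"
definition A :: "'u \<Rightarrow> 'f \<Rightarrow> int" where "A v f = s (x f) (x (fin v)) + s (x f) (x (fout v))"
definition B :: "'e \<Rightarrow> 'u \<Rightarrow> int" where "B e w = s (y e) (y (ein w)) + s (y e) (y (eout w))"
definition E0 where "E0 = E - eout ` U"
definition F0 where "F0 = F - fout ` U"
text \<open>The value of \<open>A\<close> at the tail of \<open>e\<close>, as \<open>Ah\<close> is
  the value at its head. An edge of \<open>E0\<close> leaves no unit and gets 4, the largest value
  of \<open>A\<close>; an edge that enters no unit gets 0, the smallest. So
  \<open>At e f - Ah e f\<close> is the fall of \<open>A\<close> along \<open>e\<close>.\<close>

definition At where "At e f = (if e \<in> E0 then 4 else 0) + (\<Sum>v\<in>U. if eout v = e then A v f else 0)"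
definition Ah where "Ah e f = (\<Sum>v\<in>U. if ein v = e then A v f else 0)"
definition Bt where "Bt e f = (if f \<in> F0 then 4 else 0) + (\<Sum>v\<in>U. if fout v = f then B e v else 0)"
definition Bh where "Bh e f = (\<Sum>v\<in>U. if fin v = f then B e v else 0)"
definition T1 where "T1 e f = (At e f - Ah e f) * (Bt e f - Bh e f)"
definition T2 where "T2 v w = (A v (fout w) - A v (fin w)) * (B (eout v) w - B (ein v) w)"
text \<open>Nonzero only if the rank of \<open>f\<close> lies between the ranks of the two
  \<open>F\<close>-edges at \<open>v\<close>: the fall that a Heaviside function of the rank would
  have inside the unit. These terms form the reserve that pays for the off-diagonal part of
  \<open>T2\<close>.\<close>

definition M where "M v f = s (x f) (min (x (fin v)) (x (fout v))) - s (x f) (max (x (fin v)) (x (fout v)))"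
definition M' where "M' w e = s (y e) (min (y (ein w)) (y (eout w))) - s (y e) (max (y (ein w)) (y (eout w)))"

lemma sum_delta_image:
  assumes "g ` U \<subseteq> S" "finite S"
  shows "(\<Sum>e\<in>S. (\<Sum>v\<in>U. if g v = e then (h v::int) else 0) * Y e) = (\<Sum>v\<in>U. h v * Y (g v))"
proof -
  have "(\<Sum>e\<in>S. (\<Sum>v\<in>U. if g v = e then h v else 0) * Y e)
      = (\<Sum>v\<in>U. \<Sum>e\<in>S. (if g v = e then h v else 0) * Y e)"
    by (simp add: sum_distrib_right sum.swap[of _ S U])
  also have "\<dots> = (\<Sum>v\<in>U. h v * Y (g v))"
  proof (rule sum.cong[OF refl])
    fix v assume v: "v \<in> U"
    have "(\<Sum>e\<in>S. (if g v = e then h v else 0) * Y e) = (\<Sum>e\<in>S. if g v = e then h v * Y e else 0)"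
      by (rule sum.cong) auto
    also have "\<dots> = h v * Y (g v)" using v assms by (auto simp: sum.delta' )
    finally show "(\<Sum>e\<in>S. (if g v = e then h v else 0) * Y e) = h v * Y (g v)" .
  qed
  finally show ?thesis .
qed

text \<open>Summation by parts: a unit \<open>v\<close> occurs once at the tail of
  \<open>eout v\<close> and once at the head of \<open>ein v\<close>. After regrouping by units only
  the constant 4 on \<open>E0\<close> is left over.\<close>

lemma sum_E: "(\<Sum>e\<in>E. (At e f - Ah e f) * Y e)
   = 4 * (\<Sum>e\<in>E0. Y e) + (\<Sum>v\<in>U. A v f * (Y (eout v) - Y (ein v)))"
proof -
  have "(\<Sum>e\<in>E. (if e \<in> E0 then 4 else 0) * Y e) = (\<Sum>e\<in>E. if e \<in> E0 then 4 * Y e else 0)"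
    by (rule sum.cong) auto
  also have "\<dots> = (\<Sum>e\<in>E \<inter> E0. 4 * Y e)" using finE by (simp add: sum.inter_restrict)
  also have "E \<inter> E0 = E0" by (auto simp: E0_def)
  finally have 1: "(\<Sum>e\<in>E. (if e \<in> E0 then 4 else 0) * Y e) = 4 * (\<Sum>e\<in>E0. Y e)"
    by (simp add: sum_distrib_left)
  show ?thesis
    using sum_delta_image[OF eout(1) finE, of "\<lambda>v. A v f" Y] sum_delta_image[OF ein(1) finE, of "\<lambda>v. A v f" Y] 1
    by (simp add: At_def Ah_def left_diff_distrib distrib_right sum.distrib sum_subtractf right_diff_distrib)
qed

lemma s_bounds: "0 \<le> s a b" "s a b \<le> 2" by (auto simp: s_def)
lemma s_mono: "b \<le> b' \<Longrightarrow> s a b' \<le> s a b" by (auto simp: s_def)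
lemma M_nonneg: "0 \<le> M v f" unfolding M_def using s_mono[of "min (x (fin v)) (x (fout v))" "max (x (fin v)) (x (fout v))" "x f"] by simp
lemma A_alt: "A v f = s (x f) (min (x (fin v)) (x (fout v))) + s (x f) (max (x (fin v)) (x (fout v)))"
  by (auto simp: A_def min_def max_def)
lemma Et: "v \<in> U \<Longrightarrow> At (eout v) f = A v f"
proof -
  assume v: "v \<in> U"
  have "(\<Sum>v'\<in>U. if eout v' = eout v then A v' f else 0) = (\<Sum>v'\<in>U. if v' = v then A v' f else 0)"
    using v eout(2) by (intro sum.cong) (auto dest: inj_onD)
  then show ?thesis using v finU by (simp add: At_def E0_def)
qed
lemma Et0: "e \<in> E0 \<Longrightarrow> At e f = 4"
  unfolding At_def by (auto simp: E0_def intro!: sum.neutral)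
lemma Eh: "v \<in> U \<Longrightarrow> Ah (ein v) f = A v f"
proof -
  assume v: "v \<in> U"
  have "(\<Sum>v'\<in>U. if ein v' = ein v then A v' f else 0) = (\<Sum>v'\<in>U. if v' = v then A v' f else 0)"
    using v ein(2) by (intro sum.cong) (auto dest: inj_onD)
  then show ?thesis using v finU by (simp add: Ah_def)
qed
lemma Eh0: "e \<notin> ein ` U \<Longrightarrow> Ah e f = 0"
  unfolding Ah_def by (auto intro!: sum.neutral)

definition SM where "SM e f = (\<Sum>v\<in>U. if eout v = e \<or> ein v = e then M v f else 0)"
definition SM' where "SM' e f = (\<Sum>w\<in>U. if fout w = f \<or> fin w = f then M' w e else 0)"

lemma eio: "v \<in> U \<Longrightarrow> ein v \<noteq> eout v" using KP[of v v "fin v" "fin v"] by auto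
lemma sum_two:
  assumes "\<And>v. v \<in> U \<Longrightarrow> (a v :: 'e2) \<noteq> b v"
  shows "(\<Sum>v\<in>U. if b v = e \<or> a v = e then (m v::int) else 0)
    = (\<Sum>v\<in>U. if b v = e then m v else 0) + (\<Sum>v\<in>U. if a v = e then m v else 0)"
  unfolding sum.distrib[symmetric]
proof (intro sum.cong refl)
  fix v assume "v \<in> U"
  then have "a v \<noteq> b v" by (rule assms)
  then show "(if b v = e \<or> a v = e then m v else 0) = (if b v = e then m v else 0) + (if a v = e then m v else 0)" by auto
qed

lemma one_sum:
  assumes "inj_on g U"
  shows "(\<Sum>v\<in>U. if g v = e then (m v::int) else 0) = (if e \<in> g ` U then m (the_inv_into U g e) else 0)"
proof (cases "e \<in> g ` U")
  case True
  then obtain v where v: "v \<in> U" "e = g v" by auto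
  have "(\<Sum>v'\<in>U. if g v' = e then m v' else 0) = (\<Sum>v'\<in>U. if v' = v then m v' else 0)"
    using v assms by (intro sum.cong) (auto dest: inj_onD)
  then show ?thesis using v finU True assms by (simp add: the_inv_into_f_f)
next
  case False then show ?thesis by (auto intro!: sum.neutral)
qed

text \<open>If \<open>e\<close> leads from \<open>v\<close> to \<open>w\<close>, then by
  \<open>KP\<close> the ranks at \<open>v\<close> lie below those at \<open>w\<close>. The fall
  \<open>A v f - A w f\<close> exceeds \<open>M v f + M w f\<close> by twice the difference of the
  values of \<open>s\<close> at the largest rank of \<open>v\<close> and the smallest rank of
  \<open>w\<close>. At a missing end the value 4 or 0 plays the same part.\<close>

lemma AtAh_ge: assumes "e \<in> E" shows "At e f - Ah e f \<ge> SM e f"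
proof -
  have SM: "SM e f = (\<Sum>v\<in>U. if eout v = e then M v f else 0) + (\<Sum>v\<in>U. if ein v = e then M v f else 0)"
    unfolding SM_def by (rule sum_two) (rule eio)
  show ?thesis
  proof (cases "e \<in> eout ` U")
    case True
    then obtain v where v: "v \<in> U" "e = eout v" by auto
    have 1: "(\<Sum>v\<in>U. if eout v = e then M v f else 0) = M v f"
      using v by (simp add: one_sum[OF eout(2)] the_inv_into_f_f[OF eout(2)])
    show ?thesis
    proof (cases "e \<in> ein ` U")
      case True
      then obtain w where w: "w \<in> U" "e = ein w" by auto
      have 2: "(\<Sum>v\<in>U. if ein v = e then M v f else 0) = M w f"
        using w by (simp add: one_sum[OF ein(2)] the_inv_into_f_f[OF ein(2)])
      have "max (x (fin v)) (x (fout v)) \<le> min (x (fin w)) (x (fout w))"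
        using KP[of v w "fin v" "fin w"] KP[of v w "fin v" "fout w"] KP[of v w "fout v" "fin w"] KP[of v w "fout v" "fout w"]
        v w by auto
      then have "s (x f) (min (x (fin w)) (x (fout w))) \<le> s (x f) (max (x (fin v)) (x (fout v)))" by (rule s_mono)
      moreover have "At e f = A v f" "Ah e f = A w f" using Et[OF v(1)] v(2) Eh[OF w(1)] w(2) by metis+
      ultimately show ?thesis unfolding SM 1 2 unfolding M_def A_alt by simp
    next
      case False
      have 2: "(\<Sum>v\<in>U. if ein v = e then M v f else 0) = 0" using False by (simp add: one_sum[OF ein(2)])
      have "At e f = A v f" "Ah e f = 0" using v Et Eh0 False by auto
      then show ?thesis unfolding SM 1 2 unfolding M_def A_alt using s_bounds[of "x f" "max (x (fin v)) (x (fout v))"] by simp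
    qed
  next
    case False
    then have e0: "e \<in> E0" using assms by (simp add: E0_def)
    have 1: "(\<Sum>v\<in>U. if eout v = e then M v f else 0) = 0" using False by (simp add: one_sum[OF eout(2)])
    show ?thesis
    proof (cases "e \<in> ein ` U")
      case True
      then obtain w where w: "w \<in> U" "e = ein w" by auto
      have 2: "(\<Sum>v\<in>U. if ein v = e then M v f else 0) = M w f"
        using w by (simp add: one_sum[OF ein(2)] the_inv_into_f_f[OF ein(2)])
      show ?thesis unfolding SM 1 2 Et0[OF e0] using w Eh[of w f] s_bounds[of "x f" "min (x (fin w)) (x (fout w))"]
        unfolding M_def A_alt by simp
    next
      case False
      have 2: "(\<Sum>v\<in>U. if ein v = e then M v f else 0) = 0" using False by (simp add: one_sum[OF ein(2)])
      show ?thesis unfolding SM 1 2 Et0[OF e0] Eh0[OF False] by simp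
    qed
  qed
qed

text \<open>Distinct units on a common edge are consecutive, so by \<open>KP\<close> the rank of an
  edge at \<open>u\<close> lies outside the range of ranks at \<open>v\<close>.\<close>

lemma M0: assumes "u \<in> U" "v \<in> U" "u \<noteq> v" "e \<in> {ein v, eout v}" "e \<in> {ein u, eout u}" "f \<in> {fin u, fout u}"
  shows "M v f = 0"
proof -
  have "(eout v = ein u) \<or> (eout u = ein v)" using assms ein(2) eout(2) by (auto dest: inj_onD)
  then show ?thesis
  proof
    assume "eout v = ein u"
    then have "x (fin v) < x f" "x (fout v) < x f" using KP[OF assms(2,1) _ _ assms(6)] by simp_all
    then show ?thesis by (auto simp: M_def s_def min_def max_def)
  next
    assume "eout u = ein v"
    then have "x f < x (fin v)" "x f < x (fout v)" using KP[OF assms(1,2) _ assms(6)] by simp_all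
    then show ?thesis by (auto simp: M_def s_def min_def max_def)
  qed
qed

interpretation dual: crossing U F E fin fout ein eout y x
  by unfold_locales (use finU finE finF ein eout fin fout KP KQ in auto)

lemma dual_eqs:
  "dual.A v e = B e v" "dual.E0 = F0" "dual.At f e = Bt e f" "dual.Ah f e = Bh e f" "dual.M v e = M' v e" "dual.SM f e = SM' e f"
proof -
  have A: "dual.A v e = B e v" and E: "dual.E0 = F0" and M: "dual.M v e = M' v e" for v e
    by (simp_all add: dual.A_def B_def dual.E0_def F0_def dual.M_def M'_def)
  then show "dual.A v e = B e v" "dual.E0 = F0" "dual.M v e = M' v e" by blast+
  show "dual.At f e = Bt e f" "dual.Ah f e = Bh e f" "dual.SM f e = SM' e f"
    unfolding dual.At_def Bt_def dual.Ah_def Bh_def dual.SM_def SM'_def A E M by (rule refl)+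
qed

lemmas Ft = dual.Et[unfolded dual_eqs] and Ft0 = dual.Et0[unfolded dual_eqs]
  and Fh = dual.Eh[unfolded dual_eqs] and Fh0 = dual.Eh0[unfolded dual_eqs]
  and fio = dual.eio and M'_nonneg = dual.M_nonneg[unfolded dual_eqs]
  and BtBh_ge = dual.AtAh_ge[unfolded dual_eqs] and M'0 = dual.M0[unfolded dual_eqs]
  and sum_F = dual.sum_E[unfolded dual_eqs]

text \<open>Summation by parts in both variables. The boundary terms give 4 * 4 for each pair of
  initial edges, and \<open>T2\<close> collects what is left at pairs of units.\<close>

lemma identity:
  "(\<Sum>e\<in>E. \<Sum>f\<in>F. T1 e f) = 16 * int (card E0) * int (card F0) + (\<Sum>v\<in>U. \<Sum>w\<in>U. T2 v w)"
proof -
  have "(\<Sum>e\<in>E. \<Sum>f\<in>F. T1 e f) = (\<Sum>e\<in>E. 4 * (\<Sum>f\<in>F0. At e f - Ah e f)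
      + (\<Sum>w\<in>U. ((At e (fout w) - Ah e (fout w)) - (At e (fin w) - Ah e (fin w))) * B e w))"
    unfolding T1_def
    by (rule sum.cong[OF refl]) (simp add: mult.commute[of "At _ _ - Ah _ _"] sum_F mult.commute[of "B _ _"])
  also have "\<dots> = 4 * (\<Sum>f\<in>F0. \<Sum>e\<in>E. At e f - Ah e f)
     + (\<Sum>w\<in>U. (\<Sum>e\<in>E. (At e (fout w) - Ah e (fout w)) * B e w) - (\<Sum>e\<in>E. (At e (fin w) - Ah e (fin w)) * B e w))"
    by (simp add: sum.distrib sum_distrib_left sum.swap[of _ E] left_diff_distrib sum_subtractf)
  also have "(\<Sum>f\<in>F0. \<Sum>e\<in>E. At e f - Ah e f) = (\<Sum>f\<in>F0. 4 * int (card E0))"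
    using sum_E[where Y="\<lambda>_. 1"] by simp
  also have "(\<Sum>w\<in>U. (\<Sum>e\<in>E. (At e (fout w) - Ah e (fout w)) * B e w) - (\<Sum>e\<in>E. (At e (fin w) - Ah e (fin w)) * B e w))
     = (\<Sum>w\<in>U. \<Sum>v\<in>U. T2 v w)"
  proof (rule sum.cong[OF refl])
    fix w
    have "(\<Sum>e\<in>E. (At e (fout w) - Ah e (fout w)) * B e w) - (\<Sum>e\<in>E. (At e (fin w) - Ah e (fin w)) * B e w)
      = (4 * (\<Sum>e\<in>E0. B e w) + (\<Sum>v\<in>U. A v (fout w) * (B (eout v) w - B (ein v) w)))
       - (4 * (\<Sum>e\<in>E0. B e w) + (\<Sum>v\<in>U. A v (fin w) * (B (eout v) w - B (ein v) w)))"
      by (simp only: sum_E)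
    also have "\<dots> = (\<Sum>v\<in>U. T2 v w)" by (simp add: T2_def left_diff_distrib sum_subtractf)
    finally show "(\<Sum>e\<in>E. (At e (fout w) - Ah e (fout w)) * B e w) - (\<Sum>e\<in>E. (At e (fin w) - Ah e (fin w)) * B e w)
      = (\<Sum>v\<in>U. T2 v w)" .
  qed
  finally show ?thesis using sum.swap[of T2 U U] by simp
qed

text \<open>The value 1 at the jump makes \<open>s a b + s b a = 2\<close>. Hence the change of
  \<open>s\<close> in its first argument between the two edges of \<open>w\<close> is, up to sign,
  the change in its second argument, and the latter is \<open>M w\<close>.\<close>

lemma T2_le: "T2 v w \<le> (M w (fin v) + M w (fout v)) * (M' v (ein w) + M' v (eout w))"
proof -
  have a: "\<bar>A v (fout w) - A v (fin w)\<bar> \<le> M w (fin v) + M w (fout v)"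
    unfolding A_def M_def by (auto simp: s_def min_def max_def)
  have b: "\<bar>B (eout v) w - B (ein v) w\<bar> \<le> M' v (ein w) + M' v (eout w)"
    unfolding B_def M'_def by (auto simp: s_def min_def max_def)
  have "T2 v w \<le> \<bar>A v (fout w) - A v (fin w)\<bar> * \<bar>B (eout v) w - B (ein v) w\<bar>"
    unfolding T2_def by (metis abs_ge_self abs_mult)
  also have "\<dots> \<le> (M w (fin v) + M w (fout v)) * (M' v (ein w) + M' v (eout w))"
    by (rule mult_mono[OF a b]) (simp_all add: M_nonneg M'_nonneg add_nonneg_nonneg)
  finally show ?thesis .
qed

definition Ow where "Ow = {(e, f) \<in> E \<times> F. \<exists>v\<in>U. e \<in> {ein v, eout v} \<and> f \<in> {fin v, fout v}}"
definition Ov where "Ov v = {ein v, eout v} \<times> {fin v, fout v}"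

lemma Ow_UN: "Ow = (\<Union>v\<in>U. Ov v)"
proof -
  have m: "ein v \<in> E" "eout v \<in> E" "fin v \<in> F" "fout v \<in> F" if "v \<in> U" for v
    using that ein(1) eout(1) fin(1) fout(1) by blast+
  show ?thesis
  proof (intro set_eqI iffI)
    fix p assume "p \<in> Ow" then show "p \<in> (\<Union>v\<in>U. Ov v)" unfolding Ow_def Ov_def by blast
  next
    fix p assume "p \<in> (\<Union>v\<in>U. Ov v)"
    then obtain v where v: "v \<in> U" "p \<in> {ein v, eout v} \<times> {fin v, fout v}" unfolding Ov_def by blast
    then obtain e f where p: "p = (e, f)" "e \<in> {ein v, eout v}" "f \<in> {fin v, fout v}" by blast
    then have "e \<in> E" "f \<in> F" using m[OF v(1)] by auto
    then show "p \<in> Ow" unfolding Ow_def using p v(1) by blast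
  qed
qed

text \<open>Units that share an edge of one system are consecutive there, so their edges in the
  other system have different ranks and cannot coincide.\<close>

lemma Ov_disj: assumes "u \<in> U" "v \<in> U" "u \<noteq> v" shows "Ov u \<inter> Ov v = {}"
proof (rule ccontr)
  assume "Ov u \<inter> Ov v \<noteq> {}"
  then obtain e f where e: "e \<in> {ein u, eout u}" "e \<in> {ein v, eout v}"
    and f: "f \<in> {fin u, fout u}" "f \<in> {fin v, fout v}" by (auto simp: Ov_def)
  have "(eout v = ein u) \<or> (eout u = ein v)" using assms e ein(2) eout(2) by (auto dest: inj_onD)
  then show False
    using KP[OF assms(2,1) _ f(2,1)] KP[OF assms(1,2) _ f(1,2)] by auto
qed

text \<open>Seen from the edges at \<open>v\<close>, all units before \<open>v\<close> count fully
  (4) and all units after \<open>v\<close> count 0. The four products then depend only on the values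
  at \<open>v\<close>, and since these sum to 4 over the two edges of each system, the result is 16
  plus the diagonal term.\<close>

lemma own: assumes v: "v \<in> U" shows "(\<Sum>(e, f)\<in>Ov v. T1 e f) = 16 + T2 v v"
proof -
  have a: "A v (fin v) + A v (fout v) = 4" by (auto simp: A_def s_def)
  have b: "B (ein v) v + B (eout v) v = 4" by (auto simp: B_def s_def)
  have At1: "At (ein v) f = 4" if f: "f \<in> {fin v, fout v}" for f
  proof (cases "ein v \<in> eout ` U")
    case True
    then obtain u where u: "u \<in> U" "eout u = ein v" by auto
    show ?thesis using Et[OF u(1), of f] u KP[OF u(1) v u(2) _ f, of "fin u"] KP[OF u(1) v u(2) _ f, of "fout u"]
      by (auto simp: A_def s_def)
  next
    case False
    then show ?thesis using Et0 v ein(1) by (auto simp: E0_def)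
  qed
  have Ah1: "Ah (eout v) f = 0" if f: "f \<in> {fin v, fout v}" for f
  proof (cases "eout v \<in> ein ` U")
    case True
    then obtain u where u: "u \<in> U" "eout v = ein u" by auto
    show ?thesis using Eh[OF u(1), of f] u KP[OF v u(1) u(2) f, of "fin u"] KP[OF v u(1) u(2) f, of "fout u"]
      by (auto simp: A_def s_def)
  next
    case False
    then show ?thesis using Eh0 by auto
  qed
  have Bt1: "Bt e (fin v) = 4" if e: "e \<in> {ein v, eout v}" for e
  proof (cases "fin v \<in> fout ` U")
    case True
    then obtain u where u: "u \<in> U" "fout u = fin v" by auto
    show ?thesis using Ft[OF u(1), of e] u KQ[OF u(1) v u(2) _ e, of "ein u"] KQ[OF u(1) v u(2) _ e, of "eout u"]
      by (auto simp: B_def s_def)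
  next
    case False
    then show ?thesis using Ft0 v fin(1) by (auto simp: F0_def)
  qed
  have Bh1: "Bh e (fout v) = 0" if e: "e \<in> {ein v, eout v}" for e
  proof (cases "fout v \<in> fin ` U")
    case True
    then obtain u where u: "u \<in> U" "fout v = fin u" by auto
    show ?thesis using Fh[OF u(1), of e] u KQ[OF v u(1) u(2) e, of "ein u"] KQ[OF v u(1) u(2) e, of "eout u"]
      by (auto simp: B_def s_def)
  next
    case False
    then show ?thesis using Fh0 by auto
  qed
  have "(\<Sum>(e, f)\<in>Ov v. T1 e f) = T1 (ein v) (fin v) + T1 (ein v) (fout v) + T1 (eout v) (fin v) + T1 (eout v) (fout v)"
    unfolding Ov_def sum.cartesian_product[symmetric] using eio[OF v] fio[OF v] by simp
  also have "\<dots> = (4 - A v (fin v)) * (4 - B (ein v) v) + (4 - A v (fout v)) * B (ein v) v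
      + A v (fin v) * (4 - B (eout v) v) + A v (fout v) * B (eout v) v"
    unfolding T1_def using v by (simp add: At1 Ah1 Bt1 Bh1 Et Eh Ft Fh)
  also have "\<dots> = 16 + T2 v v"
  proof -
    have 1: "A v (fout v) = 4 - A v (fin v)" "B (eout v) v = 4 - B (ein v) v" using a b by linarith+
    show ?thesis unfolding T2_def 1 by (simp add: algebra_simps)
  qed
  finally show ?thesis .
qed

text \<open>The product of the lower bounds \<open>SM\<close> and \<open>SM'\<close> for the two
  factors of \<open>T1\<close>, expanded over pairs of units.\<close>

definition R where "R e f = (\<Sum>v\<in>U. \<Sum>w\<in>U. if (e \<in> {ein v, eout v} \<and> f \<in> {fin w, fout w}) then M v f * M' w e else 0)"

lemma R_eq: "SM e f * SM' e f = R e f"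
  unfolding SM_def SM'_def R_def sum_product by (intro sum.cong refl) auto

lemma SM_nonneg: "0 \<le> SM e f" unfolding SM_def by (intro sum_nonneg) (simp add: M_nonneg)
lemma SM'_nonneg: "0 \<le> SM' e f" unfolding SM'_def by (intro sum_nonneg) (simp add: M'_nonneg)

lemma T1_ge: assumes "e \<in> E" "f \<in> F" shows "R e f \<le> T1 e f"
  unfolding R_eq[symmetric] T1_def using AtAh_ge[OF assms(1), of f] BtBh_ge[OF assms(2), of e]
  by (intro mult_mono) (use SM_nonneg[of e f] SM'_nonneg[of e f] in linarith)+

lemma R_sum: "(\<Sum>(e, f)\<in>E \<times> F - Ow. R e f)
   = (\<Sum>v\<in>U. \<Sum>w\<in>U. if v = w then 0 else (M v (fin w) + M v (fout w)) * (M' w (ein v) + M' w (eout v)))"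
proof -
  have finEF: "finite (E \<times> F - Ow)" using finE finF by auto
  have "(\<Sum>(e, f)\<in>E \<times> F - Ow. R e f) = (\<Sum>v\<in>U. \<Sum>w\<in>U. \<Sum>(e, f)\<in>E \<times> F - Ow.
        if (e \<in> {ein v, eout v} \<and> f \<in> {fin w, fout w}) then M v f * M' w e else 0)"
    unfolding R_def by (simp add: case_prod_beta sum.swap[of _ U "E \<times> F - Ow"] del: insert_iff)
  also have "\<dots> = (\<Sum>v\<in>U. \<Sum>w\<in>U. if v = w then 0 else (M v (fin w) + M v (fout w)) * (M' w (ein v) + M' w (eout v)))"
  proof (intro sum.cong refl)
    fix v w assume vw: "v \<in> U" "w \<in> U"
    let ?S = "{ein v, eout v} \<times> {fin w, fout w}"
    have sub: "?S \<subseteq> E \<times> F" using vw ein(1) eout(1) fin(1) fout(1) by auto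
    have "(\<Sum>(e, f)\<in>E \<times> F - Ow. if (e \<in> {ein v, eout v} \<and> f \<in> {fin w, fout w}) then M v f * M' w e else 0)
       = (\<Sum>p\<in>E \<times> F - Ow. if p \<in> ?S then (case p of (e, f) \<Rightarrow> M v f * M' w e) else 0)"
      by (intro sum.cong refl) (auto simp: split_beta prod_eq_iff)
    also have "\<dots> = (\<Sum>p\<in>(E \<times> F - Ow) \<inter> ?S. case p of (e, f) \<Rightarrow> M v f * M' w e)"
      using finEF by (simp add: sum.inter_restrict)
    also have "(E \<times> F - Ow) \<inter> ?S = ?S - Ow" using sub by auto
    also have "(\<Sum>p\<in>?S - Ow. case p of (e, f) \<Rightarrow> M v f * M' w e)
      = (if v = w then 0 else (M v (fin w) + M v (fout w)) * (M' w (ein v) + M' w (eout v)))"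
    proof (cases "v = w")
      case True
      then have "?S - Ow = {}" using vw Ow_UN by (auto simp: Ov_def)
      then show ?thesis using True by simp
    next
      case False
      \<comment> \<open>Leaving out the pairs of \<open>Ow\<close> loses nothing when the two units
        differ. Such a pair belongs to a unit \<open>u\<close> different from \<open>v\<close> or
        from \<open>w\<close>, and \<open>M0\<close> or \<open>M'0\<close> makes its term
        vanish.\<close>
      have "(\<Sum>p\<in>?S - Ow. case p of (e, f) \<Rightarrow> M v f * M' w e) = (\<Sum>p\<in>?S. case p of (e, f) \<Rightarrow> M v f * M' w e)"
      proof (rule sum.mono_neutral_left)
        show "\<forall>p\<in>?S - (?S - Ow). (case p of (e, f) \<Rightarrow> M v f * M' w e) = 0"
        proof
          fix p assume p: "p \<in> ?S - (?S - Ow)"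
          obtain e f where ef: "p = (e, f)" by force
          then have e: "e \<in> {ein v, eout v}" and f: "f \<in> {fin w, fout w}" and "(e, f) \<in> Ow" using p by auto
          then obtain u where u: "u \<in> U" "e \<in> {ein u, eout u}" "f \<in> {fin u, fout u}" unfolding Ow_UN Ov_def by blast
          have "M v f * M' w e = 0"
          proof (cases "u = v")
            case True
            then show ?thesis using M'0[of v w f e] u f e False vw by simp
          next
            case neq: False
            then show ?thesis using M0[OF u(1) vw(1) neq e u(2,3)] by simp
          qed
          then show "(case p of (e, f) \<Rightarrow> M v f * M' w e) = 0" using ef by simp
        qed
      qed auto
      also have "\<dots> = (M v (fin w) + M v (fout w)) * (M' w (ein v) + M' w (eout v))"
        unfolding sum.cartesian_product[symmetric] using eio[OF vw(1)] fio[OF vw(2)] by (simp add: algebra_simps)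
      finally show ?thesis using False by simp
    qed
    finally show "(\<Sum>(e, f)\<in>E \<times> F - Ow. if (e \<in> {ein v, eout v} \<and> f \<in> {fin w, fout w}) then M v f * M' w e else 0)
      = (if v = w then 0 else (M v (fin w) + M v (fout w)) * (M' w (ein v) + M' w (eout v)))" .
  qed
  finally show ?thesis .
qed

text \<open>Pairs of edges that meet at a unit contribute 16 per unit plus the diagonal of
  \<open>T2\<close>. All other pairs contribute at least \<open>X\<close>, which dominates the
  off-diagonal part of \<open>T2\<close>. Comparison with \<open>identity\<close> leaves 16 times
  the claim.\<close>

theorem card_le: "card U \<le> card (E - eout ` U) * card (F - fout ` U)"
proof -
  have subO: "Ow \<subseteq> E \<times> F" by (auto simp: Ow_def)
  have finO: "finite (E \<times> F)" using finE finF by simp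
  have "(\<Sum>e\<in>E. \<Sum>f\<in>F. T1 e f) = (\<Sum>(e, f)\<in>E \<times> F. T1 e f)" by (rule sum.cartesian_product)
  also have "\<dots> = (\<Sum>(e, f)\<in>E \<times> F - Ow. T1 e f) + (\<Sum>(e, f)\<in>Ow. T1 e f)"
    using sum.subset_diff[OF subO finO] by simp
  also have "(\<Sum>(e, f)\<in>Ow. T1 e f) = (\<Sum>v\<in>U. \<Sum>(e, f)\<in>Ov v. T1 e f)"
    unfolding Ow_UN using Ov_disj finU by (intro sum.UNION_disjoint) (simp_all add: Ov_def)
  also have "\<dots> = (\<Sum>v\<in>U. 16 + T2 v v)" by (intro sum.cong refl own)
  finally have 1: "(\<Sum>e\<in>E. \<Sum>f\<in>F. T1 e f) = (\<Sum>(e, f)\<in>E \<times> F - Ow. T1 e f) + (16 * int (card U) + (\<Sum>v\<in>U. T2 v v))"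
    by (simp add: sum.distrib)
  have "(\<Sum>(e, f)\<in>E \<times> F - Ow. R e f) \<le> (\<Sum>(e, f)\<in>E \<times> F - Ow. T1 e f)"
    by (rule sum_mono) (auto intro: T1_ge)
  then have 2: "(\<Sum>v\<in>U. \<Sum>w\<in>U. if v = w then 0 else (M v (fin w) + M v (fout w)) * (M' w (ein v) + M' w (eout v)))
     \<le> (\<Sum>(e, f)\<in>E \<times> F - Ow. T1 e f)" unfolding R_sum .
  define c where "c v w = (M v (fin w) + M v (fout w)) * (M' w (ein v) + M' w (eout v))" for v w
  define X where "X = (\<Sum>v\<in>U. \<Sum>w\<in>U. if v = w then 0 else c v w)"
  have le: "T2 w v \<le> (if v = w then T2 v v else 0) + (if v = w then 0 else c v w)" for v w
    using T2_le[of w v] by (simp add: c_def)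
  have "(\<Sum>v\<in>U. \<Sum>w\<in>U. T2 v w) = (\<Sum>v\<in>U. \<Sum>w\<in>U. T2 w v)" by (rule sum.swap)
  also have "\<dots> \<le> (\<Sum>v\<in>U. \<Sum>w\<in>U. (if v = w then T2 v v else 0) + (if v = w then 0 else c v w))"
    by (intro sum_mono le)
  also have "\<dots> = (\<Sum>v\<in>U. \<Sum>w\<in>U. if v = w then T2 v v else 0) + X"
    unfolding X_def by (simp only: sum.distrib)
  also have "(\<Sum>v\<in>U. \<Sum>w\<in>U. if v = w then T2 v v else 0) = (\<Sum>v\<in>U. T2 v v)"
    by (intro sum.cong refl) (simp add: finU)
  finally have 3: "(\<Sum>v\<in>U. \<Sum>w\<in>U. T2 v w) \<le> (\<Sum>v\<in>U. T2 v v) + X" .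
  have 2: "X \<le> (\<Sum>(e, f)\<in>E \<times> F - Ow. T1 e f)" using 2 unfolding X_def c_def .
  have "16 * int (card U) \<le> 16 * (int (card E0) * int (card F0))"
    using identity 1 2 3 unfolding mult.assoc by linarith
  then have "int (card U) \<le> int (card E0 * card F0)" by simp
  then show ?thesis unfolding E0_def F0_def by (simp only: of_nat_le_iff)
qed

end

section \<open>Rankings from acyclic residual relations\<close>

lemma acyclic_rank:
  assumes "finite F" "R \<subseteq> F \<times> F" "acyclic R"
  obtains x :: "'a \<Rightarrow> nat" where "\<And>a b. (a, b) \<in> R \<Longrightarrow> x a < x b"
proof
  fix a b assume ab: "(a, b) \<in> R"
  have fin: "finite {c. (c, b) \<in> R\<^sup>+}"
    by (rule finite_subset[OF _ assms(1)]) (use assms(2) trancl_subset_Sigma[OF assms(2)] in auto)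
  have "{c. (c, a) \<in> R\<^sup>+} \<subset> {c. (c, b) \<in> R\<^sup>+}"
    using ab assms(3) by (auto simp: acyclic_def intro: trancl_into_trancl)
  then show "card {c. (c, a) \<in> R\<^sup>+} < card {c. (c, b) \<in> R\<^sup>+}" by (rule psubset_card_mono[OF fin])
qed

text \<open>The residual relation: \<open>v\<close> can be rerouted to the \<open>P\<close>-successor of \<open>z\<close>.\<close>

definition residual :: "'u rel \<Rightarrow> 'u rel \<Rightarrow> 'u rel" where
  "residual PN QN = {(v, z). \<exists>w. (z, w) \<in> PN \<and> (v = w \<or> (v, w) \<in> QN \<or> (w, v) \<in> QN)}"

text \<open>Names for the links of a system: the link that leaves \<open>u\<close> is
  \<open>Inl u\<close>, also when it is regarded as the link that enters the successor of
  \<open>u\<close>, and \<open>Inr v\<close> is the initial link in front of a first unit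
  \<open>v\<close>. A last unit \<open>v\<close> still has the outgoing link
  \<open>Inl v\<close>.\<close>

definition in_edge :: "'u rel \<Rightarrow> 'u \<Rightarrow> 'u + 'u" where
  "in_edge N v = (if v \<in> Range N then Inl (THE u. (u, v) \<in> N) else Inr v)"

lemma in_edge_Inl:
  assumes "single_valued (N\<inverse>)" shows "in_edge N v = Inl u \<longleftrightarrow> (u, v) \<in> N"
proof -
  have "(THE u. (u, v) \<in> N) = u" if "(u, v) \<in> N" for u
    using that assms by (intro the_equality) (auto simp: single_valued_def)
  then show ?thesis unfolding in_edge_def by (auto simp: Range_iff)
qed

lemma in_edge_inj: assumes "single_valued N" "single_valued (N\<inverse>)" shows "inj_on (in_edge N) U"
proof (rule inj_onI)
  fix v w assume eq: "in_edge N v = in_edge N w"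
  show "v = w"
  proof (cases "in_edge N v")
    case (Inl u)
    then show ?thesis using eq in_edge_Inl[OF assms(2)] assms(1) by (metis single_valuedD)
  next
    case (Inr u)
    then show ?thesis using eq by (auto simp: in_edge_def split: if_splits)
  qed
qed

lemma shared_edge:
  assumes "single_valued N" "single_valued (N\<inverse>)" "f \<in> {in_edge N a, Inl a}" "f \<in> {in_edge N b, Inl b}"
  shows "a = b \<or> (a, b) \<in> N \<or> (b, a) \<in> N"
  using assms(3,4) inj_onD[OF in_edge_inj[OF assms(1,2), of UNIV], of a b]
  by (auto simp: in_edge_Inl[OF assms(2)] dest: sym)

text \<open>Order the \<open>QN\<close>-links by the steps of \<open>PN\<close>. Where one step ends
  and the next one starts on the same link, the two units are equal or adjacent in
  \<open>QN\<close>, and this is a residual step in the opposite direction. So a cycle of links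
  would give a residual cycle.\<close>

lemma residual_order:
  assumes "finite U" "PN \<subseteq> U \<times> U" "QN \<subseteq> U \<times> U"
    and QN: "single_valued QN" "single_valued (QN\<inverse>)" and ac: "acyclic (residual PN QN)"
  obtains x :: "'u + 'u \<Rightarrow> nat"
  where "\<And>v v' f g. (v, v') \<in> PN \<Longrightarrow> f \<in> {in_edge QN v, Inl v} \<Longrightarrow> g \<in> {in_edge QN v', Inl v'} \<Longrightarrow> x f < x g"
proof -
  let ?R = "{(f, g). \<exists>v v'. (v, v') \<in> PN \<and> f \<in> {in_edge QN v, Inl v} \<and> g \<in> {in_edge QN v', Inl v'}}"
  let ?F = "Inl ` U \<union> Inr ` U"
  have inF: "in_edge QN v \<in> ?F" if "v \<in> U" for v
  proof (cases "in_edge QN v")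
    case (Inl u)
    then show ?thesis using in_edge_Inl[OF QN(2)] assms(3) by auto
  next
    case (Inr u)
    then show ?thesis using that by (auto simp: in_edge_def split: if_splits)
  qed
  have sub: "?R \<subseteq> ?F \<times> ?F"
  proof (clarify, intro conjI)
    fix f g v v' assume h: "(v, v') \<in> PN" "f \<in> {in_edge QN v, Inl v}" "g \<in> {in_edge QN v', Inl v'}"
    have "v \<in> U" "v' \<in> U" using h(1) assms(2) by auto
    then show "f \<in> ?F" "g \<in> ?F" using h(2,3) inF by auto
  qed
  have chain: "\<exists>v v' z z'. (v, v') \<in> PN \<and> f \<in> {in_edge QN v, Inl v} \<and> (z, z') \<in> PN \<and> g \<in> {in_edge QN z', Inl z'}
      \<and> (z, v) \<in> (residual PN QN)\<^sup>*" if "(f, g) \<in> ?R\<^sup>+" for f g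
    using that
  proof (induction rule: trancl_induct)
    case (base g)
    then show ?case by blast
  next
    case (step g h)
    from step.IH obtain v v' z z' where 1: "(v, v') \<in> PN" "f \<in> {in_edge QN v, Inl v}" "(z, z') \<in> PN"
      "g \<in> {in_edge QN z', Inl z'}" "(z, v) \<in> (residual PN QN)\<^sup>*" by blast
    from step.hyps obtain w w' where 2: "(w, w') \<in> PN" "g \<in> {in_edge QN w, Inl w}" "h \<in> {in_edge QN w', Inl w'}" by blast
    have "w = z' \<or> (w, z') \<in> QN \<or> (z', w) \<in> QN" by (rule shared_edge[OF QN 2(2) 1(4)])
    then have "(w, z) \<in> residual PN QN" using 1(3) by (auto simp: residual_def)
    then show ?case using 1 2 by (metis converse_rtrancl_into_rtrancl)
  qed
  have "acyclic ?R"
  proof (rule acyclicI, intro allI notI)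
    fix f assume "(f, f) \<in> ?R\<^sup>+"
    from chain[OF this] obtain v v' z z' where 1: "(v, v') \<in> PN" "f \<in> {in_edge QN v, Inl v}" "(z, z') \<in> PN"
      "f \<in> {in_edge QN z', Inl z'}" "(z, v) \<in> (residual PN QN)\<^sup>*" by blast
    have "v = z' \<or> (v, z') \<in> QN \<or> (z', v) \<in> QN" by (rule shared_edge[OF QN 1(2,4)])
    then have "(v, z) \<in> residual PN QN" using 1(3) by (auto simp: residual_def)
    then have "(v, v) \<in> (residual PN QN)\<^sup>+" using 1(5) by (rule rtrancl_into_trancl2)
    then show False using ac by (auto simp: acyclic_def)
  qed
  from acyclic_rank[OF _ sub this] assms(1) obtain x :: "'u + 'u \<Rightarrow> nat" where "\<And>a b. (a, b) \<in> ?R \<Longrightarrow> x a < x b" by auto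
  then show thesis by (intro that[of x]) blast
qed

theorem crossing_bound:
  assumes fin: "finite U" and sub: "PN \<subseteq> U \<times> U" "QN \<subseteq> U \<times> U"
    and PN: "single_valued PN" "single_valued (PN\<inverse>)" and QN: "single_valued QN" "single_valued (QN\<inverse>)"
    and ac: "acyclic (residual PN QN)" "acyclic (residual QN PN)"
  shows "card U \<le> card (U - Range PN) * card (U - Range QN)"
proof -
  obtain x where x: "\<And>v v' f g. (v, v') \<in> PN \<Longrightarrow> f \<in> {in_edge QN v, Inl v} \<Longrightarrow> g \<in> {in_edge QN v', Inl v'} \<Longrightarrow> (x f :: nat) < x g"
    by (rule residual_order[OF fin sub(1,2) QN ac(1)]) (rule that)
  obtain y where y: "\<And>v v' f g. (v, v') \<in> QN \<Longrightarrow> f \<in> {in_edge PN v, Inl v} \<Longrightarrow> g \<in> {in_edge PN v', Inl v'} \<Longrightarrow> (y f :: nat) < y g"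
    by (rule residual_order[OF fin sub(2,1) PN ac(2)]) (rule that)
  let ?E = "\<lambda>N. Inl ` U \<union> Inr ` (U - Range N)"
  have inE: "in_edge N ` U \<subseteq> ?E N" if "N \<subseteq> U \<times> U" "single_valued (N\<inverse>)" for N
  proof
    fix e assume "e \<in> in_edge N ` U"
    then obtain v where v: "v \<in> U" "e = in_edge N v" by auto
    show "e \<in> ?E N"
    proof (cases e)
      case (Inl u)
      then show ?thesis using in_edge_Inl[OF that(2)] v that(1) by auto
    next
      case (Inr u)
      then show ?thesis using v by (auto simp: in_edge_def split: if_splits)
    qed
  qed
  have E0: "?E N - Inl ` U = Inr ` (U - Range N)" for N by auto
  interpret crossing U "?E PN" "?E QN" "in_edge PN" Inl "in_edge QN" Inl x y
  proof
    show "\<And>v v' f g. v \<in> U \<Longrightarrow> v' \<in> U \<Longrightarrow> Inl v = in_edge PN v' \<Longrightarrow> f \<in> {in_edge QN v, Inl v} \<Longrightarrow>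
       g \<in> {in_edge QN v', Inl v'} \<Longrightarrow> x f < x g" using x in_edge_Inl[OF PN(2)] by metis
    show "\<And>v v' f g. v \<in> U \<Longrightarrow> v' \<in> U \<Longrightarrow> Inl v = in_edge QN v' \<Longrightarrow> f \<in> {in_edge PN v, Inl v} \<Longrightarrow>
       g \<in> {in_edge PN v', Inl v'} \<Longrightarrow> y f < y g" using y in_edge_Inl[OF QN(2)] by metis
  qed (use fin inE[OF sub(1) PN(2)] inE[OF sub(2) QN(2)] in_edge_inj[OF PN] in_edge_inj[OF QN] in auto)
  show ?thesis using card_le unfolding E0 by (simp add: card_image)
qed

section \<open>Path systems and rerouting\<close>

definition walk :: "('v, 'e) mixed_graph \<Rightarrow> 'e set \<Rightarrow> 'v set \<Rightarrow> 'v rel" where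
  "walk G W Z = {(u, v). u \<in> Z \<and> v \<in> Z \<and> (\<exists>e\<in>W. traverses G u e v)}"

definition trail :: "('v, 'e) mixed_graph \<Rightarrow> 'v list \<Rightarrow> 'e list \<Rightarrow> bool" where
  "trail G vs es \<longleftrightarrow> length vs = Suc (length es) \<and> distinct vs \<and>
     (\<forall>i<length es. traverses G (vs ! i) (es ! i) (vs ! Suc i))"

lemma paths_trail: "(vs, es) \<in> paths G s t \<longleftrightarrow> trail G vs es \<and> hd vs = s \<and> last vs = t"
  by (auto simp: paths_def trail_def)

lemma trail_snoc:
  assumes "trail G vs es" "traverses G (last vs) e w" "w \<notin> set vs"
  shows "trail G (vs @ [w]) (es @ [e])"
proof -
  have l: "length vs = Suc (length es)" using assms(1) by (simp add: trail_def)
  then have "last vs = vs ! length es" by (metis diff_Suc_1 last_conv_nth length_0_conv nat.distinct(1))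
  then show ?thesis using assms l by (auto simp: trail_def nth_append less_Suc_eq)
qed

lemma trail_cons:
  assumes "trail G vs es" "traverses G w e (hd vs)" "w \<notin> set vs"
  shows "trail G (w # vs) (e # es)"
proof -
  have l: "length vs = Suc (length es)" using assms(1) by (simp add: trail_def)
  then have "hd vs = vs ! 0" by (metis hd_conv_nth length_0_conv nat.distinct(1))
  then show ?thesis using assms l by (auto simp: trail_def nth_Cons split: nat.splits)
qed

lemma trail_take:
  assumes "trail G vs es" "i < length vs"
  shows "trail G (take (Suc i) vs) (take i es)"
  using assms by (auto simp: trail_def)

lemma walk_trail:
  assumes "(b, l) \<in> (walk G W Z)\<^sup>*" "b \<in> Z"
  shows "\<exists>vs es. trail G vs es \<and> hd vs = b \<and> last vs = l \<and> set vs \<subseteq> Z \<and> set es \<subseteq> W"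
  using assms
proof (induction rule: rtrancl_induct)
  case base
  then show ?case by (intro exI[of _ "[b]"] exI[of _ "[]"]) (simp add: trail_def)
next
  case (step y z)
  then obtain vs es where p: "trail G vs es" "hd vs = b" "last vs = y" "set vs \<subseteq> Z" "set es \<subseteq> W" by blast
  have ne: "vs \<noteq> []" using p(1) by (auto simp: trail_def)
  from step obtain e where e: "e \<in> W" "traverses G y e z" "z \<in> Z" by (auto simp: walk_def)
  show ?case
  proof (cases "z \<in> set vs")
    case True
    \<comment> \<open>Loop erasure: at a repeated vertex the trail is cut back to its first
      visit.\<close>
    then obtain i where i: "i < length vs" "vs ! i = z" by (auto simp: in_set_conv_nth)
    have "hd (take (Suc i) vs) = b" using p(2) ne by simp
    moreover have "last (take (Suc i) vs) = z" using i by (simp add: take_Suc_conv_app_nth)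
    ultimately show ?thesis
      using trail_take[OF p(1) i(1)] p(4,5) set_take_subset[of "Suc i" vs] set_take_subset[of i es] by blast
  next
    case False
    have "trail G (vs @ [z]) (es @ [e])" using trail_snoc[OF p(1)] p(3) e False by simp
    then show ?thesis using p e ne by (intro exI[of _ "vs @ [z]"] exI[of _ "es @ [e]"]) auto
  qed
qed

definition linked :: "('v, 'e) mixed_graph \<Rightarrow> 'e set \<Rightarrow> 'v \<Rightarrow> 'v \<Rightarrow> nat \<Rightarrow> bool" where
  "linked G W s t k \<longleftrightarrow> (\<exists>P. finite P \<and> disjoint_paths G s t P \<and> card P = k \<and> (\<forall>p\<in>P. set (snd p) \<subseteq> W))"

text \<open>Reduces the construction of disjoint paths to reachability inside pairwise disjoint
  zones, so that rerouted paths never have to be written down. A start is recorded with its edge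
  because parallel edges from \<open>s\<close> to \<open>t\<close> count as different paths.\<close>

lemma lanes:
  assumes fin: "finite I"
    and start: "\<And>e v. (e, v) \<in> I \<Longrightarrow> e \<in> W \<and> traverses G s e v"
    and lane: "\<And>e v. (e, v) \<in> I \<Longrightarrow> v \<noteq> t \<Longrightarrow> v \<in> Z v \<and> s \<notin> Z v \<and> t \<notin> Z v \<and>
        (\<exists>l e'. (v, l) \<in> (walk G W (Z v))\<^sup>* \<and> e' \<in> W \<and> traverses G l e' t)"
    and disj: "\<And>e v e' v'. (e, v) \<in> I \<Longrightarrow> (e', v') \<in> I \<Longrightarrow> v \<noteq> t \<Longrightarrow> v' \<noteq> t \<Longrightarrow> (e, v) \<noteq> (e', v') \<Longrightarrow> Z v \<inter> Z v' = {}"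
    and st: "s \<noteq> t"
  shows "linked G W s t (card I)"
proof -
  \<comment> \<open>The conjuncts about the first edge and about length 2 serve injectivity: a
    single-edge path is recognised by its edge, a longer one by its first inner vertex.\<close>
  have "\<exists>p. p \<in> paths G s t \<and> set (snd p) \<subseteq> W \<and> hd (snd p) = fst a \<and> set (fst p) \<subseteq> {s, t} \<union> Z (snd a) \<and>
      (snd a = t \<longleftrightarrow> length (fst p) = 2) \<and> (snd a = t \<longrightarrow> set (fst p) \<subseteq> {s, t}) \<and> (snd a \<noteq> t \<longrightarrow> snd a \<in> set (fst p))" if "a \<in> I" for a
  proof -
    obtain e v where a: "a = (e, v)" by force
    note st1 = start[OF that[unfolded a]]
    show ?thesis
    proof (cases "v = t")
      case True
      show ?thesis using st1 True st a by (intro exI[of _ "([s, t], [e])"]) (auto simp: paths_def)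
    next
      case False
      note l = lane[OF that[unfolded a] False]
      then obtain l e' where l': "(v, l) \<in> (walk G W (Z v))\<^sup>*" "e' \<in> W" "traverses G l e' t" by blast
      from walk_trail[OF l'(1)] l obtain vs es where p: "trail G vs es" "hd vs = v" "last vs = l" "set vs \<subseteq> Z v" "set es \<subseteq> W"
        by blast
      have ne: "vs \<noteq> []" using p(1) by (auto simp: trail_def)
      have "trail G (vs @ [t]) (es @ [e'])" using trail_snoc[OF p(1)] p l' l by auto
      then have "trail G (s # vs @ [t]) (e # es @ [e'])"
        using trail_cons[of G "vs @ [t]" "es @ [e']" s e] p st1 st l ne by auto
      then have "(s # vs @ [t], e # es @ [e']) \<in> paths G s t" by (simp add: paths_trail)
      moreover have "v \<in> set vs" using p(2) ne by force
      ultimately show ?thesis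
        using st1 p l' False a ne by (intro exI[of _ "(s # vs @ [t], e # es @ [e'])"]) auto
    qed
  qed
  then obtain f where f: "\<And>a. a \<in> I \<Longrightarrow> f a \<in> paths G s t \<and> set (snd (f a)) \<subseteq> W \<and> hd (snd (f a)) = fst a
      \<and> set (fst (f a)) \<subseteq> {s, t} \<union> Z (snd a) \<and> (snd a = t \<longleftrightarrow> length (fst (f a)) = 2)
      \<and> (snd a = t \<longrightarrow> set (fst (f a)) \<subseteq> {s, t}) \<and> (snd a \<noteq> t \<longrightarrow> snd a \<in> set (fst (f a)))" by metis
  have dj: "set (fst (f a)) \<inter> set (fst (f b)) \<subseteq> {s, t}" if "a \<in> I" "b \<in> I" "a \<noteq> b" for a b
    using f[OF that(1)] f[OF that(2)] disj[of "fst a" "snd a" "fst b" "snd b"] that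
    by (cases "snd a = t"; cases "snd b = t"; auto)
  have inj: "inj_on f I"
  proof (rule inj_onI, rule ccontr)
    fix a b assume ab: "a \<in> I" "b \<in> I" "f a = f b" "a \<noteq> b"
    have "snd a = t \<longleftrightarrow> snd b = t" using f[OF ab(1)] f[OF ab(2)] ab(3) by metis
    moreover have "fst a = fst b" using f[OF ab(1)] f[OF ab(2)] ab(3) by metis
    ultimately have nt: "snd a \<noteq> t" using ab(4) by (metis prod.expand)
    then have "snd a \<in> {s, t}" using dj[OF ab(1,2,4)] f[OF ab(1)] ab(3) by auto
    moreover have "snd a \<noteq> s" using lane[of "fst a" "snd a"] nt ab(1) by auto
    ultimately show False using nt by auto
  qed
  show ?thesis unfolding linked_def
  proof (intro exI[of _ "f ` I"] conjI)
    show "disjoint_paths G s t (f ` I)" unfolding disjoint_paths_def using f dj by blast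
    show "card (f ` I) = card I" by (rule card_image[OF inj])
  qed (use fin f in auto)
qed

section \<open>Path systems as sets of arcs\<close>

text \<open>Disjoint paths as a degree condition: away from \<open>s\<close> and \<open>t\<close> at
  most one arc enters and at most one leaves a vertex. The last two conditions exclude stray cycles
  and tie every arc to both terminals.\<close>

locale linkage =
  fixes G :: "('v, 'e) mixed_graph" and s t :: 'v and N :: "('v \<times> 'e \<times> 'v) set"
  assumes trav: "(u, e, v) \<in> N \<Longrightarrow> traverses G u e v"
    and st: "s \<noteq> t"
    and out: "(u, e, v) \<in> N \<Longrightarrow> (u, e', v') \<in> N \<Longrightarrow> u \<noteq> s \<Longrightarrow> e = e' \<and> v = v'"
    and inn: "(u, e, v) \<in> N \<Longrightarrow> (u', e', v) \<in> N \<Longrightarrow> v \<noteq> t \<Longrightarrow> e = e' \<and> u = u'"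
    and not_s: "(u, e, v) \<in> N \<Longrightarrow> v \<noteq> s" and not_t: "(u, e, v) \<in> N \<Longrightarrow> u \<noteq> t"
    and finN: "finite N"
    and to_t: "(u, e, v) \<in> N \<Longrightarrow> v \<noteq> t \<Longrightarrow>
       \<exists>l e'. (v, l) \<in> {(a, b). a \<noteq> s \<and> b \<noteq> t \<and> (\<exists>e. (a, e, b) \<in> N)}\<^sup>* \<and> (l, e', t) \<in> N"
    and from_s: "(u, e, v) \<in> N \<Longrightarrow> u \<noteq> s \<Longrightarrow>
       \<exists>b e'. (b, u) \<in> {(a, b). a \<noteq> s \<and> b \<noteq> t \<and> (\<exists>e. (a, e, b) \<in> N)}\<^sup>* \<and> (s, e', b) \<in> N"
begin
definition nxt :: "'v rel" where "nxt = {(a, b). a \<noteq> s \<and> b \<noteq> t \<and> (\<exists>e. (a, e, b) \<in> N)}"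
definition V :: "'v set" where "V = {v. v \<noteq> t \<and> (\<exists>u e. (u, e, v) \<in> N)}"
definition E :: "'e set" where "E = {e. \<exists>u v. (u, e, v) \<in> N}"
definition starts :: "('e \<times> 'v) set" where "starts = {(e, v). (s, e, v) \<in> N}"

lemma V_out: "v \<in> V \<Longrightarrow> \<exists>e w. (v, e, w) \<in> N"
proof -
  assume "v \<in> V"
  then obtain u e where v: "(u, e, v) \<in> N" "v \<noteq> t" unfolding V_def by blast
  from to_t[OF v] obtain l e' where l: "(v, l) \<in> {(a, b). a \<noteq> s \<and> b \<noteq> t \<and> (\<exists>e. (a, e, b) \<in> N)}\<^sup>*" "(l, e', t) \<in> N" by blast
  from l(1) show "\<exists>e w. (v, e, w) \<in> N" by (cases rule: converse_rtranclE) (use l(2) in auto)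
qed
lemma V_st: "v \<in> V \<Longrightarrow> v \<noteq> s \<and> v \<noteq> t" using not_s by (auto simp: V_def)
lemma out_V: "(v, e, w) \<in> N \<Longrightarrow> v \<noteq> s \<Longrightarrow> v \<in> V"
proof -
  assume a: "(v, e, w) \<in> N" "v \<noteq> s"
  from from_s[OF a] obtain b e' where b: "(b, v) \<in> {(a, b). a \<noteq> s \<and> b \<noteq> t \<and> (\<exists>e. (a, e, b) \<in> N)}\<^sup>*" "(s, e', b) \<in> N" by blast
  from b(1) have "\<exists>u e. (u, e, v) \<in> N" by (cases rule: rtranclE) (use b(2) in auto)
  then show "v \<in> V" using not_t[OF a(1)] by (auto simp: V_def)
qed
lemma in_V: "(v, e, w) \<in> N \<Longrightarrow> w \<noteq> t \<Longrightarrow> w \<in> V" by (auto simp: V_def)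
lemma nxt_V: "(a, b) \<in> nxt \<Longrightarrow> a \<in> V \<and> b \<in> V" using out_V in_V unfolding nxt_def by blast
lemma nxt_sv: "single_valued nxt" using out unfolding nxt_def single_valued_def by blast
lemma nxt_inj: "single_valued (nxt\<inverse>)" using inn unfolding nxt_def single_valued_def by blast
lemma finV: "finite V"
proof -
  have "V \<subseteq> (\<lambda>(u, e, v). v) ` N" unfolding V_def by force
  then show ?thesis using finN finite_surj by blast
qed
lemma V_to_t: "v \<in> V \<Longrightarrow> \<exists>l e'. (v, l) \<in> nxt\<^sup>* \<and> (l, e', t) \<in> N"
  using to_t unfolding V_def nxt_def by blast
lemma V_from_s: "v \<in> V \<Longrightarrow> \<exists>b e'. (b, v) \<in> nxt\<^sup>* \<and> (s, e', b) \<in> N"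
  using V_out[of v] from_s[of v] V_st[of v] unfolding nxt_def by blast
lemma start_not_range: "(s, e, b) \<in> N \<Longrightarrow> b \<notin> Range nxt"
  using inn unfolding nxt_def by blast

text \<open>Every vertex is reached from a first vertex, which has no predecessor. Since
  predecessors are unique, a cycle could be pulled back along this walk to the first vertex.\<close>

lemma nxt_acyclic: "acyclic nxt"
proof (rule acyclicI, intro allI notI)
  fix v assume c: "(v, v) \<in> nxt\<^sup>+"
  then have "v \<in> V" using nxt_V by (meson tranclD)
  then obtain b e' where b: "(b, v) \<in> nxt\<^sup>*" "(s, e', b) \<in> N" using V_from_s by blast
  from b(1) c show False
  proof (induction rule: rtrancl_induct)
    case base
    then show ?case using start_not_range[OF b(2)] by (meson Range.intros tranclD2)
  next
    case (step y z)
    from step.prems obtain y' where "(z, y') \<in> nxt\<^sup>*" "(y', z) \<in> nxt" by (meson tranclD2)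
    moreover have "y' = y" using nxt_inj calculation(2) step.hyps(2) by (auto simp: single_valued_def)
    ultimately show ?case using step by (meson rtrancl_into_trancl2)
  qed
qed

lemma fin_starts: "finite starts"
proof -
  have "starts \<subseteq> snd ` N" unfolding starts_def by force
  then show ?thesis by (rule finite_subset) (use finN in auto)
qed
text \<open>An undirected edge used in both directions would be a cycle of length two.\<close>

lemma E_inj:
  assumes "(u, e, v) \<in> N" "(u', e, v') \<in> N" shows "u = u' \<and> v = v'"
proof -
  have "(u = u' \<and> v = v') \<or> (u = v' \<and> v = u')" using trav[OF assms(1)] trav[OF assms(2)] by (auto simp: traverses_def)
  moreover have False if h: "u = v'" "v = u'"
  proof -
    have "u \<noteq> s" "v \<noteq> t" "v \<noteq> s" "u \<noteq> t" using h not_s[OF assms(1)] not_s[OF assms(2)] not_t[OF assms(1)] not_t[OF assms(2)] by auto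
    then have "(u, v) \<in> nxt" "(v, u) \<in> nxt" using assms h unfolding nxt_def by auto
    then show False using nxt_acyclic by (meson acyclic_def trancl.intros)
  qed
  ultimately show ?thesis by auto
qed
end

definition arcs :: "('v list \<times> 'e list) set \<Rightarrow> ('v \<times> 'e \<times> 'v) set" where
  "arcs P = {(vs ! i, es ! i, vs ! Suc i) | vs es i. (vs, es) \<in> P \<and> i < length es}"

lemma linkage_arcs:
  assumes P: "finite P" "disjoint_paths G s t P" and st: "s \<noteq> t"
    and s: "\<And>u e. \<not> traverses G u e s" and t: "\<And>u e. \<not> traverses G t e u"
  shows "linkage G s t (arcs P)"
    and "card {(e, v). (s, e, v) \<in> arcs P} = card P"
    and "{e. \<exists>u v. (u, e, v) \<in> arcs P} = (\<Union>p\<in>P. set (snd p))"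
proof -
  have path: "length vs = Suc (length es)" "distinct vs" "vs ! 0 = s" "vs ! length es = t"
    "\<And>i. i < length es \<Longrightarrow> traverses G (vs ! i) (es ! i) (vs ! Suc i)" "0 < length es" if "(vs, es) \<in> P" for vs es
  proof -
    have "(vs, es) \<in> paths G s t" using that P(2) by (auto simp: disjoint_paths_def)
    then have 1: "length vs = Suc (length es)" "distinct vs" "hd vs = s" "last vs = t"
      "\<And>i. i < length es \<Longrightarrow> traverses G (vs ! i) (es ! i) (vs ! Suc i)" by (auto simp: paths_def)
    have "vs \<noteq> []" using 1(1) by auto
    then show "length vs = Suc (length es)" "distinct vs" "vs ! 0 = s" "vs ! length es = t"
      "\<And>i. i < length es \<Longrightarrow> traverses G (vs ! i) (es ! i) (vs ! Suc i)"
      using 1 by (simp_all add: hd_conv_nth last_conv_nth)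
    then show "0 < length es" using st by (cases "length es") auto
  qed
  have idx: "vs ! i = vs ! j \<longleftrightarrow> i = j" if "(vs, es) \<in> P" "i \<le> length es" "j \<le> length es" for vs es i j
    using path[OF that(1)] that(2,3) by (simp add: nth_eq_iff_index_eq)
  have same: "vs = vs' \<and> es = es' \<and> i = j"
    if "(vs, es) \<in> P" "(vs', es') \<in> P" "i \<le> length es" "j \<le> length es'" "vs ! i = vs' ! j" "vs ! i \<noteq> s" "vs ! i \<noteq> t"
    for vs es vs' es' i j
  proof -
    have "vs ! i \<in> set vs" using that(3) path(1)[OF that(1)] by (intro nth_mem) simp
    moreover have "vs' ! j \<in> set vs'" using that(4) path(1)[OF that(2)] by (intro nth_mem) simp
    ultimately have "vs ! i \<in> set vs \<inter> set vs'" using that(5) by simp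
    then have "(vs, es) = (vs', es')" using P(2) that unfolding disjoint_paths_def by fastforce
    then show ?thesis using idx[OF that(1,3)] that by auto
  qed
  have s0: "vs ! i = s \<longleftrightarrow> i = 0" "vs ! i = t \<longleftrightarrow> i = length es" if "(vs, es) \<in> P" "i \<le> length es" for vs es i
    using idx[OF that, of 0] idx[OF that, of "length es"] path(3,4)[OF that(1)] by auto
  let ?R = "{(a, b). a \<noteq> s \<and> b \<noteq> t \<and> (\<exists>e. (a, e, b) \<in> arcs P)}"
  have reach: "(vs ! i, vs ! j) \<in> ?R\<^sup>*" if "(vs, es) \<in> P" "0 < i" "i \<le> j" "j < length es" for vs es i j
    using that(3,4)
  proof (induction j rule: dec_induct)
    case (step j)
    have "(vs ! j, es ! j, vs ! Suc j) \<in> arcs P" using that(1) step.prems unfolding arcs_def by fastforce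
    then have "(vs ! j, vs ! Suc j) \<in> ?R"
      using that(2) step s0[OF that(1), of j] s0[OF that(1), of "Suc j"] by auto
    then show ?case using step by (meson Suc_lessD rtrancl.rtrancl_into_rtrancl)
  qed auto
  have fin: "finite (arcs P)"
  proof -
    have "arcs P \<subseteq> (\<Union>(vs, es)\<in>P. (\<lambda>i. (vs ! i, es ! i, vs ! Suc i)) ` {..<length es})" unfolding arcs_def by auto
    then show ?thesis by (rule finite_subset) (use P(1) in auto)
  qed
  show "linkage G s t (arcs P)"
  proof
    show "\<And>u e v. (u, e, v) \<in> arcs P \<Longrightarrow> traverses G u e v" using path(5) by (auto simp: arcs_def)
    then show "\<And>u e v. (u, e, v) \<in> arcs P \<Longrightarrow> v \<noteq> s" "\<And>u e v. (u, e, v) \<in> arcs P \<Longrightarrow> u \<noteq> t" using s t by blast+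
    show "e = e' \<and> v = v'" if "(u, e, v) \<in> arcs P" "(u, e', v') \<in> arcs P" "u \<noteq> s" for u e v e' v'
    proof -
      from that(1) obtain vs es i where 1: "(vs, es) \<in> P" "i < length es" "u = vs ! i" "e = es ! i" "v = vs ! Suc i" by (auto simp: arcs_def)
      from that(2) obtain vs' es' j where 2: "(vs', es') \<in> P" "j < length es'" "u = vs' ! j" "e' = es' ! j" "v' = vs' ! Suc j" by (auto simp: arcs_def)
      have "u \<noteq> t" using s0(2)[OF 1(1), of i] 1 by auto
      then show ?thesis using same[OF 1(1) 2(1), of i j] 1 2 that(3) by auto
    qed
    show "e = e' \<and> u = u'" if "(u, e, v) \<in> arcs P" "(u', e', v) \<in> arcs P" "v \<noteq> t" for u e v e' u'
    proof -
      from that(1) obtain vs es i where 1: "(vs, es) \<in> P" "i < length es" "u = vs ! i" "e = es ! i" "v = vs ! Suc i" by (auto simp: arcs_def)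
      from that(2) obtain vs' es' j where 2: "(vs', es') \<in> P" "j < length es'" "u' = vs' ! j" "e' = es' ! j" "v = vs' ! Suc j" by (auto simp: arcs_def)
      have "v \<noteq> s" using s0(1)[OF 1(1), of "Suc i"] 1 by auto
      then show ?thesis using same[OF 1(1) 2(1), of "Suc i" "Suc j"] 1 2 that(3) by auto
    qed
    show "\<exists>l e'. (v, l) \<in> ?R\<^sup>* \<and> (l, e', t) \<in> arcs P" if "(u, e, v) \<in> arcs P" "v \<noteq> t" for u e v
    proof -
      from that(1) obtain vs es i where 1: "(vs, es) \<in> P" "i < length es" "u = vs ! i" "e = es ! i" "v = vs ! Suc i" by (auto simp: arcs_def)
      then have i: "Suc i < length es" using s0(2)[OF 1(1), of "Suc i"] that(2) by (cases "Suc i = length es") auto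
      have "(v, vs ! (length es - 1)) \<in> ?R\<^sup>*" using reach[OF 1(1), of "Suc i" "length es - 1"] i 1 by auto
      moreover have "(vs ! (length es - 1), es ! (length es - 1), t) \<in> arcs P" unfolding arcs_def using 1(1) path(4,6)[OF 1(1)]
        by (intro CollectI exI[of _ vs] exI[of _ es] exI[of _ "length es - 1"]) auto
      ultimately show ?thesis by blast
    qed
    show "\<exists>b e'. (b, u) \<in> ?R\<^sup>* \<and> (s, e', b) \<in> arcs P" if "(u, e, v) \<in> arcs P" "u \<noteq> s" for u e v
    proof -
      from that(1) obtain vs es i where 1: "(vs, es) \<in> P" "i < length es" "u = vs ! i" "e = es ! i" "v = vs ! Suc i" by (auto simp: arcs_def)
      then have i: "0 < i" using s0(1)[OF 1(1), of i] that(2) by (cases i) auto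
      have "(vs ! 1, u) \<in> ?R\<^sup>*" using reach[OF 1(1), of 1 i] i 1 by auto
      moreover have "(s, es ! 0, vs ! 1) \<in> arcs P" unfolding arcs_def using 1(1) path(3,6)[OF 1(1)]
        by (intro CollectI exI[of _ vs] exI[of _ es] exI[of _ 0]) auto
      ultimately show ?thesis by blast
    qed
  qed (use st fin in auto)
  \<comment> \<open>First edge and second vertex identify the path: two paths with the same second
    vertex other than \<open>t\<close> coincide by disjointness, and a single-edge path is
    determined by its edge.\<close>
  define h where "h = (\<lambda>(vs :: 'a list, es :: 'b list). (es ! 0, vs ! 1))"
  have S: "{(e, v). (s, e, v) \<in> arcs P} = h ` P"
  proof (intro set_eqI iffI)
    fix a assume "a \<in> {(e, v). (s, e, v) \<in> arcs P}"
    then obtain vs es i where 1: "(vs, es) \<in> P" "i < length es" "s = vs ! i" "a = (es ! i, vs ! Suc i)" by (auto simp: arcs_def)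
    then have "i = 0" using s0(1)[OF 1(1), of i] by auto
    then show "a \<in> h ` P" using 1 by (force simp: h_def)
  next
    fix a assume "a \<in> h ` P"
    then obtain vs es where 1: "(vs, es) \<in> P" "a = (es ! 0, vs ! 1)" by (auto simp: h_def)
    then show "a \<in> {(e, v). (s, e, v) \<in> arcs P}" using path(3,6)[OF 1(1)] unfolding arcs_def by auto
  qed
  have inj: "inj_on h P"
  proof (rule inj_onI)
    fix p q assume pq: "p \<in> P" "q \<in> P" "h p = h q"
    obtain vs es where p: "p = (vs, es)" by force
    obtain vs' es' where q: "q = (vs', es')" by force
    have P1: "(vs, es) \<in> P" and P2: "(vs', es') \<in> P" using pq p q by auto
    have eq: "es ! 0 = es' ! 0" "vs ! 1 = vs' ! 1" using pq p q by (auto simp: h_def)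
    show "p = q"
    proof (cases "vs ! 1 = t")
      case True
      have l: "length es = 1" "length es' = 1"
        using s0(2)[OF P1, of 1] s0(2)[OF P2, of 1] path(6)[OF P1] path(6)[OF P2] True eq by auto
      have "vs = [s, t]" using path(1,3,4)[OF P1] l by (auto simp: length_Suc_conv nth_Cons')
      moreover have "vs' = [s, t]" using path(1,3,4)[OF P2] l by (auto simp: length_Suc_conv nth_Cons')
      moreover have "es = es'" using l eq by (auto simp: length_Suc_conv)
      ultimately show ?thesis using p q by simp
    next
      case False
      then show ?thesis
        using same[OF P1 P2, of 1 1] s0(1)[OF P1, of 1] path(6)[OF P1] path(6)[OF P2] eq p q by auto
    qed
  qed
  show "card {(e, v). (s, e, v) \<in> arcs P} = card P" unfolding S by (rule card_image[OF inj])
  show "{e. \<exists>u v. (u, e, v) \<in> arcs P} = (\<Union>p\<in>P. set (snd p))"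
    unfolding arcs_def by (fastforce simp: in_set_conv_nth)
qed

lemma cycle_perm:
  assumes "finite U" "D \<subseteq> U \<times> U" "\<not> acyclic D"
  obtains C \<sigma> where "C \<noteq> {}" "C \<subseteq> U" "bij_betw \<sigma> C C" "\<And>u. u \<in> C \<Longrightarrow> (u, \<sigma> u) \<in> D"
proof -
  define ok where "ok C \<longleftrightarrow> C \<noteq> {} \<and> C \<subseteq> U \<and> (\<forall>u\<in>C. \<exists>z\<in>C. (u, z) \<in> D)" for C
  have "ok {u. (u, u) \<in> D\<^sup>+}" unfolding ok_def
  proof (intro conjI ballI)
    show "{u. (u, u) \<in> D\<^sup>+} \<noteq> {}" using assms(3) by (auto simp: acyclic_def)
    show "{u. (u, u) \<in> D\<^sup>+} \<subseteq> U" using trancl_subset_Sigma[OF assms(2)] by auto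
    fix u assume "u \<in> {u. (u, u) \<in> D\<^sup>+}"
    then obtain z where "(u, z) \<in> D" "(z, u) \<in> D\<^sup>*" by (auto dest: tranclD)
    then show "\<exists>z\<in>{u. (u, u) \<in> D\<^sup>+}. (u, z) \<in> D" by (auto intro: rtrancl_into_trancl1)
  qed
  from ex_has_least_nat[of ok, OF this, of card] obtain C where "ok C" and C2: "\<forall>C'. ok C' \<longrightarrow> card C \<le> card C'"
    by (elim exE conjE) (rule that)
  then have C: "C \<noteq> {}" "C \<subseteq> U" "\<forall>u\<in>C. \<exists>z\<in>C. (u, z) \<in> D" by (simp_all add: ok_def)
  from C(3) obtain \<sigma> where \<sigma>: "\<And>u. u \<in> C \<Longrightarrow> \<sigma> u \<in> C \<and> (u, \<sigma> u) \<in> D" by metis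
  have fin: "finite C" using C(2) assms(1) finite_subset by blast
  have "ok (\<sigma> ` C)" unfolding ok_def using C(1,2) \<sigma> by blast
  then have "card C \<le> card (\<sigma> ` C)" using C2 by blast
  then have "\<sigma> ` C = C" using \<sigma> fin by (intro card_subset_eq) (auto simp: card_image_le le_antisym)
  then have "bij_betw \<sigma> C C" using fin by (simp add: bij_betw_def finite_surj_inj)
  then show thesis using C(1,2) \<sigma> by (intro that) auto
qed

section \<open>Consecutive marked vertices on a path\<close>

definition skip :: "'v rel \<Rightarrow> 'v set \<Rightarrow> 'v rel" where "skip r U = {(a, b) \<in> r. b \<notin> U}"
definition nextU :: "'v rel \<Rightarrow> 'v set \<Rightarrow> 'v \<Rightarrow> 'v \<Rightarrow> bool" where
  "nextU r U x w \<longleftrightarrow> w \<in> U \<and> (\<exists>m. (x, m) \<in> (skip r U)\<^sup>* \<and> (m, w) \<in> r)"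
definition jump :: "'v rel \<Rightarrow> 'v set \<Rightarrow> 'v rel" where "jump r U = {(u, w). u \<in> U \<and> nextU r U u w}"

lemma skip_sub: "skip r U \<subseteq> r" by (auto simp: skip_def)
lemma skip_rtrancl: "(x, y) \<in> (skip r U)\<^sup>* \<Longrightarrow> (x, y) \<in> r\<^sup>*" using rtrancl_mono[OF skip_sub] by blast
lemma skip_end: "(x, y) \<in> (skip r U)\<^sup>* \<Longrightarrow> y \<in> U \<Longrightarrow> y = x"
  by (erule rtranclE) (auto simp: skip_def)

lemma inj_chain:
  assumes "single_valued (r\<inverse>)" "(x, m) \<in> r\<^sup>*" "(y, m) \<in> r\<^sup>*"
  shows "(x, y) \<in> r\<^sup>* \<or> (y, x) \<in> r\<^sup>*"
  using assms(2,3)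
proof (induction rule: rtrancl_induct)
  case (step m m')
  from step.prems show ?case
  proof (cases rule: rtranclE)
    case base then show ?thesis using step.hyps by (metis rtrancl.rtrancl_into_rtrancl)
  next
    case (step z)
    then have "z = m" using assms(1) \<open>(m, m') \<in> r\<close> by (auto simp: single_valued_def)
    then show ?thesis using step \<open>(y, m) \<in> r\<^sup>* \<Longrightarrow> _\<close> by blast
  qed
qed auto

lemma inj_chain_start:
  assumes "single_valued (r\<inverse>)" "(x, m) \<in> r\<^sup>*" "(y, m) \<in> r\<^sup>*" "x \<notin> Range r" "y \<notin> Range r"
  shows "x = y"
  using inj_chain[OF assms(1-3)] assms(4,5) by (metis Range.intros rtranclE)

text \<open>Backwards from \<open>m\<close> the walk does not branch, and it must stop at the first
  member of \<open>U\<close> or at the beginning of the path. Both \<open>x\<close> and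
  \<open>y\<close> are this stopping point.\<close>

lemma skip_owner:
  assumes "single_valued (r\<inverse>)" "(x, m) \<in> (skip r U)\<^sup>*" "(y, m) \<in> (skip r U)\<^sup>*"
    "x \<in> U \<or> x \<notin> Range r" "y \<in> U \<or> y \<notin> Range r"
  shows "x = y"
proof -
  have sv: "single_valued ((skip r U)\<inverse>)" using assms(1) by (auto simp: single_valued_def skip_def)
  show ?thesis by (rule inj_chain_start[OF sv assms(2,3)]) (use assms(4,5) in \<open>auto simp: skip_def\<close>)
qed

lemma nextU_inj:
  assumes "single_valued (r\<inverse>)" "nextU r U x w" "nextU r U y w" "x \<in> U \<or> x \<notin> Range r" "y \<in> U \<or> y \<notin> Range r"
  shows "x = y"
proof -
  obtain m m' where "(x, m) \<in> (skip r U)\<^sup>*" "(m, w) \<in> r" "(y, m') \<in> (skip r U)\<^sup>*" "(m', w) \<in> r"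
    using assms(2,3) by (auto simp: nextU_def)
  moreover have "m = m'" using assms(1) calculation(2,4) by (auto simp: single_valued_def)
  ultimately show ?thesis using skip_owner[OF assms(1) _ _ assms(4,5)] by blast
qed

lemma nextU_sv:
  assumes "single_valued r" "nextU r U x w" "nextU r U x w'"
  shows "w = w'"
proof -
  obtain m m' where m: "(x, m) \<in> (skip r U)\<^sup>*" "(m, w) \<in> r" "(x, m') \<in> (skip r U)\<^sup>*" "(m', w') \<in> r" "w \<in> U" "w' \<in> U"
    using assms(2,3) by (auto simp: nextU_def)
  have sv: "single_valued (((skip r U)\<inverse>)\<inverse>)" using assms(1) by (auto simp: single_valued_def skip_def)
  have "(m, x) \<in> ((skip r U)\<inverse>)\<^sup>*" "(m', x) \<in> ((skip r U)\<inverse>)\<^sup>*" using m by (simp_all add: rtrancl_converse)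
  from inj_chain[OF sv this] have "(m, m') \<in> (skip r U)\<^sup>* \<or> (m', m) \<in> (skip r U)\<^sup>*" by (auto simp: rtrancl_converse)
  then show ?thesis
  proof
    assume "(m, m') \<in> (skip r U)\<^sup>*"
    then show ?thesis using m assms(1)
      by (cases rule: converse_rtranclE) (auto simp: single_valued_def skip_def)
  next
    assume "(m', m) \<in> (skip r U)\<^sup>*"
    then show ?thesis using m assms(1)
      by (cases rule: converse_rtranclE) (auto simp: single_valued_def skip_def)
  qed
qed

lemma jump_props:
  assumes "single_valued r" "single_valued (r\<inverse>)"
  shows "jump r U \<subseteq> U \<times> U" "single_valued (jump r U)" "single_valued ((jump r U)\<inverse>)"
proof -
  show "jump r U \<subseteq> U \<times> U" by (auto simp: jump_def nextU_def)
  show "single_valued (jump r U)" by (rule single_valuedI) (use nextU_sv[OF assms(1)] in \<open>simp add: jump_def, blast\<close>)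
  show "single_valued ((jump r U)\<inverse>)" by (rule single_valuedI) (use nextU_inj[OF assms(2)] in \<open>simp add: jump_def, blast\<close>)
qed

lemma skip_or_next: "(x, l) \<in> r\<^sup>* \<Longrightarrow> (x, l) \<in> (skip r U)\<^sup>* \<or> (\<exists>w. nextU r U x w)"
proof (induction rule: rtrancl_induct)
  case (step y z)
  then show ?case
    by (cases "z \<in> U") (auto simp: nextU_def skip_def intro: rtrancl.rtrancl_into_rtrancl)
qed auto

lemma nextU_trancl: "nextU r U x w \<Longrightarrow> (x, w) \<in> r\<^sup>+"
  unfolding nextU_def using skip_rtrancl by (metis rtrancl_into_trancl1)

text \<open>Two common vertices joined by an edge of both systems belong to the same unit, whichever way the
  systems run through it. A unit is represented by one of its vertices.\<close>

definition sh :: "('v \<times> 'e \<times> 'v) set \<Rightarrow> ('v \<times> 'e \<times> 'v) set \<Rightarrow> 'v rel" where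
  "sh NP NQ = {(a, b). \<exists>e. ((a, e, b) \<in> NP \<or> (b, e, a) \<in> NP) \<and> ((a, e, b) \<in> NQ \<or> (b, e, a) \<in> NQ)}"
definition rep :: "('v \<times> 'e \<times> 'v) set \<Rightarrow> ('v \<times> 'e \<times> 'v) set \<Rightarrow> 'v \<Rightarrow> 'v" where
  "rep NP NQ v = (SOME r. (v, r) \<in> (sh NP NQ)\<^sup>*)"

lemma sh_commute: "sh NP NQ = sh NQ NP" by (auto simp: sh_def)
lemma rep_commute: "rep NP NQ = rep NQ NP" by (simp add: rep_def sh_commute fun_eq_iff)
lemma sym_sh: "sym ((sh NP NQ)\<^sup>*)" by (rule sym_rtrancl) (auto simp: sh_def sym_def)
lemma rep_sh: "(v, rep NP NQ v) \<in> (sh NP NQ)\<^sup>*" unfolding rep_def by (rule someI[of _ v]) simp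
lemma rep_eq: "(v, w) \<in> (sh NP NQ)\<^sup>* \<Longrightarrow> rep NP NQ v = rep NP NQ w"
proof -
  assume a: "(v, w) \<in> (sh NP NQ)\<^sup>*"
  then have "(w, v) \<in> (sh NP NQ)\<^sup>*" using sym_sh by (metis symD)
  then have "(v, r) \<in> (sh NP NQ)\<^sup>* \<longleftrightarrow> (w, r) \<in> (sh NP NQ)\<^sup>*" for r using a by (meson rtrancl_trans)
  then show ?thesis by (simp add: rep_def)
qed
lemma rep_rep: "rep NP NQ (rep NP NQ v) = rep NP NQ v" using rep_eq[OF rep_sh] by metis

section \<open>Units of two path systems and rerouting along residual cycles\<close>

locale linkage_pair = P: linkage G s1 t1 NP + Q: linkage G s2 t2 NQ
  for G :: "('v, 'e) mixed_graph" and s1 t1 NP s2 t2 NQ +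
  assumes undir: "\<And>u e v. u \<in> P.V \<union> Q.V \<Longrightarrow> v \<in> P.V \<union> Q.V \<Longrightarrow> traverses G u e v \<Longrightarrow> traverses G v e u"
    and ends: "{s1, t1, s2, t2} \<inter> (P.V \<union> Q.V) = {}" "{s1, t1} \<inter> {s2, t2} = {}"
begin

abbreviation "X \<equiv> P.V \<inter> Q.V"
abbreviation "S \<equiv> sh NP NQ"
abbreviation "rp \<equiv> rep NP NQ"
definition U where "U = rp ` X"

lemma sh_nxt:
  assumes "(a, b) \<in> S"
  shows "a \<in> X" "b \<in> X" "(a, b) \<in> P.nxt \<or> (b, a) \<in> P.nxt" "(a, b) \<in> Q.nxt \<or> (b, a) \<in> Q.nxt"
proof -
  obtain e where e: "(a, e, b) \<in> NP \<or> (b, e, a) \<in> NP" "(a, e, b) \<in> NQ \<or> (b, e, a) \<in> NQ" using assms by (auto simp: sh_def)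
  have P: "a \<in> P.V \<union> {s1, t1}" "b \<in> P.V \<union> {s1, t1}" using e(1) P.out_V P.in_V by blast+
  have Q: "a \<in> Q.V \<union> {s2, t2}" "b \<in> Q.V \<union> {s2, t2}" using e(2) Q.out_V Q.in_V by blast+
  show ab: "a \<in> X" "b \<in> X" using P Q ends by auto
  show "(a, b) \<in> P.nxt \<or> (b, a) \<in> P.nxt" using e(1) ab ends by (auto simp: P.nxt_def)
  show "(a, b) \<in> Q.nxt \<or> (b, a) \<in> Q.nxt" using e(2) ab ends by (auto simp: Q.nxt_def)
qed

lemma sh_X: "(a, b) \<in> S\<^sup>* \<Longrightarrow> a \<in> X \<Longrightarrow> b \<in> X"
  by (induction rule: rtrancl_induct) (use sh_nxt(2) in auto)

lemma UX: "U \<subseteq> X" using sh_X[OF rep_sh] unfolding U_def by blast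
lemma rpU: "u \<in> U \<Longrightarrow> rp u = u" by (auto simp: U_def rep_rep)
lemma rp_in: "a \<in> X \<Longrightarrow> rp a \<in> U" by (auto simp: U_def)
lemma finU: "finite U" using P.finV by (simp add: U_def)

text \<open>A unit is a contiguous run along either system. From \<open>a\<close> follow shared
  edges to the representative of its unit: each of them is a step of \<open>r\<close> forwards or
  backwards, so one stays between \<open>x\<close> and the next representative until one of the two
  is reached.\<close>

lemma zone_gen:
  assumes inj: "single_valued (r\<inverse>)" and S: "\<And>a b. (a, b) \<in> S \<Longrightarrow> (a, b) \<in> r \<or> (b, a) \<in> r"
    and x: "x \<in> U \<or> x \<notin> Range r" and a: "(x, a) \<in> (skip r U)\<^sup>*" "a \<in> X"
  shows "(x \<in> U \<and> rp a = x) \<or> nextU r U x (rp a)"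
proof -
  have "(x, y) \<in> (skip r U)\<^sup>* \<or> nextU r U x (rp a) \<or> (x \<in> U \<and> rp a = x)" if "(a, y) \<in> S\<^sup>*" for y
    using that
  proof (induction rule: rtrancl_induct)
    case base then show ?case using a by simp
  next
    case (step y y')
    have rpy: "rp a = rp y" "rp a = rp y'" using step.hyps by (auto intro: rep_eq rtrancl.rtrancl_into_rtrancl)
    show ?case
    proof (cases "(x, y) \<in> (skip r U)\<^sup>*")
      case True
      show ?thesis
      proof (cases "y \<in> U")
        case yU: True
        then show ?thesis using skip_end[OF True yU] rpy rpU by auto
      next
        case yU: False
        from S[OF step.hyps(2)] show ?thesis
        proof
          assume yy: "(y, y') \<in> r"
          show ?thesis
          proof (cases "y' \<in> U")
            case True
            then show ?thesis using yy \<open>(x, y) \<in> (skip r U)\<^sup>*\<close> rpy rpU unfolding nextU_def by auto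
          next
            case False
            then have "(y, y') \<in> skip r U" using yy by (simp add: skip_def)
            then show ?thesis using True by (meson rtrancl.rtrancl_into_rtrancl)
          qed
        next
          assume yy: "(y', y) \<in> r"
          from True show ?thesis
          proof (cases rule: rtranclE)
            case base
            then show ?thesis using x yU yy by auto
          next
            case (step y0)
            then have "y0 = y'" using inj yy by (auto simp: single_valued_def skip_def)
            then show ?thesis using step by auto
          qed
        qed
      qed
    next
      case False
      then show ?thesis using step.IH by auto
    qed
  qed
  from this[OF rep_sh] show ?thesis using skip_end rp_in[OF a(2)] by metis
qed

lemma zoneP: "x \<in> U \<or> x \<notin> Range P.nxt \<Longrightarrow> (x, a) \<in> (skip P.nxt U)\<^sup>* \<Longrightarrow> a \<in> X \<Longrightarrow> (x \<in> U \<and> rp a = x) \<or> nextU P.nxt U x (rp a)"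
  by (rule zone_gen[OF P.nxt_inj sh_nxt(3)])
lemma zoneQ: "x \<in> U \<or> x \<notin> Range Q.nxt \<Longrightarrow> (x, a) \<in> (skip Q.nxt U)\<^sup>* \<Longrightarrow> a \<in> X \<Longrightarrow> (x \<in> U \<and> rp a = x) \<or> nextU Q.nxt U x (rp a)"
  by (rule zone_gen[OF Q.nxt_inj sh_nxt(4)])

abbreviation "PN \<equiv> jump P.nxt U"
abbreviation "QN \<equiv> jump Q.nxt U"

lemmas PN_props = jump_props[OF P.nxt_sv P.nxt_inj, of U]
lemmas QN_props = jump_props[OF Q.nxt_sv Q.nxt_inj, of U]

text \<open>If every edge of \<open>P\<close> from \<open>z\<close> to \<open>w\<close> were shared,
  both representatives would lie in one unit and coincide, against acyclicity of
  \<open>P.nxt\<close>.\<close>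

lemma private_edge:
  assumes "(z, w) \<in> PN"
  obtains a e b where "(z, a) \<in> (skip P.nxt U)\<^sup>*" "(a, e, b) \<in> NP" "e \<notin> Q.E" "a \<noteq> s1"
proof (rule ccontr)
  note concl = that
  assume no: "\<not> thesis"
  have all: "e \<in> Q.E" if "(z, a) \<in> (skip P.nxt U)\<^sup>*" "(a, e, b) \<in> NP" "a \<noteq> s1" for a e b
    using that no concl by blast
  have st: "(a, b) \<in> S" if "(z, a) \<in> (skip P.nxt U)\<^sup>*" "(a, b) \<in> P.nxt" for a b
  proof -
    note hyp = that
    obtain e where e: "(a, e, b) \<in> NP" "a \<noteq> s1" using hyp(2) by (auto simp: P.nxt_def)
    then obtain u v where "(u, e, v) \<in> NQ" using all[OF hyp(1)] unfolding Q.E_def by blast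
    moreover have "(u = a \<and> v = b) \<or> (u = b \<and> v = a)"
      using P.trav[OF e(1)] Q.trav[OF calculation] by (auto simp: traverses_def)
    ultimately show ?thesis using e unfolding sh_def by blast
  qed
  have run: "(z, m) \<in> S\<^sup>*" if "(z, m) \<in> (skip P.nxt U)\<^sup>*" for m
    using that
  proof (induction rule: rtrancl_induct)
    case (step m m')
    then have "(m, m') \<in> S" using st skip_sub by blast
    then show ?case using step.IH by (meson rtrancl.rtrancl_into_rtrancl)
  qed auto
  obtain m where m: "z \<in> U" "w \<in> U" "(z, m) \<in> (skip P.nxt U)\<^sup>*" "(m, w) \<in> P.nxt"
    using assms by (auto simp: jump_def nextU_def)
  have "(z, w) \<in> S\<^sup>*" using run[OF m(3)] st[OF m(3,4)] by (meson rtrancl.rtrancl_into_rtrancl)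
  then have "z = w" using rep_eq rpU m(1,2) by metis
  moreover have "(z, w) \<in> P.nxt\<^sup>+" using assms nextU_trancl by (auto simp: jump_def)
  ultimately show False using P.nxt_acyclic by (auto simp: acyclic_def)
qed

text \<open>Each vertex belongs to the last unit representative before it on its own system, except that common
  vertices belong to their unit.\<close>

definition owns :: "'v \<Rightarrow> 'v \<Rightarrow> bool" where
  "owns u m \<longleftrightarrow> u \<in> U \<and> (if m \<in> X then rp m = u else
     m \<in> P.V \<and> (u, m) \<in> (skip P.nxt U)\<^sup>* \<or> m \<in> Q.V \<and> (u, m) \<in> (skip Q.nxt U)\<^sup>*)"

lemma owns_unique: "owns u m \<Longrightarrow> owns u' m \<Longrightarrow> u = u'"
  using skip_owner[OF P.nxt_inj] skip_owner[OF Q.nxt_inj] unfolding owns_def by (auto split: if_splits)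

lemma skip_V: "(x, m) \<in> (skip P.nxt U)\<^sup>* \<Longrightarrow> x \<in> P.V \<Longrightarrow> m \<in> P.V"
  by (erule rtranclE) (auto simp: skip_def dest: P.nxt_V)
lemma skip_VQ: "(x, m) \<in> (skip Q.nxt U)\<^sup>* \<Longrightarrow> x \<in> Q.V \<Longrightarrow> m \<in> Q.V"
  by (erule rtranclE) (auto simp: skip_def dest: Q.nxt_V)

text \<open>Along a cycle \<open>\<sigma>\<close> of the residual relation, send the path arriving at \<open>u\<close> on from \<open>\<sigma> u\<close>: it
  reaches the \<open>P\<close>-successor of \<open>\<sigma> u\<close> by at most one step along \<open>Q\<close> (in either direction). The private edge of \<open>P\<close> leaving
  a unit of the cycle becomes free. \<open>Z v\<close> collects the vertices of the new path that starts at \<open>v\<close>.\<close>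

lemma reroute:
  assumes C: "C \<noteq> {}" "C \<subseteq> U" and \<sigma>: "bij_betw \<sigma> C C" and res: "\<And>u. u \<in> C \<Longrightarrow> (u, \<sigma> u) \<in> residual PN QN"
  shows "\<exists>e\<in>P.E - Q.E. linked G (P.E \<union> Q.E - {e}) s1 t1 (card P.starts)"
proof -
  let ?sP = "skip P.nxt U" and ?sQ = "skip Q.nxt U"
  obtain c0 where c0: "c0 \<in> C" using C(1) by auto
  define z0 where "z0 = \<sigma> c0"
  have z0: "z0 \<in> C" using \<sigma> c0 by (auto simp: z0_def bij_betw_def)
  obtain w0 where "(z0, w0) \<in> PN" using res[OF c0] by (auto simp: residual_def z0_def)
  from private_edge[OF this] obtain a0 e0 b0 where e0: "(z0, a0) \<in> ?sP\<^sup>*" "(a0, e0, b0) \<in> NP" "e0 \<notin> Q.E" "a0 \<noteq> s1" .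
  have e0P: "e0 \<in> P.E - Q.E" using e0 by (auto simp: P.E_def)
  define W where "W = P.E \<union> Q.E - {e0}"
  have QW: "Q.E \<subseteq> W" using e0 by (auto simp: W_def)
  have z0U: "z0 \<in> U" using z0 C(2) by auto
  \<comment> \<open>Deleting \<open>e0\<close> affects no arc of \<open>P\<close> except in the
    stretch that follows \<open>z0\<close>. The new lanes never use this stretch, since at a unit of
    \<open>C\<close> they leave \<open>P\<close>.\<close>
  have arcW: "e \<in> W" if "(a, e, b) \<in> NP" "(x, a) \<in> ?sP\<^sup>*" "x \<in> U \<or> x \<notin> Range P.nxt" "x \<noteq> z0" for a e b x
  proof -
    have "e \<noteq> e0"
    proof
      assume "e = e0"
      then have "a = a0" using P.E_inj[OF that(1)] e0(2) by auto
      then have "x = z0" using skip_owner[OF P.nxt_inj that(2) _ that(3)] e0(1) z0U by blast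
      then show False using that(4) by simp
    qed
    then show ?thesis using that(1) by (auto simp: W_def P.E_def)
  qed
  \<comment> \<open>The order of units on the new lanes: from \<open>u\<close> in \<open>C\<close>
    one proceeds to the \<open>P\<close>-successor of \<open>\<sigma> u\<close>. Since
    \<open>\<sigma>\<close> permutes \<open>C\<close>, this relation is as injective as
    \<open>PN\<close>, so lanes never merge.\<close>
  define A where "A = {(u, w). u \<in> U \<and> ((if u \<in> C then \<sigma> u else u), w) \<in> PN}"
  have \<sigma>C: "u \<in> C \<Longrightarrow> \<sigma> u \<in> C" for u using \<sigma> by (auto simp: bij_betw_def)
  have inj\<sigma>: "inj_on \<sigma> C" using \<sigma> by (auto simp: bij_betw_def)
  have A_sub: "A \<subseteq> U \<times> U" using PN_props(1) by (auto simp: A_def)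
  have A_inj: "single_valued (A\<inverse>)"
  proof (rule single_valuedI)
    fix w u u' assume "(w, u) \<in> A\<inverse>" "(w, u') \<in> A\<inverse>"
    then have "(if u \<in> C then \<sigma> u else u) = (if u' \<in> C then \<sigma> u' else u')"
      using PN_props(3) unfolding A_def single_valued_def by blast
    then show "u = u'" using \<sigma>C inj\<sigma> by (auto split: if_splits dest: inj_onD)
  qed
  have A_range: "Range A \<subseteq> Range PN" by (auto simp: A_def)
  have A_C: "u = w \<or> (u, w) \<in> QN \<or> (w, u) \<in> QN" if "(u, w) \<in> A" "u \<in> C" for u w
    using res[OF that(2)] that PN_props(2) unfolding A_def residual_def single_valued_def by auto
  define first where "first v b \<longleftrightarrow> (if v \<in> U then b = v else nextU P.nxt U v b)" for v b
  define Z where "Z v = {m \<in> P.V - X. v \<notin> U \<and> (v, m) \<in> ?sP\<^sup>*} \<union> {m \<in> P.V \<union> Q.V. \<exists>b u. first v b \<and> (b, u) \<in> A\<^sup>* \<and> owns u m}" for v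
  have firstU: "b \<in> U" if "first v b" for v b using that by (auto simp: first_def nextU_def split: if_splits)
  have first_range: "b \<notin> Range PN" if "first v b" "v \<notin> Range P.nxt" for v b
  proof
    assume "b \<in> Range PN"
    then obtain u where u: "u \<in> U" "nextU P.nxt U u b" by (auto simp: jump_def)
    show False
    proof (cases "v \<in> U")
      case True
      then show ?thesis using that u nextU_trancl[OF u(2)] by (auto simp: first_def dest: tranclD2)
    next
      case False
      then have "nextU P.nxt U v b" using that by (simp add: first_def)
      then have "v = u" using nextU_inj[OF P.nxt_inj _ u(2)] that(2) u(1) by blast
      then show ?thesis using False u by simp
    qed
  qed
  have first_inj: "v = v'" if "first v b" "first v' b" "v \<notin> Range P.nxt" "v' \<notin> Range P.nxt" for v v' b
  proof -
    have tr: "False" if "nextU P.nxt U x y" "y \<notin> Range P.nxt" for x y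
      using nextU_trancl[OF that(1)] that(2) by (auto dest: tranclD2)
    show ?thesis using that tr nextU_inj[OF P.nxt_inj, of U v b v'] by (auto simp: first_def split: if_splits)
  qed
  have step_in: "(a, b) \<in> walk G W (Z v)" if "e \<in> W" "traverses G a e b" "a \<in> Z v" "b \<in> Z v" for a b e v
    using that by (auto simp: walk_def)
  have ZV: "Z v \<subseteq> P.V \<union> Q.V" for v by (auto simp: Z_def)
  have sym: "sym ((walk G W (Z v))\<^sup>*)" for v
  proof (rule sym_rtrancl, rule symI)
    fix a b assume "(a, b) \<in> walk G W (Z v)"
    then show "(b, a) \<in> walk G W (Z v)" using undir ZV[of v] unfolding walk_def by blast
  qed
  have ownZ: "m \<in> Z v" if "first v b" "(b, u) \<in> A\<^sup>*" "owns u m" "m \<in> P.V \<union> Q.V" for v b u m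
    using that by (auto simp: Z_def)
  have ownU: "owns u u" if "u \<in> U" for u using that UX rpU by (auto simp: owns_def)
  have orbU: "u \<in> U" if "first v b" "(b, u) \<in> A\<^sup>*" for v b u
    using that(2) firstU[OF that(1)] A_sub by (auto elim: rtranclE)
  have runP: "(x, m) \<in> (walk G W (Z v))\<^sup>*"
    if "(x, m) \<in> ?sP\<^sup>*" "x \<in> U \<or> x \<notin> Range P.nxt" "x \<noteq> z0" "\<And>m. (x, m) \<in> ?sP\<^sup>* \<Longrightarrow> m \<in> Z v" for x m v
    using that(1)
  proof (induction rule: rtrancl_induct)
    case (step a b)
    then obtain e where e: "(a, e, b) \<in> NP" by (auto simp: skip_def P.nxt_def)
    have "(a, b) \<in> walk G W (Z v)"
      using step arcW[OF e step.hyps(1) that(2,3)] P.trav[OF e] that(4) by (intro step_in[of e]) (auto intro: rtrancl.rtrancl_into_rtrancl)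
    then show ?case using step.IH by (meson rtrancl.rtrancl_into_rtrancl)
  qed auto
  have runQ: "(x, m) \<in> (walk G W (Z v))\<^sup>*"
    if "(x, m) \<in> ?sQ\<^sup>*" "\<And>m. (x, m) \<in> ?sQ\<^sup>* \<Longrightarrow> m \<in> Z v" for x m v
    using that(1)
  proof (induction rule: rtrancl_induct)
    case (step a b)
    then obtain e where e: "(a, e, b) \<in> NQ" by (auto simp: skip_def Q.nxt_def)
    then have "e \<in> W" using QW by (auto simp: Q.E_def)
    then have "(a, b) \<in> walk G W (Z v)"
      using step Q.trav[OF e] that(2) by (intro step_in[of e]) (auto intro: rtrancl.rtrancl_into_rtrancl)
    then show ?case using step.IH by (meson rtrancl.rtrancl_into_rtrancl)
  qed auto
  have nextP: "(x, w) \<in> (walk G W (Z v))\<^sup>*"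
    if "nextU P.nxt U x w" "x \<in> U \<or> x \<notin> Range P.nxt" "x \<noteq> z0" "\<And>m. (x, m) \<in> ?sP\<^sup>* \<Longrightarrow> m \<in> Z v" "w \<in> Z v" for x w v
  proof -
    note hyp = that
    obtain m where m: "(x, m) \<in> ?sP\<^sup>*" "(m, w) \<in> P.nxt" using hyp(1) unfolding nextU_def by blast
    from m(2) obtain e where e: "(m, e, w) \<in> NP" unfolding P.nxt_def by blast
    have "(m, w) \<in> walk G W (Z v)" using arcW[OF e m(1) that(2,3)] P.trav[OF e] that(4)[OF m(1)] that(5) by (intro step_in[of e])
    then show ?thesis using runP[OF m(1) that(2,3,4)] by (meson rtrancl.rtrancl_into_rtrancl)
  qed
  \<comment> \<open>A common vertex met on the stretch after \<open>u\<close> belongs to the unit of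
    \<open>u\<close> or to the next one, which for \<open>u\<close> outside \<open>C\<close> is its
    \<open>A\<close>-successor. Either way it is owned by a unit of the same lane.\<close>
  have zoneZP: "m \<in> Z v" if "(u, m) \<in> ?sP\<^sup>*" "first v b" "(b, u) \<in> A\<^sup>*" "u \<notin> C" for u m v b
  proof -
    have u: "u \<in> U" using orbU[OF that(2,3)] .
    have mV: "m \<in> P.V" using skip_V[OF that(1)] u UX by auto
    show ?thesis
    proof (cases "m \<in> X")
      case True
      from zoneP[OF _ that(1) True] u have "rp m = u \<or> (u, rp m) \<in> PN" by (auto simp: jump_def)
      then have "(b, rp m) \<in> A\<^sup>*" using that(3,4) u unfolding A_def by (auto intro: rtrancl.rtrancl_into_rtrancl)
      then show ?thesis using True rp_in[OF True] by (intro ownZ[OF that(2)]) (auto simp: owns_def)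
    next
      case False
      then show ?thesis using u mV that by (intro ownZ[OF that(2,3)]) (auto simp: owns_def)
    qed
  qed
  have zoneZQ: "m \<in> Z v" if "(u, m) \<in> ?sQ\<^sup>*" "first v b" "(b, u) \<in> A\<^sup>*" "(u, w) \<in> QN" "(b, w) \<in> A\<^sup>*" for u m v b w
  proof -
    have u: "u \<in> U" using orbU[OF that(2,3)] .
    have mV: "m \<in> Q.V" using skip_VQ[OF that(1)] u UX by auto
    show ?thesis
    proof (cases "m \<in> X")
      case True
      from zoneQ[OF _ that(1) True] u have "rp m = u \<or> (u, rp m) \<in> QN" by (auto simp: jump_def)
      then have "rp m = u \<or> rp m = w" using that(4) QN_props(2) by (auto simp: single_valued_def)
      then have "(b, rp m) \<in> A\<^sup>*" using that(3,5) by auto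
      then show ?thesis using True rp_in[OF True] by (intro ownZ[OF that(2)]) (auto simp: owns_def)
    next
      case False
      then show ?thesis using u mV that by (intro ownZ[OF that(2,3)]) (auto simp: owns_def)
    qed
  qed
  have UZ: "u \<in> Z v" if "first v b" "(b, u) \<in> A\<^sup>*" for v b u
    using orbU[OF that] UX ownU by (intro ownZ[OF that]) auto
  have QstepZ: "(u, w) \<in> (walk G W (Z v))\<^sup>*"
    if "(u, w) \<in> QN" "first v b" "(b, u) \<in> A\<^sup>*" "(b, w) \<in> A\<^sup>*" for u w v b
  proof -
    note hyp = that
    obtain m where m: "(u, m) \<in> ?sQ\<^sup>*" "(m, w) \<in> Q.nxt" using hyp(1) by (auto simp: jump_def nextU_def)
    from m(2) obtain e where e: "(m, e, w) \<in> NQ" unfolding Q.nxt_def by blast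
    have "e \<in> W" using e QW by (auto simp: Q.E_def)
    then have "(m, w) \<in> walk G W (Z v)"
      using Q.trav[OF e] zoneZQ[OF m(1) that(2,3,1,4)] UZ[OF that(2,4)] by (intro step_in[of e])
    then show ?thesis using runQ[OF m(1) zoneZQ[OF _ that(2,3,1,4)]] by (meson rtrancl.rtrancl_into_rtrancl)
  qed
  have AstepZ: "(b, u) \<in> (walk G W (Z v))\<^sup>*" if "first v b" "(b, u) \<in> A\<^sup>*" for v b u
    using that(2)
  proof (induction rule: rtrancl_induct)
    case (step u w)
    have bw: "(b, w) \<in> A\<^sup>*" using step.hyps by (meson rtrancl.rtrancl_into_rtrancl)
    have "(u, w) \<in> (walk G W (Z v))\<^sup>*"
    proof (cases "u \<in> C")
      case True
      \<comment> \<open>The \<open>Q\<close>-step may have to be taken against the direction of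
        \<open>Q\<close>; this is possible because edges between inner vertices are undirected,
        which makes the walk relation symmetric.\<close>
      from A_C[OF step.hyps(2) True] show ?thesis
        using QstepZ[OF _ that(1) step.hyps(1) bw] QstepZ[OF _ that(1) bw step.hyps(1)] sym by (auto dest: symD)
    next
      case False
      then have "nextU P.nxt U u w" "u \<in> U" using step.hyps by (auto simp: A_def jump_def)
      then show ?thesis using False z0 zoneZP[OF _ that(1) step.hyps(1) False] UZ[OF that(1) bw] by (intro nextP) auto
    qed
    then show ?case using step.IH by (meson rtrancl_trans)
  qed auto
  have startZ: "m \<in> Z v" if "(v, m) \<in> ?sP\<^sup>*" "v \<notin> U" "v \<notin> Range P.nxt" "v \<in> P.V" for v m
  proof (cases "m \<in> X")
    case True
    have "first v (rp m)" using zoneP[OF _ that(1) True] that by (auto simp: first_def)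
    then show ?thesis using True rp_in[OF True] by (intro ownZ[of v "rp m" "rp m"]) (auto simp: owns_def)
  next
    case False
    then show ?thesis using that skip_V[OF that(1,4)] by (auto simp: Z_def)
  qed
  have toT: "\<exists>l e. (x, l) \<in> (walk G W (Z v))\<^sup>* \<and> e \<in> W \<and> traverses G l e t1"
    if "x \<in> P.V" "\<not> (\<exists>w. nextU P.nxt U x w)" "x \<in> U \<or> x \<notin> Range P.nxt" "x \<noteq> z0" "\<And>m. (x, m) \<in> ?sP\<^sup>* \<Longrightarrow> m \<in> Z v" for x v
  proof -
    note hyp = that
    obtain l e where l: "(x, l) \<in> P.nxt\<^sup>*" "(l, e, t1) \<in> NP" using P.V_to_t[OF hyp(1)] by blast
    have "(x, l) \<in> ?sP\<^sup>*" using skip_or_next[OF l(1), of U] that(2) by blast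
    then show ?thesis using runP[OF _ that(3,4,5)] arcW[OF l(2) _ that(3,4)] P.trav[OF l(2)] by blast
  qed
  \<comment> \<open>The relation \<open>A\<close> may contain cycles, but they are not met here:
    \<open>A\<close> is injective and \<open>b\<close> is outside its range, so the finite orbit of
    \<open>b\<close> cannot close up and has to end.\<close>
  have last: "\<exists>u. (b, u) \<in> A\<^sup>* \<and> u \<notin> Domain A" if "first v b" "v \<notin> Range P.nxt" for v b
  proof (rule ccontr)
    assume no: "\<not> ?thesis"
    let ?O = "A\<^sup>* `` {b}"
    have "?O \<subseteq> U" using orbU[OF that(1)] by auto
    then have fin: "finite ?O" using finU finite_subset by blast
    have "\<forall>u\<in>?O. \<exists>w. (u, w) \<in> A" using no by auto
    then obtain g where g: "\<And>u. u \<in> ?O \<Longrightarrow> (u, g u) \<in> A" by metis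
    have "g ` ?O \<subseteq> ?O" using g by (auto intro: rtrancl.rtrancl_into_rtrancl)
    moreover have "inj_on g ?O"
      by (rule inj_onI) (use g A_inj in \<open>metis converseI single_valuedD\<close>)
    ultimately have "g ` ?O = ?O" using fin by (simp add: endo_inj_surj)
    then have "b \<in> g ` ?O" by auto
    then have "b \<in> Range A" using g by auto
    then show False using first_range[OF that] A_range by auto
  qed
  have lane: "v \<in> Z v \<and> s1 \<notin> Z v \<and> t1 \<notin> Z v \<and> (\<exists>l e'. (v, l) \<in> (walk G W (Z v))\<^sup>* \<and> e' \<in> W \<and> traverses G l e' t1)"
    if "(e, v) \<in> P.starts" "v \<noteq> t1" for e v
  proof -
    have N: "(s1, e, v) \<in> NP" using that by (simp add: P.starts_def)
    have vV: "v \<in> P.V" using P.in_V[OF N that(2)] .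
    have vr: "v \<notin> Range P.nxt" using P.start_not_range[OF N] .
    have final: "\<exists>l e. (b, l) \<in> (walk G W (Z v))\<^sup>* \<and> e \<in> W \<and> traverses G l e t1" if f: "first v b" for b
    proof -
      obtain u where u: "(b, u) \<in> A\<^sup>*" "u \<notin> Domain A" using last[OF f vr] by blast
      have uU: "u \<in> U" using orbU[OF f u(1)] .
      \<comment> \<open>Every unit of \<open>C\<close> has an \<open>A\<close>-successor. The lane
        therefore ends outside \<open>C\<close>, where the old path leads on to \<open>t1\<close>
        intact.\<close>
      have uC: "u \<notin> C"
      proof
        assume "u \<in> C"
        then obtain w where "(\<sigma> u, w) \<in> PN" using res by (auto simp: residual_def)
        then show False using u(2) uU \<open>u \<in> C\<close> by (auto simp: A_def)
      qed
      have "\<not> (\<exists>w. nextU P.nxt U u w)" using u(2) uU uC by (auto simp: A_def jump_def)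
      then obtain l e where "(u, l) \<in> (walk G W (Z v))\<^sup>*" "e \<in> W" "traverses G l e t1"
        using toT[of u v] uU UX uC z0 zoneZP[OF _ f u(1) uC] by blast
      then show ?thesis using AstepZ[OF f u(1)] by (meson rtrancl_trans)
    qed
    have main: "v \<in> Z v \<and> (\<exists>l e'. (v, l) \<in> (walk G W (Z v))\<^sup>* \<and> e' \<in> W \<and> traverses G l e' t1)"
    proof (cases "v \<in> U")
      case True
      then have "first v v" by (simp add: first_def)
      then show ?thesis using final UZ by blast
    next
      case False
      have vZ: "v \<in> Z v" using startZ[OF _ False vr vV] by blast
      have vz0: "v \<noteq> z0" using False z0U by auto
      show ?thesis
      proof (cases "\<exists>w. nextU P.nxt U v w")
        case True
        then obtain w where w: "nextU P.nxt U v w" by blast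
        then have f: "first v w" using False by (simp add: first_def)
        have "(v, w) \<in> (walk G W (Z v))\<^sup>*" using nextP[OF w _ vz0] vr startZ[OF _ False vr vV] UZ[OF f] by blast
        then show ?thesis using final[OF f] vZ by (meson rtrancl_trans)
      next
        case no: False
        then show ?thesis using toT[OF vV no _ vz0] vr startZ[OF _ False vr vV] vZ by blast
      qed
    qed
    then show ?thesis using ZV[of v] ends by blast
  qed
  \<comment> \<open>A common vertex of two lanes would lie on two initial stretches, or on one
    initial stretch and in the possession of a unit, or be owned by units of both lanes. In the last
    case the owner is unique, and injectivity of \<open>A\<close> leads back to the same first
    unit.\<close>
  have disj: "Z v \<inter> Z v' = {}" if "(e, v) \<in> P.starts" "(e', v') \<in> P.starts" "v \<noteq> t1" "v' \<noteq> t1" "(e, v) \<noteq> (e', v')" for e v e' v'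
  proof (rule ccontr)
    assume "Z v \<inter> Z v' \<noteq> {}"
    then obtain m where m: "m \<in> Z v" "m \<in> Z v'" by auto
    have N: "(s1, e, v) \<in> NP" "(s1, e', v') \<in> NP" using that by (simp_all add: P.starts_def)
    then have ne: "v \<noteq> v'" using that P.inn by blast
    have vr: "v \<notin> Range P.nxt" "v' \<notin> Range P.nxt" using P.start_not_range N by blast+
    have one: False if "m \<in> P.V - X" "x \<notin> U" "x \<notin> Range P.nxt" "(x, m) \<in> ?sP\<^sup>*" "owns u m" for x u
    proof -
      have "(u, m) \<in> ?sP\<^sup>*" "u \<in> U" using that by (auto simp: owns_def)
      then show False using skip_owner[OF P.nxt_inj that(4)] that by blast
    qed
    have two: False
      if h: "first v b" "(b, u) \<in> A\<^sup>*" "owns u m" "first v' b'" "(b', u') \<in> A\<^sup>*" "owns u' m" for b u b' u'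
    proof -
      have "u = u'" using owns_unique h by blast
      then have "b = b'" using inj_chain_start[OF A_inj h(2)] h(5) first_range[OF h(1) vr(1)] first_range[OF h(4) vr(2)] A_range by blast
      then show False using first_inj[OF h(1) _ vr] h(4) ne by blast
    qed
    have cases: "m \<in> P.V - X \<and> x \<notin> U \<and> (x, m) \<in> ?sP\<^sup>* \<or> (\<exists>b u. first x b \<and> (b, u) \<in> A\<^sup>* \<and> owns u m)"
      if "m \<in> Z x" for x using that unfolding Z_def by blast
    have "\<not> ((v, m) \<in> ?sP\<^sup>* \<and> (v', m) \<in> ?sP\<^sup>*)" using skip_owner[OF P.nxt_inj] vr ne by blast
    then show False using cases[OF m(1)] cases[OF m(2)] one[OF _ _ vr(1)] one[OF _ _ vr(2)] two by blast
  qed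
  have start: "e \<in> W \<and> traverses G s1 e v" if "(e, v) \<in> P.starts" for e v
  proof -
    have N: "(s1, e, v) \<in> NP" using that by (simp add: P.starts_def)
    then have "e \<noteq> e0" using P.E_inj[OF _ e0(2)] e0(4) by auto
    then show ?thesis using N P.trav[OF N] by (auto simp: W_def P.E_def)
  qed
  have "linked G W s1 t1 (card P.starts)"
    by (rule lanes[where Z = Z, OF P.fin_starts start lane disj P.st])
  then show ?thesis using e0P unfolding W_def by blast
qed

end

section \<open>Hubs of a minimal pair\<close>

text \<open>The product of the two sums contains all \<open>a k * b k\<close> and also cross terms.
  If both sums over the rest are positive, a new \<open>k\<close> with
  \<open>a k + b k \<ge> 1\<close> adds at least one cross term, which pays for counting
  \<open>k\<close>. Otherwise the products over the rest vanish.\<close>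

lemma num_bound:
  fixes a b :: "'k \<Rightarrow> nat"
  assumes "finite K" "\<And>k. k \<in> K \<Longrightarrow> a k + b k \<ge> 1"
    "sum a K \<le> A" "sum b K \<le> B" "A \<ge> 1" "B \<ge> 1"
  shows "(\<Sum>k\<in>K. a k * b k) + card K \<le> A * B + 1"
  using assms
proof (induction K arbitrary: A B rule: finite_induct)
  case (insert k K)
  \<comment> \<open>The maxima with 1 keep the induction hypothesis applicable when one of the
    remaining sums is 0.\<close>
  let ?A = "max 1 (sum a K)" and ?B = "max 1 (sum b K)"
  have IH: "(\<Sum>k\<in>K. a k * b k) + card K \<le> ?A * ?B + 1"
    using insert.prems by (intro insert.IH) auto
  have ab: "a k + b k \<ge> 1" using insert.prems(1) by simp
  have cardK: "card K \<le> sum a K + sum b K"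
  proof -
    have "card K = (\<Sum>k\<in>K. 1)" by simp
    also have "\<dots> \<le> (\<Sum>k\<in>K. a k + b k)" using insert.prems(1) by (intro sum_mono) simp
    finally show ?thesis by (simp add: sum.distrib)
  qed
  have A: "a k + sum a K \<le> A" and B: "b k + sum b K \<le> B" using insert by auto
  have "(\<Sum>k\<in>K. a k * b k) + card K + a k * b k \<le> A * B"
  proof (cases "sum a K = 0 \<or> sum b K = 0")
    case True
    then have z: "(\<Sum>k\<in>K. a k * b k) = 0" using insert.hyps(1) by auto
    show ?thesis
    proof (cases "sum a K = 0")
      case True
      have "sum b K + a k * b k \<le> max 1 (a k) * (sum b K + b k)"
        by (cases "a k = 0") (auto simp: algebra_simps)
      also have "\<dots> \<le> A * B" using A B insert.prems(4) by (intro mult_mono) auto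
      finally show ?thesis using z cardK True by simp
    next
      case False
      then have T: "sum b K = 0" using True by simp
      have "sum a K + a k * b k \<le> (sum a K + a k) * max 1 (b k)"
        by (cases "b k = 0") (auto simp: algebra_simps)
      also have "\<dots> \<le> A * B" using A B insert.prems(5) by (intro mult_mono) auto
      finally show ?thesis using z cardK T by simp
    qed
  next
    case False
    then have "?A = sum a K" "?B = sum b K" by auto
    then have "(\<Sum>k\<in>K. a k * b k) + card K \<le> sum a K * sum b K + 1" using IH by simp
    moreover have "sum a K * sum b K + 1 + a k * b k \<le> (a k + sum a K) * (b k + sum b K)"
    proof -
      have "1 \<le> sum a K * b k + a k * sum b K" using False ab by (cases "a k = 0") (auto simp: Suc_le_eq)
      then show ?thesis by (simp add: algebra_simps)
    qed
    moreover have "(a k + sum a K) * (b k + sum b K) \<le> A * B" using A B by (rule mult_mono) auto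
    ultimately show ?thesis by linarith
  qed
  then show ?case using insert.hyps by simp
qed simp

lemma prev_U: "(x, y) \<in> r\<^sup>* \<Longrightarrow> x \<in> U \<Longrightarrow> \<exists>u\<in>U. (u, y) \<in> (skip r U)\<^sup>*"
proof (induction rule: rtrancl_induct)
  case (step y z)
  then show ?case by (cases "z \<in> U") (auto simp: skip_def intro: rtrancl.rtrancl_into_rtrancl)
qed auto

text \<open>Trace each unit back to the start of its path. Two units with the same start are
  comparable along the path, and the later one would have a predecessor.\<close>

lemma first_units_card:
  assumes "linkage G s t N" "U0 \<subseteq> U" "U \<subseteq> linkage.V t N"
    "\<And>u. u \<in> U0 \<Longrightarrow> u \<notin> Range (jump (linkage.nxt s t N) U)"
    "\<And>u b. u \<in> U0 \<Longrightarrow> (b, u) \<in> (linkage.nxt s t N)\<^sup>* \<Longrightarrow> b \<in> K"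
  shows "card U0 \<le> card {a \<in> linkage.starts s N. snd a \<in> K}"
proof -
  interpret linkage G s t N by fact
  have "\<exists>a. a \<in> starts \<and> (snd a, u) \<in> nxt\<^sup>*" if "u \<in> U0" for u
    using V_from_s[of u] that assms(2,3) unfolding starts_def by force
  then obtain f where f: "\<And>u. u \<in> U0 \<Longrightarrow> f u \<in> starts \<and> (snd (f u), u) \<in> nxt\<^sup>*" by metis
  have no: "u = u'" if "u \<in> U0" "u' \<in> U0" "(u, u') \<in> nxt\<^sup>*" for u u'
  proof (rule ccontr)
    assume ne: "u \<noteq> u'"
    from that(3) show False
    proof (cases rule: rtranclE)
      case base then show ?thesis using ne by simp
    next
      case (step m)
      have "u \<in> U" "u' \<in> U" using that(1,2) assms(2) by auto
      obtain w where "w \<in> U" "(w, m) \<in> (skip nxt U)\<^sup>*" using prev_U[OF step(1) \<open>u \<in> U\<close>] by blast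
      then have "nextU nxt U w u'" using step(2) \<open>u' \<in> U\<close> by (auto simp: nextU_def)
      then have "(w, u') \<in> jump nxt U" using \<open>w \<in> U\<close> by (simp add: jump_def)
      then show ?thesis using assms(4)[OF that(2)] by auto
    qed
  qed
  have inj: "inj_on f U0"
  proof (rule inj_onI)
    fix u u' assume u: "u \<in> U0" "u' \<in> U0" "f u = f u'"
    have sv: "single_valued ((nxt\<inverse>)\<inverse>)" using nxt_sv by simp
    have "(u, snd (f u)) \<in> (nxt\<inverse>)\<^sup>*" "(u', snd (f u)) \<in> (nxt\<inverse>)\<^sup>*"
      using f[OF u(1)] f[OF u(2)] u(3) by (simp_all add: rtrancl_converse)
    from inj_chain[OF sv this] have "(u, u') \<in> nxt\<^sup>* \<or> (u', u) \<in> nxt\<^sup>*" by (auto simp: rtrancl_converse)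
    then show "u = u'" using no u by blast
  qed
  have fin: "finite {a \<in> starts. snd a \<in> K}"
  proof -
    have "starts \<subseteq> snd ` N" unfolding starts_def by force
    then have "finite starts" by (rule finite_subset) (use finN in auto)
    then show ?thesis by simp
  qed
  show ?thesis by (rule card_inj_on_le[OF inj _ fin]) (use f assms(5) in auto)
qed

context linkage begin
lemma in_out:
  assumes "v \<in> V"
  obtains u e e' w where "(u, e, v) \<in> N" "(v, e', w) \<in> N" "e \<noteq> e'" "{e \<in> E. tail G e = v \<or> head G e = v} = {e, e'}"
proof -
  obtain u e where 1: "(u, e, v) \<in> N" using assms by (auto simp: V_def)
  obtain e' w where 2: "(v, e', w) \<in> N" using V_out[OF assms] by blast
  have vst: "v \<noteq> s" "v \<noteq> t" using V_st[OF assms] by auto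
  have ne: "e \<noteq> e'"
  proof
    assume "e = e'"
    then have "(v, e, v) \<in> N" using E_inj[OF 1, of v w] 2 1 by auto
    then have "(v, v) \<in> nxt" using vst by (auto simp: nxt_def)
    then show False using nxt_acyclic by (auto simp: acyclic_def)
  qed
  have "{e \<in> E. tail G e = v \<or> head G e = v} = {e, e'}"
  proof (intro equalityI subsetI)
    fix f assume "f \<in> {e \<in> E. tail G e = v \<or> head G e = v}"
    then obtain a b where f: "(a, f, b) \<in> N" "tail G f = v \<or> head G f = v" by (auto simp: E_def)
    then have "a = v \<or> b = v" using trav[OF f(1)] by (auto simp: traverses_def)
    then show "f \<in> {e, e'}" using out[OF f(1), of e' w] inn[OF f(1), of u e] 1 2 vst by auto
  next
    fix f assume "f \<in> {e, e'}"
    then show "f \<in> {e \<in> E. tail G e = v \<or> head G e = v}" using 1 2 trav[OF 1] trav[OF 2] by (auto simp: E_def traverses_def)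
  qed
  then show thesis using that 1 2 ne by blast
qed

lemma no_inc: assumes "v \<notin> V" "v \<noteq> s" "v \<noteq> t" shows "{e \<in> E. tail G e = v \<or> head G e = v} = {}"
proof (rule ccontr)
  assume "\<not> ?thesis"
  then obtain a f b where f: "(a, f, b) \<in> N" "tail G f = v \<or> head G f = v" by (auto simp: E_def)
  then have "a = v \<or> b = v" using trav[OF f(1)] by (auto simp: traverses_def)
  then show False using out_V in_V f assms by blast
qed
lemma inc_ex: assumes "v \<in> V" shows "\<exists>e\<in>E. tail G e = v \<or> head G e = v"
proof -
  obtain u e e' w where "{e \<in> E. tail G e = v \<or> head G e = v} = {e, e'}" by (rule in_out[OF assms])
  then show ?thesis by blast
qed
lemma inc_card: assumes "v \<noteq> s" "v \<noteq> t"
  shows "finite {e \<in> E. tail G e = v \<or> head G e = v}" "card {e \<in> E. tail G e = v \<or> head G e = v} \<le> 2"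
proof -
  have "finite {e \<in> E. tail G e = v \<or> head G e = v} \<and> card {e \<in> E. tail G e = v \<or> head G e = v} \<le> 2"
  proof (cases "v \<in> V")
    case True
    obtain u e e' w where "{e \<in> E. tail G e = v \<or> head G e = v} = {e, e'}" by (rule in_out[OF True])
    then show ?thesis by (simp add: card_insert_if)
  next
    case False
    then show ?thesis by (simp add: no_inc[OF False assms])
  qed
  then show "finite {e \<in> E. tail G e = v \<or> head G e = v}" "card {e \<in> E. tail G e = v \<or> head G e = v} \<le> 2" by blast+
qed

end

section \<open>Components and branch vertices of an edge set\<close>

definition covered :: "('v, 'e) mixed_graph \<Rightarrow> 'e set \<Rightarrow> 'v set \<Rightarrow> 'v set" where
  "covered G W I = {v \<in> I. \<exists>e\<in>W. tail G e = v \<or> head G e = v}"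
text \<open>Later \<open>I\<close> is the set of nonterminal vertices: terminals do not join
  components, and a vertex without edges of \<open>W\<close> forms none. With the same
  \<open>I\<close>, \<open>branch\<close> is the set of hubs of the subnetwork.\<close>

definition comps :: "('v, 'e) mixed_graph \<Rightarrow> 'e set \<Rightarrow> 'v set \<Rightarrow> 'v set set" where
  "comps G W I = (\<lambda>v. (walk G W I)\<^sup>* `` {v}) ` covered G W I"
definition branch :: "('v, 'e) mixed_graph \<Rightarrow> 'e set \<Rightarrow> 'v set \<Rightarrow> 'v set" where
  "branch G W I = {v \<in> I. card {e \<in> W. tail G e = v \<or> head G e = v} \<ge> 3}"

text \<open>Minimality is demanded for private edges only. Deleting one of them leaves the other
  system intact, so it suffices to exclude that the damaged system can be restored.\<close>

locale min_pair = linkage_pair +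
  fixes I
  assumes VI: "P.V \<union> Q.V \<subseteq> I" and I: "I \<inter> {s1, t1, s2, t2} = {}"
    and symI: "\<And>u e v. u \<in> I \<Longrightarrow> v \<in> I \<Longrightarrow> traverses G u e v \<Longrightarrow> traverses G v e u"
    and minP: "\<And>e. e \<in> P.E - Q.E \<Longrightarrow> \<not> linked G (P.E \<union> Q.E - {e}) s1 t1 (card P.starts)"
    and minQ: "\<And>e. e \<in> Q.E - P.E \<Longrightarrow> \<not> linked G (P.E \<union> Q.E - {e}) s2 t2 (card Q.starts)"
begin

abbreviation "W \<equiv> P.E \<union> Q.E"
abbreviation "cc \<equiv> (walk G W I)\<^sup>*"

lemma acyP: "acyclic (residual PN QN)"
proof (rule ccontr)
  assume "\<not> ?thesis"
  moreover have "residual PN QN \<subseteq> U \<times> U" using PN_props(1) QN_props(1) by (auto simp: residual_def)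
  ultimately obtain C \<sigma> where "C \<noteq> {}" "C \<subseteq> U" "bij_betw \<sigma> C C" "\<And>u. u \<in> C \<Longrightarrow> (u, \<sigma> u) \<in> residual PN QN"
    using cycle_perm[OF finU] by metis
  from reroute[OF this] show False using minP by blast
qed

lemma acyQ: "acyclic (residual QN PN)"
proof (rule ccontr)
  interpret sw: linkage_pair G s2 t2 NQ s1 t1 NP
    by unfold_locales (use undir ends in auto)
  have U: "sw.U = U" unfolding sw.U_def U_def rep_commute[of NQ NP] by (simp add: Int_commute)
  assume "\<not> ?thesis"
  moreover have "residual QN PN \<subseteq> U \<times> U" using PN_props(1) QN_props(1) by (auto simp: residual_def)
  ultimately obtain C \<sigma> where "C \<noteq> {}" "C \<subseteq> U" "bij_betw \<sigma> C C" "\<And>u. u \<in> C \<Longrightarrow> (u, \<sigma> u) \<in> residual QN PN"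
    using cycle_perm[OF finU] by metis
  from sw.reroute[unfolded U, OF this] show False using minQ by (auto simp: Un_commute)
qed

lemma nxt_walk: "P.nxt \<subseteq> walk G W I" "Q.nxt \<subseteq> walk G W I"
proof -
  show "P.nxt \<subseteq> walk G W I"
  proof (clarify)
    fix a b assume ab: "(a, b) \<in> P.nxt"
    then obtain e where "(a, e, b) \<in> NP" by (auto simp: P.nxt_def)
    then show "(a, b) \<in> walk G W I" using P.nxt_V[OF ab] VI P.trav unfolding walk_def P.E_def by blast
  qed
  show "Q.nxt \<subseteq> walk G W I"
  proof (clarify)
    fix a b assume ab: "(a, b) \<in> Q.nxt"
    then obtain e where "(a, e, b) \<in> NQ" by (auto simp: Q.nxt_def)
    then show "(a, b) \<in> walk G W I" using Q.nxt_V[OF ab] VI Q.trav unfolding walk_def Q.E_def by blast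
  qed
qed

lemma sym_cc: "sym cc" by (rule sym_rtrancl) (use symI in \<open>auto simp: sym_def walk_def\<close>)
lemma nxt_cc: "(a, b) \<in> P.nxt\<^sup>* \<Longrightarrow> (a, b) \<in> cc" "(a, b) \<in> Q.nxt\<^sup>* \<Longrightarrow> (a, b) \<in> cc"
  using rtrancl_mono nxt_walk by blast+

text \<open>Jumps between units stay inside a component, so restriction to \<open>K\<close> creates
  no new first units and each factor is bounded by the starts that lead into
  \<open>K\<close>.\<close>

lemma unit_comp:
  assumes K: "K = cc `` {v}"
  shows "card (U \<inter> K) \<le> card {a \<in> P.starts. snd a \<in> K} * card {a \<in> Q.starts. snd a \<in> K}"
proof -
  have Kc: "b \<in> K" if "a \<in> K" "(a, b) \<in> cc \<or> (b, a) \<in> cc" for a b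
    using that K sym_cc by (auto dest: symD intro: rtrancl_trans)
  let ?U = "U \<inter> K"
  let ?P = "PN \<inter> K \<times> K" and ?Q = "QN \<inter> K \<times> K"
  have PNc: "(u, w) \<in> cc" if "(u, w) \<in> PN" for u w using that nxt_cc(1)[OF trancl_into_rtrancl[OF nextU_trancl]] by (auto simp: jump_def)
  have QNc: "(u, w) \<in> cc" if "(u, w) \<in> QN" for u w using that nxt_cc(2)[OF trancl_into_rtrancl[OF nextU_trancl]] by (auto simp: jump_def)
  have "card ?U \<le> card (?U - Range ?P) * card (?U - Range ?Q)"
  proof (rule crossing_bound)
    show "acyclic (residual ?P ?Q)" by (rule acyclic_subset[OF acyP]) (unfold residual_def, blast)
    show "acyclic (residual ?Q ?P)" by (rule acyclic_subset[OF acyQ]) (unfold residual_def, blast)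
    show "finite ?U" using finU by simp
    show "?P \<subseteq> ?U \<times> ?U" "?Q \<subseteq> ?U \<times> ?U" using PN_props(1) QN_props(1) by auto
    show "single_valued ?P" "single_valued ?Q" using PN_props(2) QN_props(2) single_valued_subset by blast+
    have "?P\<inverse> \<subseteq> PN\<inverse>" "?Q\<inverse> \<subseteq> QN\<inverse>" by auto
    then show "single_valued (?P\<inverse>)" "single_valued (?Q\<inverse>)" using PN_props(3) QN_props(3) single_valued_subset by blast+
  qed
  also have "\<dots> \<le> card {a \<in> P.starts. snd a \<in> K} * card {a \<in> Q.starts. snd a \<in> K}"
  proof (rule mult_mono)
    show "card (?U - Range ?P) \<le> card {a \<in> P.starts. snd a \<in> K}"
    proof (rule first_units_card[OF P.linkage_axioms])
      show "u \<notin> Range PN" if "u \<in> ?U - Range ?P" for u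
      proof
        assume "u \<in> Range PN"
        then obtain w where "(w, u) \<in> PN" by auto
        then show False using that PNc Kc by blast
      qed
      show "\<And>u b. u \<in> ?U - Range ?P \<Longrightarrow> (b, u) \<in> P.nxt\<^sup>* \<Longrightarrow> b \<in> K" using Kc nxt_cc(1) by blast
    qed (use UX in auto)
    show "card (?U - Range ?Q) \<le> card {a \<in> Q.starts. snd a \<in> K}"
    proof (rule first_units_card[OF Q.linkage_axioms])
      show "u \<notin> Range QN" if "u \<in> ?U - Range ?Q" for u
      proof
        assume "u \<in> Range QN"
        then obtain w where "(w, u) \<in> QN" by auto
        then show False using that QNc Kc by blast
      qed
      show "\<And>u b. u \<in> ?U - Range ?Q \<Longrightarrow> (b, u) \<in> Q.nxt\<^sup>* \<Longrightarrow> b \<in> K" using Kc nxt_cc(2) by blast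
    qed (use UX in auto)
  qed auto
  finally show ?thesis .
qed

lemma covered: "covered G W I = P.V \<union> Q.V"
proof (intro equalityI subsetI)
  fix v assume v: "v \<in> covered G W I"
  then have "v \<in> I" and "v \<noteq> s1" "v \<noteq> t1" "v \<noteq> s2" "v \<noteq> t2" using I by (auto simp: covered_def)
  then show "v \<in> P.V \<union> Q.V" using P.no_inc[of v] Q.no_inc[of v] v by (auto simp: covered_def)
next
  fix v assume v: "v \<in> P.V \<union> Q.V"
  then show "v \<in> covered G W I"
  proof
    assume "v \<in> P.V" from P.inc_ex[OF this] show ?thesis using VI v unfolding covered_def by blast
  next
    assume "v \<in> Q.V" from Q.inc_ex[OF this] show ?thesis using VI v unfolding covered_def by blast
  qed
qed

text \<open>Each component contains the first inner vertex of some path of one of the systems, which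
  is the condition \<open>a k + b k \<ge> 1\<close> of \<open>num_bound\<close>.\<close>

theorem units_bound:
  assumes "card P.starts = C1" "card Q.starts = C2" "C1 \<ge> 1" "C2 \<ge> 1"
  shows "card U + card (comps G W I) \<le> C1 * C2 + 1"
proof -
  let ?K = "comps G W I"
  let ?a = "\<lambda>K. card {a \<in> P.starts. snd a \<in> K}" and ?b = "\<lambda>K. card {a \<in> Q.starts. snd a \<in> K}"
  have fin: "finite ?K" unfolding comps_def covered using P.finV Q.finV by simp
  have disj: "K \<inter> K' = {}" if "K \<in> ?K" "K' \<in> ?K" "K \<noteq> K'" for K K'
  proof (rule ccontr)
    note hyp = that
    assume "K \<inter> K' \<noteq> {}"
    then obtain m where m: "m \<in> K" "m \<in> K'" by auto
    obtain v v' where v: "K = cc `` {v}" "K' = cc `` {v'}" using hyp by (auto simp: comps_def)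
    have "(v, m) \<in> cc" "(m, v) \<in> cc" "(v', m) \<in> cc" "(m, v') \<in> cc" using m v sym_cc by (auto dest: symD)
    then have "K = K'" unfolding v by (auto intro: rtrancl_trans)
    then show False using that by simp
  qed
  have sums: "(\<Sum>K\<in>?K. card {a \<in> S. snd a \<in> K}) \<le> card S" if "finite S" for S :: "('b \<times> 'a) set"
  proof -
    have "(\<Sum>K\<in>?K. card {a \<in> S. snd a \<in> K}) = card (\<Union>K\<in>?K. {a \<in> S. snd a \<in> K})"
    proof (rule card_UN_disjoint[symmetric])
      show "finite ?K" by (rule fin)
      show "\<forall>K\<in>?K. finite {a \<in> S. snd a \<in> K}" using that by simp
      show "\<forall>K\<in>?K. \<forall>j\<in>?K. K \<noteq> j \<longrightarrow> {a \<in> S. snd a \<in> K} \<inter> {a \<in> S. snd a \<in> j} = {}" using disj by blast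
    qed
    also have "\<dots> \<le> card S" using that by (intro card_mono) auto
    finally show ?thesis .
  qed
  have U: "U = (\<Union>K\<in>?K. U \<inter> K)"
    using UX unfolding comps_def covered by auto
  have "card U = (\<Sum>K\<in>?K. card (U \<inter> K))"
  proof (subst U, rule card_UN_disjoint)
    show "finite ?K" by (rule fin)
    show "\<forall>K\<in>?K. finite (U \<inter> K)" using finU by simp
    show "\<forall>K\<in>?K. \<forall>j\<in>?K. K \<noteq> j \<longrightarrow> (U \<inter> K) \<inter> (U \<inter> j) = {}" using disj by blast
  qed
  also have "\<dots> \<le> (\<Sum>K\<in>?K. ?a K * ?b K)"
    by (rule sum_mono) (use unit_comp in \<open>auto simp: comps_def\<close>)
  finally have 1: "card U \<le> (\<Sum>K\<in>?K. ?a K * ?b K)" .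
  have "(\<Sum>K\<in>?K. ?a K * ?b K) + card ?K \<le> C1 * C2 + 1"
  proof (rule num_bound[OF fin])
    fix K assume "K \<in> ?K"
    then obtain v where v: "K = cc `` {v}" "v \<in> P.V \<union> Q.V" unfolding comps_def covered by auto
    have mem: "b \<in> K" if "(b, v) \<in> cc" for b using that v(1) sym_cc by (auto dest: symD)
    from v(2) show "?a K + ?b K \<ge> 1"
    proof
      assume "v \<in> P.V"
      then obtain b e where b: "(b, v) \<in> P.nxt\<^sup>*" "(s1, e, b) \<in> NP" using P.V_from_s by blast
      have "(e, b) \<in> {a \<in> P.starts. snd a \<in> K}" using b(2) mem[OF nxt_cc(1)[OF b(1)]] by (simp add: P.starts_def)
      then have "0 < ?a K" using P.fin_starts by (auto simp: card_gt_0_iff)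
      then show ?thesis by linarith
    next
      assume "v \<in> Q.V"
      then obtain b e where b: "(b, v) \<in> Q.nxt\<^sup>*" "(s2, e, b) \<in> NQ" using Q.V_from_s by blast
      have "(e, b) \<in> {a \<in> Q.starts. snd a \<in> K}" using b(2) mem[OF nxt_cc(2)[OF b(1)]] by (simp add: Q.starts_def)
      then have "0 < ?b K" using Q.fin_starts by (auto simp: card_gt_0_iff)
      then show ?thesis by linarith
    qed
  qed (use assms sums[OF P.fin_starts] sums[OF Q.fin_starts] in auto)
  then show ?thesis using 1 by linarith
qed

definition Xin where "Xin = {v \<in> X. \<exists>u e. (u, e, v) \<in> NP \<and> e \<notin> Q.E}"
definition Xout where "Xout = {v \<in> X. \<exists>w e. (v, e, w) \<in> NP \<and> e \<notin> Q.E}"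

text \<open>A system has exactly two edges at each of its inner vertices. Three edges therefore
  require a common vertex at which some edge of the first system is not in the second.\<close>

lemma branch_sub: "branch G W I \<subseteq> Xin \<union> Xout"
proof
  fix v assume v: "v \<in> branch G W I"
  let ?p = "{e \<in> P.E. tail G e = v \<or> head G e = v}" and ?q = "{e \<in> Q.E. tail G e = v \<or> head G e = v}"
  have nt: "v \<noteq> s1" "v \<noteq> t1" "v \<noteq> s2" "v \<noteq> t2" using v I by (auto simp: branch_def)
  have W: "{e \<in> W. tail G e = v \<or> head G e = v} = ?p \<union> ?q" by auto
  then have c: "card (?p \<union> ?q) \<ge> 3" using v by (simp add: branch_def)
  have cp: "card ?p \<le> 2 \<and> finite ?p" using P.inc_card[OF nt(1,2)] by simp
  have cq: "card ?q \<le> 2 \<and> finite ?q" using Q.inc_card[OF nt(3,4)] by simp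
  have vX: "v \<in> X"
  proof (rule ccontr)
    assume "v \<notin> X"
    then have "?p = {} \<or> ?q = {}" using P.no_inc[OF _ nt(1,2)] Q.no_inc[OF _ nt(3,4)] by blast
    then show False
    proof
      assume "?p = {}" then show False using c cq by (simp only: Un_empty_left) linarith
    next
      assume "?q = {}" then show False using c cp by (simp only: Un_empty_right) linarith
    qed
  qed
  then have "v \<in> P.V" by simp
  then obtain u e e' w where p: "(u, e, v) \<in> NP" "(v, e', w) \<in> NP" "e \<noteq> e'" "?p = {e, e'}" by (rule P.in_out)
  show "v \<in> Xin \<union> Xout"
  proof (rule ccontr)
    assume "v \<notin> Xin \<union> Xout"
    then have "e \<in> Q.E" "e' \<in> Q.E" using p vX by (auto simp: Xin_def Xout_def)
    then have "?p \<subseteq> ?q" using p(4) by auto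
    then have "?p \<union> ?q = ?q" by auto
    then show False using c cq by (simp only:) linarith
  qed
qed

definition PS where "PS = {(a, b). \<exists>e. (a, e, b) \<in> NP \<and> a \<noteq> s1 \<and> b \<noteq> t1 \<and> e \<in> Q.E}"

lemma S_PS: "(a, b) \<in> S \<Longrightarrow> (a, b) \<in> PS \<or> (b, a) \<in> PS"
proof -
  assume h: "(a, b) \<in> S"
  have ab: "a \<in> X" "b \<in> X" using sh_nxt[OF h] by auto
  from h obtain e where e: "(a, e, b) \<in> NP \<or> (b, e, a) \<in> NP" "(a, e, b) \<in> NQ \<or> (b, e, a) \<in> NQ" by (auto simp: sh_def)
  then have "e \<in> Q.E" by (auto simp: Q.E_def)
  then show ?thesis using e(1) ab ends unfolding PS_def by blast
qed

lemma PS_inj: "single_valued PS" "single_valued (PS\<inverse>)"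
  using P.out P.inn unfolding PS_def single_valued_def by blast+

lemma S_chain:
  assumes r: "single_valued (r\<inverse>)" and S: "\<And>a b. (a, b) \<in> S \<Longrightarrow> (a, b) \<in> r \<or> (b, a) \<in> r"
    and v: "v \<notin> Range r" and "(v, y) \<in> S\<^sup>*"
  shows "(v, y) \<in> r\<^sup>*"
  using assms(4)
proof (induction rule: rtrancl_induct)
  case (step y z)
  from S[OF step.hyps(2)] show ?case
  proof
    assume "(y, z) \<in> r" then show ?thesis using step.IH by (meson rtrancl.rtrancl_into_rtrancl)
  next
    assume zy: "(z, y) \<in> r"
    from step.IH show ?thesis
    proof (cases rule: rtranclE)
      case base then show ?thesis using zy v by auto
    next
      case (step m)
      then have "m = z" using r zy by (auto simp: single_valued_def)
      then show ?thesis using step by simp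
    qed
  qed
qed auto

lemma Xin_range: "v \<in> Xin \<Longrightarrow> v \<notin> Range PS"
  using P.inn P.V_st unfolding Xin_def PS_def by blast
lemma Xout_range: "v \<in> Xout \<Longrightarrow> v \<notin> Range (PS\<inverse>)"
  using P.out P.V_st unfolding Xout_def PS_def by blast

text \<open>Shared edges link a unit to a single run along \<open>P\<close>, and such a run has one
  beginning and one end. Applied to \<open>PS\<close> and its converse, this leaves each unit at
  most one vertex of \<open>Xin\<close> and one of \<open>Xout\<close>.\<close>

lemma rep_inj:
  assumes r: "single_valued (r\<inverse>)" and S: "\<And>a b. (a, b) \<in> S \<Longrightarrow> (a, b) \<in> r \<or> (b, a) \<in> r"
    and Y: "\<And>v. v \<in> Y \<Longrightarrow> v \<notin> Range r"
  shows "inj_on rp Y"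
proof (rule inj_onI)
  fix v v' assume h: "v \<in> Y" "v' \<in> Y" "rp v = rp v'"
  have "(v, rp v) \<in> S\<^sup>*" "(rp v, v') \<in> S\<^sup>*" using rep_sh[of v NP NQ] rep_sh[of v' NP NQ] h(3) sym_sh[of NP NQ] by (auto dest: symD)
  then have "(v, v') \<in> S\<^sup>*" by (rule rtrancl_trans)
  from S_chain[OF r S Y[OF h(1)] this] show "v = v'" using Y[OF h(2)] by (auto elim: rtranclE)
qed

theorem branch_le: "card (branch G W I) \<le> 2 * card U"
proof -
  have "inj_on rp Xin" by (rule rep_inj[OF PS_inj(2) S_PS Xin_range])
  moreover have "inj_on rp Xout"
    by (rule rep_inj[where r = "PS\<inverse>"]) (use PS_inj(1) S_PS Xout_range in auto)
  moreover have "rp ` Xin \<subseteq> U" "rp ` Xout \<subseteq> U" by (auto simp: Xin_def Xout_def U_def)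
  ultimately have "card Xin \<le> card U" "card Xout \<le> card U" using finU card_inj_on_le by blast+
  moreover have "finite (Xin \<union> Xout)" using P.finV by (simp add: Xin_def Xout_def)
  ultimately show ?thesis using card_mono[OF _ branch_sub] card_Un_le[of Xin Xout] by fastforce
qed

end

section \<open>Small subnetworks\<close>

lemma finite_paths:
  assumes "finite_loopless G" shows "finite (paths G s t)"
proof -
  let ?n = "card (insert s (verts G))"
  have fin: "finite (insert s (verts G))" "finite (edges G)" using assms by (auto simp: finite_loopless_def)
  have "paths G s t \<subseteq> {vs. set vs \<subseteq> insert s (verts G) \<and> length vs \<le> ?n} \<times> {es. set es \<subseteq> edges G \<and> length es \<le> ?n}"
  proof
    fix p assume p0: "p \<in> paths G s t"
    obtain vs es where pe: "p = (vs, es)" by force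
    then have p: "(vs, es) \<in> paths G s t" using p0 by simp
    then have l: "length vs = Suc (length es)" and d: "distinct vs" and h: "hd vs = s"
      and tr: "\<And>i. i < length es \<Longrightarrow> traverses G (vs ! i) (es ! i) (vs ! Suc i)" by (auto simp: paths_def)
    have V: "set vs \<subseteq> insert s (verts G)"
    proof
      fix v assume "v \<in> set vs"
      then obtain i where i: "i < length vs" "v = vs ! i" by (auto simp: in_set_conv_nth)
      show "v \<in> insert s (verts G)"
      proof (cases i)
        case 0
        then show ?thesis using i h l by (cases vs) auto
      next
        case (Suc k)
        then show ?thesis using tr[of k] i l assms by (auto simp: traverses_def finite_loopless_def)
      qed
    qed
    have "length vs = card (set vs)" using d by (simp add: distinct_card)
    also have "\<dots> \<le> ?n" by (rule card_mono[OF fin(1) V])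
    finally have n: "length vs \<le> ?n" .
    have "set es \<subseteq> edges G" using tr by (auto simp: traverses_def in_set_conv_nth)
    then show "p \<in> {vs. set vs \<subseteq> insert s (verts G) \<and> length vs \<le> ?n} \<times> {es. set es \<subseteq> edges G \<and> length es \<le> ?n}"
      using V n l pe by simp
  qed
  then show ?thesis
    by (rule finite_subset) (intro finite_cartesian_product finite_lists_length_le fin)
qed

lemma finite_cards:
  assumes "finite_loopless G" shows "finite {card P | P. disjoint_paths G s t P}"
proof -
  have "{card P | P. disjoint_paths G s t P} \<subseteq> card ` Pow (paths G s t)" by (auto simp: disjoint_paths_def)
  then show ?thesis by (rule finite_subset) (simp add: finite_paths[OF assms])
qed

lemma cut_ge: "finite_loopless G \<Longrightarrow> disjoint_paths G s t P \<Longrightarrow> card P \<le> min_vertex_cut G s t"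
  unfolding min_vertex_cut_def by (rule Max_ge[OF finite_cards]) auto

lemma cut_attained:
  assumes "finite_loopless G"
  obtains P where "finite P" "disjoint_paths G s t P" "card P = min_vertex_cut G s t"
proof -
  have "disjoint_paths G s t {}" by (simp add: disjoint_paths_def)
  then have "{card P | P. disjoint_paths G s t P} \<noteq> {}" by blast
  from Max_in[OF finite_cards[OF assms] this] obtain P where P: "disjoint_paths G s t P" "card P = min_vertex_cut G s t"
    unfolding min_vertex_cut_def by auto
  have "finite P" using P(1) finite_paths[OF assms] finite_subset by (auto simp: disjoint_paths_def)
  then show thesis using P by (rule that)
qed

lemma linked_cut: assumes "finite_loopless G" shows "linked G (edges G) s t (min_vertex_cut G s t)"
proof -
  obtain P where P: "finite P" "disjoint_paths G s t P" "card P = min_vertex_cut G s t" by (rule cut_attained[OF assms])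
  have "set (snd p) \<subseteq> edges G" if "p \<in> P" for p
  proof -
    have "p \<in> paths G s t" using that P(2) by (auto simp: disjoint_paths_def)
    then show ?thesis by (auto simp: paths_def traverses_def in_set_conv_nth)
  qed
  then show ?thesis using P unfolding linked_def by blast
qed

lemma linked_mono: "linked G W s t k \<Longrightarrow> W \<subseteq> W' \<Longrightarrow> linked G W' s t k"
  unfolding linked_def by blast

lemma linked_restrict:
  assumes "finite_loopless G" "W \<subseteq> edges G"
  shows "linked G W s t k \<Longrightarrow> k \<le> min_vertex_cut (G\<lparr>edges := W\<rparr>) s t"
    and "min_vertex_cut (G\<lparr>edges := W\<rparr>) s t \<le> min_vertex_cut G s t"
proof -
  let ?H = "G\<lparr>edges := W\<rparr>"
  have H: "finite_loopless ?H" using assms finite_subset by (auto simp: finite_loopless_def)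
  show "k \<le> min_vertex_cut ?H s t" if k: "linked G W s t k"
  proof -
    obtain P where P: "disjoint_paths G s t P" "card P = k" "\<forall>p\<in>P. set (snd p) \<subseteq> W" using k by (auto simp: linked_def)
    have "P \<subseteq> paths ?H s t"
    proof
      fix p assume p: "p \<in> P"
      then have "p \<in> paths G s t" "set (snd p) \<subseteq> W" using P by (auto simp: disjoint_paths_def)
      moreover obtain vs es where pe: "p = (vs, es)" by force
      moreover have "es ! i \<in> W" if "i < length es" for i using calculation(2) pe nth_mem[OF that] by auto
      ultimately show "p \<in> paths ?H s t" by (auto simp: paths_def traverses_def)
    qed
    then have "disjoint_paths ?H s t P" using P(1) by (simp add: disjoint_paths_def)
    from cut_ge[OF H this] show ?thesis using P(2) by simp
  qed
  obtain P where P: "disjoint_paths ?H s t P" "card P = min_vertex_cut ?H s t" by (rule cut_attained[OF H])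
  have "paths ?H s t \<subseteq> paths G s t" using assms(2) by (auto simp: paths_def traverses_def)
  then have "disjoint_paths G s t P" using P(1) by (auto simp: disjoint_paths_def)
  from cut_ge[OF assms(1) this] show "min_vertex_cut ?H s t \<le> min_vertex_cut G s t" using P(2) by simp
qed

section \<open>Adding one path with few new edges\<close>

lemma path_walk:
  assumes "trail G vs es" "i \<le> j" "j \<le> length es" "\<And>k. i \<le> k \<Longrightarrow> k < j \<Longrightarrow> es ! k \<in> D"
    "\<And>k. i \<le> k \<Longrightarrow> k \<le> j \<Longrightarrow> vs ! k \<in> Z"
  shows "(vs ! i, vs ! j) \<in> (walk G D Z)\<^sup>*"
  using assms(2-)
proof (induction j rule: dec_induct)
  case (step j)
  have "es ! j \<in> D" "vs ! j \<in> Z" "vs ! Suc j \<in> Z" using step.prems(2)[of j] step.prems(3)[of j] step.prems(3)[of "Suc j"] step.hyps by auto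
  moreover have "traverses G (vs ! j) (es ! j) (vs ! Suc j)" using assms(1) step.prems(1) by (auto simp: trail_def)
  ultimately have "(vs ! j, vs ! Suc j) \<in> walk G D Z" unfolding walk_def by auto
  moreover have "(vs ! i, vs ! j) \<in> (walk G D Z)\<^sup>*" using step by auto
  ultimately show ?case by (meson rtrancl.rtrancl_into_rtrancl)
qed auto

lemma trail_edge_index:
  assumes "trail G vs es" "a < length es" "i \<le> length es"
    "tail G (es ! a) = vs ! i \<or> head G (es ! a) = vs ! i"
  shows "i = a \<or> i = Suc a"
proof -
  have "vs ! i = vs ! a \<or> vs ! i = vs ! Suc a" using assms by (auto simp: trail_def traverses_def)
  then show ?thesis using assms by (auto simp: trail_def nth_eq_iff_index_eq)
qed

lemma trail_edges_distinct: assumes "trail G vs es" shows "distinct es"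
proof (unfold distinct_conv_nth, intro allI impI)
  fix a b assume ab: "a < length es" "b < length es" "a \<noteq> b"
  show "es ! a \<noteq> es ! b"
  proof
    assume eq: "es ! a = es ! b"
    have t: "traverses G (vs ! a) (es ! a) (vs ! Suc a)" using assms ab by (auto simp: trail_def)
    have "a = b \<or> a = Suc b" using trail_edge_index[OF assms ab(2), of a] ab t eq by (auto simp: traverses_def)
    moreover have "Suc a = b \<or> Suc a = Suc b" using trail_edge_index[OF assms ab(2), of "Suc a"] ab t eq by (auto simp: traverses_def)
    ultimately show False using ab(3) by auto
  qed
qed

lemma finite_comps: "finite I \<Longrightarrow> finite (comps G W I)" by (simp add: comps_def covered_def)

text \<open>If the path meets \<open>card J\<close> components, it creates at most
  \<open>2 * card J\<close> branch vertices, one at the entrance and one at the exit of each, while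
  all these components merge into one. The net growth is at most 2, also when no component is met
  and the path may form a new one.\<close>

lemma add_path:
  assumes finI: "finite I" and finW: "finite W"
    and symI: "\<And>u e v. u \<in> I \<Longrightarrow> v \<in> I \<Longrightarrow> traverses G u e v \<Longrightarrow> traverses G v e u"
    and st: "s \<notin> I" "t \<notin> I" "s \<noteq> t"
    and inner: "\<And>vs es i. (vs, es) \<in> paths G s t \<Longrightarrow> 0 < i \<Longrightarrow> i < length es \<Longrightarrow> vs ! i \<in> I"
    and ex: "paths G s t \<noteq> {}"
  shows "\<exists>vs es. (vs, es) \<in> paths G s t \<and>
     card (branch G (W \<union> set es) I) + 2 * card (comps G (W \<union> set es) I) \<le> card (branch G W I) + 2 * card (comps G W I) + 2"
proof -
  obtain p where "p \<in> paths G s t" using ex by auto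
  from ex_has_least_nat[of "\<lambda>p. p \<in> paths G s t", OF this, of "\<lambda>p. card (set (snd p) - W)"]
  obtain q where q: "q \<in> paths G s t" "\<And>p. p \<in> paths G s t \<Longrightarrow> card (set (snd q) - W) \<le> card (set (snd p) - W)" by blast
  obtain vs es where vses: "q = (vs, es)" by force
  have path: "(vs, es) \<in> paths G s t" using q vses by simp
  have min: "card (set es - W) \<le> card (set es' - W)" if "(vs', es') \<in> paths G s t" for vs' es' using q(2)[OF that] vses by simp
  have tr: "trail G vs es" "hd vs = s" "last vs = t" using path by (auto simp: paths_trail)
  have len: "length vs = Suc (length es)" and dv: "distinct vs" using tr(1) by (auto simp: trail_def)
  have ne: "vs \<noteq> []" using len by auto
  have v0: "vs ! 0 = s" and vl: "vs ! length es = t" using tr len ne by (simp_all add: hd_conv_nth last_conv_nth)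
  have innr: "vs ! i \<in> I" if "0 < i" "i < length es" for i using inner[OF path that] .
  have inI: "0 < i \<and> i < length es" if "vs ! i \<in> I" "i \<le> length es" for i
    using that st v0 vl by (cases "i = 0"; cases "i = length es") auto
  define cc where "cc = (walk G W I)\<^sup>*"
  define cl where "cl v = cc `` {v}" for v
  have sym_cc: "sym cc" unfolding cc_def by (rule sym_rtrancl) (use symI in \<open>auto simp: sym_def walk_def\<close>)
  have cl_eq: "(v, w) \<in> cc" if "cl v = cl w" for v w
  proof -
    have "w \<in> cl w" by (simp add: cl_def cc_def)
    then show ?thesis using that by (auto simp: cl_def)
  qed
  \<comment> \<open>Otherwise the part of the path between the two visits could be replaced by a
    walk in \<open>W\<close> inside the component, and after loop erasure fewer new edges would be
    used.\<close>
  have contig: "es ! k \<in> W" if ij: "0 < i" "i \<le> k" "k < j" "j < length es" "cl (vs ! i) = cl (vs ! j)" for i j k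
  proof (rule ccontr)
    assume k: "es ! k \<notin> W"
    let ?D = "set (take i es) \<union> W \<union> set (drop j es)"
    have "(vs ! 0, vs ! i) \<in> (walk G ?D UNIV)\<^sup>*"
      by (rule path_walk[OF tr(1)]) (use ij in \<open>auto simp: in_set_conv_nth\<close>)
    moreover have "(vs ! i, vs ! j) \<in> (walk G ?D UNIV)\<^sup>*"
    proof -
      have "walk G W I \<subseteq> walk G ?D UNIV" by (auto simp: walk_def)
      then show ?thesis using cl_eq[OF ij(5)] rtrancl_mono unfolding cc_def by blast
    qed
    moreover have "(vs ! j, vs ! length es) \<in> (walk G ?D UNIV)\<^sup>*"
    proof (rule path_walk[OF tr(1)])
      fix k assume "j \<le> k" "k < length es"
      then have "es ! k \<in> set (drop j es)" unfolding in_set_conv_nth by (intro exI[of _ "k - j"]) auto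
      then show "es ! k \<in> ?D" by simp
    qed (use ij in auto)
    ultimately have "(s, t) \<in> (walk G ?D UNIV)\<^sup>*" unfolding v0 vl by (meson rtrancl_trans)
    from walk_trail[OF this] obtain vs' es' where p': "trail G vs' es'" "hd vs' = s" "last vs' = t" "set es' \<subseteq> ?D" by auto
    have "es ! k \<notin> set (take i es)" "es ! k \<notin> set (drop j es)"
      using trail_edges_distinct[OF tr(1)] ij by (auto simp: in_set_conv_nth nth_eq_iff_index_eq)
    then have "set es' - W \<subseteq> (set es - W) - {es ! k}"
      using p'(4) set_take_subset[of i es] set_drop_subset[of j es] by blast
    then have "card (set es' - W) \<le> card ((set es - W) - {es ! k})" by (rule card_mono[rotated]) simp
    also have "\<dots> < card (set es - W)" by (rule card_Diff1_less) (use k ij in auto)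
    finally show False using min[of vs' es'] p' by (simp add: paths_trail)
  qed
  let ?W = "W \<union> set es"
  define N where "N = {i. 0 < i \<and> i < length es \<and> vs ! i \<in> covered G W I}"
  define J where "J = (\<lambda>i. cl (vs ! i)) ` N"
  define NA where "NA = {i \<in> N. es ! (i - 1) \<notin> W}"
  define NB where "NB = {i \<in> N. es ! i \<notin> W}"
  have finN: "finite N" unfolding N_def by simp
  \<comment> \<open>After the first visit to a component no new edge leads into a later vertex of
    the path in it, and before the last visit none leads out. So \<open>NA\<close> and
    \<open>NB\<close> each have at most one index per component.\<close>
  have lt: "cl (vs ! i) \<noteq> cl (vs ! j)" if "i \<in> N" "j \<in> N" "i < j" "es ! (j - 1) \<notin> W \<or> es ! i \<notin> W" for i j
    using contig[of i "j - 1" j] contig[of i i j] that by (auto simp: N_def)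
  have cardA: "card NA \<le> card J" unfolding J_def
  proof (rule card_inj_on_le[where f = "\<lambda>i. cl (vs ! i)"])
    show "inj_on (\<lambda>i. cl (vs ! i)) NA"
      by (rule linorder_inj_onI') (use lt in \<open>auto simp: NA_def\<close>)
  qed (use finN in \<open>auto simp: NA_def\<close>)
  have cardB: "card NB \<le> card J" unfolding J_def
  proof (rule card_inj_on_le[where f = "\<lambda>i. cl (vs ! i)"])
    show "inj_on (\<lambda>i. cl (vs ! i)) NB"
      by (rule linorder_inj_onI') (use lt in \<open>auto simp: NB_def\<close>)
  qed (use finN in \<open>auto simp: NB_def\<close>)
  have on_path: "\<exists>i. 0 < i \<and> i < length es \<and> v = vs ! i" if "v \<in> I" "e \<in> set es" "tail G e = v \<or> head G e = v" for v e
  proof -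
    note hyp = that
    obtain a where a: "a < length es" "e = es ! a" using hyp(2) by (auto simp: in_set_conv_nth)
    then have "v = vs ! a \<or> v = vs ! Suc a" using tr(1) hyp(3) by (auto simp: trail_def traverses_def)
    then show ?thesis using a inI[of a] inI[of "Suc a"] that(1) by auto
  qed
  have inc_path: "{e \<in> set es. tail G e = vs ! i \<or> head G e = vs ! i} \<subseteq> {es ! (i - 1), es ! i}" if "i < length es" for i
  proof
    fix e assume "e \<in> {e \<in> set es. tail G e = vs ! i \<or> head G e = vs ! i}"
    then obtain a where a: "a < length es" "e = es ! a" "tail G (es ! a) = vs ! i \<or> head G (es ! a) = vs ! i" by (auto simp: in_set_conv_nth)
    then have "i = a \<or> i = Suc a" using trail_edge_index[OF tr(1)] that by auto
    then show "e \<in> {es ! (i - 1), es ! i}" using a by auto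
  qed
  have "branch G ?W I \<subseteq> branch G W I \<union> (\<lambda>i. vs ! i) ` (NA \<union> NB)"
  proof
    fix v assume v: "v \<in> branch G ?W I"
    show "v \<in> branch G W I \<union> (\<lambda>i. vs ! i) ` (NA \<union> NB)"
    proof (cases "v \<in> branch G W I")
      case False
      have vI: "v \<in> I" and c: "card {e \<in> ?W. tail G e = v \<or> head G e = v} \<ge> 3" using v by (auto simp: branch_def)
      have "\<not> {e \<in> ?W. tail G e = v \<or> head G e = v} \<subseteq> {e \<in> W. tail G e = v \<or> head G e = v}"
      proof
        assume "{e \<in> ?W. tail G e = v \<or> head G e = v} \<subseteq> {e \<in> W. tail G e = v \<or> head G e = v}"
        then have "card {e \<in> ?W. tail G e = v \<or> head G e = v} \<le> card {e \<in> W. tail G e = v \<or> head G e = v}"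
          using finW by (intro card_mono) auto
        then show False using c False vI by (simp add: branch_def)
      qed
      then obtain e where e: "e \<in> set es" "e \<notin> W" "tail G e = v \<or> head G e = v" by auto
      obtain i where i: "0 < i" "i < length es" "v = vs ! i" using on_path[OF vI e(1,3)] by blast
      have e2: "e = es ! (i - 1) \<or> e = es ! i" using inc_path[OF i(2)] e i(3) by auto
      have "v \<in> covered G W I"
      proof (rule ccontr)
        assume "v \<notin> covered G W I"
        then have "{e \<in> ?W. tail G e = v \<or> head G e = v} \<subseteq> {es ! (i - 1), es ! i}"
          using inc_path[OF i(2)] i(3) vI by (auto simp: covered_def)
        then have "card {e \<in> ?W. tail G e = v \<or> head G e = v} \<le> card {es ! (i - 1), es ! i}" by (intro card_mono) auto
        also have "\<dots> \<le> 2" by (simp add: card_insert_if)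
        finally show False using c by simp
      qed
      then have "i \<in> N" using i by (simp add: N_def)
      then have "i \<in> NA \<union> NB" using e2 e(2) by (auto simp: NA_def NB_def)
      then show ?thesis using i(3) by auto
    qed simp
  qed
  moreover have fb: "finite (branch G W I)" using finI by (simp add: branch_def)
  ultimately have "card (branch G ?W I) \<le> card (branch G W I \<union> (\<lambda>i. vs ! i) ` (NA \<union> NB))"
    using finN by (intro card_mono) (auto simp: NA_def NB_def)
  also have "\<dots> \<le> card (branch G W I) + card ((\<lambda>i. vs ! i) ` (NA \<union> NB))" by (rule card_Un_le)
  also have "card ((\<lambda>i. vs ! i) ` (NA \<union> NB)) \<le> card (NA \<union> NB)"
    using finN by (intro card_image_le) (auto simp: NA_def NB_def)
  also have "card (NA \<union> NB) \<le> card NA + card NB" by (rule card_Un_le)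
  finally have B: "card (branch G ?W I) \<le> card (branch G W I) + 2 * card J" using cardA cardB by linarith
  define cc' where "cc' = (walk G ?W I)\<^sup>*"
  have sub: "cc \<subseteq> cc'" unfolding cc_def cc'_def by (rule rtrancl_mono) (auto simp: walk_def)
  have sym': "sym cc'" unfolding cc'_def by (rule sym_rtrancl) (use symI in \<open>auto simp: sym_def walk_def\<close>)
  have tr': "trans cc'" unfolding cc'_def by (rule trans_rtrancl)
  have JK: "J \<subseteq> comps G W I" unfolding J_def comps_def N_def cl_def cc_def by auto
  \<comment> \<open>A component that the path misses survives; everything that the path touches lies
    in the component of its first inner vertex \<open>vs ! 1\<close>.\<close>
  have "comps G ?W I \<subseteq> (\<lambda>K. cc' `` K) ` (comps G W I - J) \<union> {cc' `` {vs ! 1}}"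
  proof
    fix K' assume "K' \<in> comps G ?W I"
    then obtain v where v: "K' = cc' `` {v}" "v \<in> covered G ?W I" by (auto simp: comps_def cc'_def)
    have vI: "v \<in> I" using v(2) by (simp add: covered_def)
    show "K' \<in> (\<lambda>K. cc' `` K) ` (comps G W I - J) \<union> {cc' `` {vs ! 1}}"
    proof (cases "\<exists>i. 0 < i \<and> i < length es \<and> (v, vs ! i) \<in> cc'")
      case True
      then obtain i where i: "0 < i" "i < length es" "(v, vs ! i) \<in> cc'" by blast
      have "(vs ! 1, vs ! i) \<in> cc'" unfolding cc'_def
        by (rule path_walk[OF tr(1)]) (use i innr in auto)
      then have "(v, vs ! 1) \<in> cc'" using i(3) sym' tr' by (meson symD transD)
      then have "K' = cc' `` {vs ! 1}" unfolding v(1) using sym' tr' by (auto dest: symD transD)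
      then show ?thesis by simp
    next
      case False
      have refl: "(v, v) \<in> cc'" by (simp add: cc'_def)
      obtain e where e: "e \<in> ?W" "tail G e = v \<or> head G e = v" using v(2) by (auto simp: covered_def)
      have "e \<notin> set es" using on_path[OF vI _ e(2)] False refl by blast
      then have vc: "v \<in> covered G W I" using e vI by (auto simp: covered_def)
      have "cl v \<notin> J"
      proof
        assume "cl v \<in> J"
        then obtain i where i: "i \<in> N" "cl v = cl (vs ! i)" by (auto simp: J_def)
        have "(v, vs ! i) \<in> cc'" using cl_eq[OF i(2)] sub by blast
        then show False using False i(1) by (auto simp: N_def)
      qed
      moreover have "cl v \<in> comps G W I" using vc by (auto simp: comps_def cl_def cc_def)
      moreover have "K' = cc' `` cl v"
      proof -
        have "v \<in> cl v" by (simp add: cl_def cc_def)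
        moreover have "(v, w) \<in> cc'" if "w \<in> cl v" for w using that sub by (auto simp: cl_def)
        ultimately show ?thesis unfolding v(1) using tr' by (auto dest: transD)
      qed
      ultimately show ?thesis by blast
    qed
  qed
  then have "card (comps G ?W I) \<le> card ((\<lambda>K. cc' `` K) ` (comps G W I - J) \<union> {cc' `` {vs ! 1}})"
    by (rule card_mono[rotated]) (simp add: finite_comps[OF finI])
  also have "\<dots> \<le> card ((\<lambda>K. cc' `` K) ` (comps G W I - J)) + card {cc' `` {vs ! 1}}" by (rule card_Un_le)
  also have "\<dots> \<le> card (comps G W I - J) + 1" by (simp add: card_image_le finite_comps[OF finI])
  also have "card (comps G W I - J) = card (comps G W I) - card J"
    using JK finite_comps[OF finI] by (meson card_Diff_subset finite_subset)
  finally have "card (comps G ?W I) + card J \<le> card (comps G W I) + 1"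
    using card_mono[OF finite_comps[OF finI] JK] by linarith
  then show ?thesis using B path by (intro exI[of _ vs] exI[of _ es]) linarith
qed

text \<open>Sources and sinks are determined by the edges that remain, so a subgraph could acquire
  new ones, for instance an inner vertex left only with an edge into a sink. This condition prevents
  it and is preserved by unions.\<close>

definition thru :: "('v, 'e) mixed_graph \<Rightarrow> 'e set \<Rightarrow> 'v set \<Rightarrow> bool" where
  "thru G W I \<longleftrightarrow> (\<forall>v\<in>covered G W I. (\<exists>u. \<exists>e\<in>W. traverses G u e v) \<and> (\<exists>w. \<exists>e\<in>W. traverses G v e w))"

lemma thru_Un: "thru G W I \<Longrightarrow> thru G W' I \<Longrightarrow> thru G (W \<union> W') I"
  unfolding thru_def covered_def by blast

lemma (in linkage) thru_E: assumes "s \<notin> I" "t \<notin> I" shows "thru G E I"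
  unfolding thru_def
proof
  fix v assume v: "v \<in> covered G E I"
  then have nst: "v \<noteq> s" "v \<noteq> t" using assms by (auto simp: covered_def)
  then have vV: "v \<in> V" using no_inc[of v] v by (auto simp: covered_def)
  obtain u e where "(u, e, v) \<in> N" using vV by (auto simp: V_def)
  moreover obtain e' w where "(v, e', w) \<in> N" using V_out[OF vV] by blast
  ultimately show "(\<exists>u. \<exists>e\<in>E. traverses G u e v) \<and> (\<exists>w. \<exists>e\<in>E. traverses G v e w)"
    using trav unfolding E_def by blast
qed

section \<open>Subnetworks of a given network\<close>

locale network =
  fixes G :: "(nat, nat) mixed_graph" and S R C :: "nat list"
  assumes net: "(G, S, R) \<in> networks C"
begin

definition "I = verts G - terminals G"

lemma props:
  "finite_loopless G" "length S = length C" "length R = length C" "distinct (S @ R)" "sources G = set S" "sinks G = set R"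
  "\<And>e. e \<in> edges G \<Longrightarrow> tail G e \<notin> terminals G \<Longrightarrow> head G e \<notin> terminals G \<Longrightarrow> undirected G e"
  "\<And>i. i < length C \<Longrightarrow> min_vertex_cut G (S ! i) (R ! i) = C ! i"
  using net by (auto simp: networks_def)

lemma into_source: "v \<in> sources G \<Longrightarrow> \<not> traverses G u e v"
  using props(1) by (fastforce simp: sources_def traverses_def incident_def finite_loopless_def)
lemma out_of_sink: "v \<in> sinks G \<Longrightarrow> \<not> traverses G v e u"
  using props(1) by (fastforce simp: sinks_def traverses_def incident_def finite_loopless_def)

lemma through_I: "traverses G u e v \<Longrightarrow> traverses G v e' w \<Longrightarrow> v \<in> I"
proof -
  assume t: "traverses G u e v" "traverses G v e' w"
  then have "v \<notin> sources G" "v \<notin> sinks G" using into_source out_of_sink by blast+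
  moreover have "v \<in> verts G" using t(1) props(1) by (auto simp: traverses_def finite_loopless_def)
  ultimately show "v \<in> I" by (simp add: I_def terminals_def)
qed

lemma symI: "u \<in> I \<Longrightarrow> v \<in> I \<Longrightarrow> traverses G u e v \<Longrightarrow> traverses G v e u"
  using props(7)[of e] by (auto simp: I_def traverses_def)

lemma terminal:
  assumes "i < length C"
  shows "S ! i \<in> sources G" "R ! i \<in> sinks G" "S ! i \<notin> I" "R ! i \<notin> I" "S ! i \<noteq> R ! i"
proof -
  show a: "S ! i \<in> sources G" "R ! i \<in> sinks G" using assms props by auto
  then show "S ! i \<notin> I" "R ! i \<notin> I" by (auto simp: I_def terminals_def)
  show "S ! i \<noteq> R ! i" using a props(4-6) by auto
qed

lemma inner: assumes "(vs, es) \<in> paths G s t" "0 < i" "i < length es" shows "vs ! i \<in> I"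
proof -
  obtain k where k: "i = Suc k" using assms(2) by (cases i) auto
  have "traverses G (vs ! k) (es ! k) (vs ! i)" "traverses G (vs ! i) (es ! i) (vs ! Suc i)"
    using assms k by (auto simp: paths_def)
  then show ?thesis by (rule through_I)
qed

lemma linkage_V: assumes "linkage G s t N" shows "linkage.V t N \<subseteq> I"
proof
  interpret linkage G s t N by fact
  fix v assume v: "v \<in> V"
  then obtain u e where "(u, e, v) \<in> N" by (auto simp: V_def)
  moreover obtain e' w where "(v, e', w) \<in> N" using V_out[OF v] by blast
  ultimately show "v \<in> I" using trav through_I by blast
qed

lemma link:
  assumes "i < length C" "finite P" "disjoint_paths G (S ! i) (R ! i) P"
  shows "linkage G (S ! i) (R ! i) (arcs P)" "card (linkage.starts (S ! i) (arcs P)) = card P"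
    "linkage.E (arcs P) = (\<Union>p\<in>P. set (snd p))"
proof -
  note l = linkage_arcs[OF assms(2,3) terminal(5)[OF assms(1)] into_source[OF terminal(1)[OF assms(1)]] out_of_sink[OF terminal(2)[OF assms(1)]]]
  show L: "linkage G (S ! i) (R ! i) (arcs P)" by (rule l(1))
  interpret linkage G "S ! i" "R ! i" "arcs P" by (rule L)
  show "card starts = card P" using l(2) by (simp add: starts_def)
  show "E = (\<Union>p\<in>P. set (snd p))" using l(3) by (simp add: E_def)
qed

text \<open>Take \<open>W\<close> with the least number of edges among the edge sets that carry both
  systems. Then \<open>W\<close> consists of the edges of the two chosen systems, and loss of a
  private edge destroys its system for good, which is what \<open>min_pair\<close> requires.\<close>

lemma base:
  assumes C: "C = C1 # C2 # D" "C1 \<ge> 1" "C2 \<ge> 1"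
  obtains W where "W \<subseteq> edges G" "linked G W (S ! 0) (R ! 0) C1" "linked G W (S ! 1) (R ! 1) C2" "thru G W I"
    "card (branch G W I) + 2 * card (comps G W I) \<le> 2 * (C1 * C2 + 1)"
proof -
  define ok where "ok W \<longleftrightarrow> W \<subseteq> edges G \<and> linked G W (S ! 0) (R ! 0) C1 \<and> linked G W (S ! 1) (R ! 1) C2" for W
  have i: "0 < length C" "1 < length C" using C by auto
  have "ok (edges G)" unfolding ok_def
    using linked_cut[OF props(1), of "S ! 0" "R ! 0"] linked_cut[OF props(1), of "S ! 1" "R ! 1"] props(8)[OF i(1)] props(8)[OF i(2)] C by simp
  from ex_has_least_nat[of ok, OF this, of card] obtain W where W: "ok W" "\<And>W'. ok W' \<Longrightarrow> card W \<le> card W'" by blast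
  have finW: "finite W" using W(1) props(1) finite_subset by (auto simp: ok_def finite_loopless_def)
  obtain P where P: "finite P" "disjoint_paths G (S ! 0) (R ! 0) P" "card P = C1" "\<forall>p\<in>P. set (snd p) \<subseteq> W"
    using W(1) by (auto simp: ok_def linked_def)
  obtain Q where Q: "finite Q" "disjoint_paths G (S ! 1) (R ! 1) Q" "card Q = C2" "\<forall>p\<in>Q. set (snd p) \<subseteq> W"
    using W(1) by (auto simp: ok_def linked_def)
  interpret P: linkage G "S ! 0" "R ! 0" "arcs P" by (rule link[OF i(1) P(1,2)])
  interpret Q: linkage G "S ! 1" "R ! 1" "arcs Q" by (rule link[OF i(2) Q(1,2)])
  have PE: "P.E = (\<Union>p\<in>P. set (snd p))" by (rule link(3)[OF i(1) P(1,2)])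
  have QE: "Q.E = (\<Union>p\<in>Q. set (snd p))" by (rule link(3)[OF i(2) Q(1,2)])
  have Pc: "card P.starts = C1" using link(2)[OF i(1) P(1,2)] P(3) by simp
  have Qc: "card Q.starts = C2" using link(2)[OF i(2) Q(1,2)] Q(3) by simp
  have sub: "P.E \<union> Q.E \<subseteq> W" using P(4) Q(4) unfolding PE QE by auto
  have lP: "linked G W' (S ! 0) (R ! 0) C1" if "P.E \<subseteq> W'" for W'
    unfolding linked_def using P that unfolding PE by blast
  have lQ: "linked G W' (S ! 1) (R ! 1) C2" if "Q.E \<subseteq> W'" for W'
    unfolding linked_def using Q that unfolding QE by blast
  have "ok (P.E \<union> Q.E)" unfolding ok_def using lP lQ sub W(1) by (auto simp: ok_def)
  then have WE: "P.E \<union> Q.E = W" using W(2) sub finW by (intro card_seteq) auto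
  have no: "\<not> ok (W - {e})" if "e \<in> W" for e
    using W(2)[of "W - {e}"] that finW card_Diff1_less[of W e] by auto
  have Sn: "S ! 0 \<noteq> S ! 1" "S ! 0 \<noteq> R ! 1" "R ! 0 \<noteq> S ! 1" "R ! 0 \<noteq> R ! 1"
  proof -
    have "S ! 0 \<in> set S" "S ! 1 \<in> set S" "R ! 0 \<in> set R" "R ! 1 \<in> set R" using i props(2,3) by auto
    then show "S ! 0 \<noteq> R ! 1" "R ! 0 \<noteq> S ! 1" using props(4) by auto
    show "S ! 0 \<noteq> S ! 1" "R ! 0 \<noteq> R ! 1" using i props(2-4) by (auto simp: nth_eq_iff_index_eq)
  qed
  have VI: "P.V \<union> Q.V \<subseteq> I" using linkage_V[OF P.linkage_axioms] linkage_V[OF Q.linkage_axioms] by auto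
  have It: "I \<inter> {S ! 0, R ! 0, S ! 1, R ! 1} = {}" using terminal(3,4)[OF i(1)] terminal(3,4)[OF i(2)] by auto
  interpret M: min_pair G "S ! 0" "R ! 0" "arcs P" "S ! 1" "R ! 1" "arcs Q" I
  proof
    show "\<And>u e v. u \<in> P.V \<union> Q.V \<Longrightarrow> v \<in> P.V \<union> Q.V \<Longrightarrow> traverses G u e v \<Longrightarrow> traverses G v e u"
      using symI VI by blast
    show "{S ! 0, R ! 0, S ! 1, R ! 1} \<inter> (P.V \<union> Q.V) = {}" using VI It by blast
    show "{S ! 0, R ! 0} \<inter> {S ! 1, R ! 1} = {}" using Sn by auto
    show "\<not> linked G (P.E \<union> Q.E - {e}) (S ! 0) (R ! 0) (card P.starts)" if "e \<in> P.E - Q.E" for e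
    proof
      assume "linked G (P.E \<union> Q.E - {e}) (S ! 0) (R ! 0) (card P.starts)"
      moreover have "linked G (W - {e}) (S ! 1) (R ! 1) C2" using that WE by (intro lQ) auto
      ultimately have "ok (W - {e})" using W(1) unfolding ok_def WE Pc by auto
      then show False using no that WE by blast
    qed
    show "\<not> linked G (P.E \<union> Q.E - {e}) (S ! 1) (R ! 1) (card Q.starts)" if "e \<in> Q.E - P.E" for e
    proof
      assume "linked G (P.E \<union> Q.E - {e}) (S ! 1) (R ! 1) (card Q.starts)"
      moreover have "linked G (W - {e}) (S ! 0) (R ! 0) C1" using that WE by (intro lP) auto
      ultimately have "ok (W - {e})" using W(1) unfolding ok_def WE Qc by auto
      then show False using no that WE by blast
    qed
  qed (use symI VI It in auto)
  show thesis
  proof (rule that)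
    show "W \<subseteq> edges G" "linked G W (S ! 0) (R ! 0) C1" "linked G W (S ! 1) (R ! 1) C2" using W(1) by (auto simp: ok_def)
    show "thru G W I" unfolding WE[symmetric]
      using P.thru_E[of I] Q.thru_E[of I] terminal(3,4)[OF i(1)] terminal(3,4)[OF i(2)] by (intro thru_Un) auto
    show "card (branch G W I) + 2 * card (comps G W I) \<le> 2 * (C1 * C2 + 1)"
    proof -
      note b = M.branch_le[unfolded WE] and u = M.units_bound[OF Pc Qc C(2,3), unfolded WE]
      show ?thesis using b mult_le_mono2[OF u, of 2] by (simp add: distrib_left)
    qed
  qed
qed

lemma extend:
  assumes C: "C = C1 # C2 # replicate n 1" "C1 \<ge> 1" "C2 \<ge> 1" and m: "m \<le> n"
  shows "\<exists>W. W \<subseteq> edges G \<and> linked G W (S ! 0) (R ! 0) C1 \<and> linked G W (S ! 1) (R ! 1) C2 \<and> thru G W I \<and>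
    (\<forall>k<m. linked G W (S ! Suc (Suc k)) (R ! Suc (Suc k)) 1) \<and>
    card (branch G W I) + 2 * card (comps G W I) \<le> 2 * (C1 * C2 + 1 + m)"
  using m
proof (induction m)
  case 0
  obtain W where "W \<subseteq> edges G" "linked G W (S ! 0) (R ! 0) C1" "linked G W (S ! 1) (R ! 1) C2" "thru G W I"
    "card (branch G W I) + 2 * card (comps G W I) \<le> 2 * (C1 * C2 + 1)" by (rule base[OF C])
  then show ?case by (intro exI[of _ W]) simp
next
  case (Suc m)
  then obtain W where W: "W \<subseteq> edges G" "linked G W (S ! 0) (R ! 0) C1" "linked G W (S ! 1) (R ! 1) C2" "thru G W I"
    "\<forall>k<m. linked G W (S ! Suc (Suc k)) (R ! Suc (Suc k)) 1"
    "card (branch G W I) + 2 * card (comps G W I) \<le> 2 * (C1 * C2 + 1 + m)" by auto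
  let ?i = "Suc (Suc m)"
  have i: "?i < length C" using C Suc.prems by simp
  have Ci: "C ! ?i = 1" using C Suc.prems by simp
  have finI: "finite I" using props(1) by (auto simp: I_def finite_loopless_def)
  have finW: "finite W" using W(1) props(1) finite_subset by (auto simp: finite_loopless_def)
  have "linked G (edges G) (S ! ?i) (R ! ?i) 1" using linked_cut[OF props(1), of "S ! ?i" "R ! ?i"] props(8)[OF i] Ci by simp
  then obtain P where P: "disjoint_paths G (S ! ?i) (R ! ?i) P" "card P = 1" by (auto simp: linked_def)
  then have ne: "paths G (S ! ?i) (R ! ?i) \<noteq> {}" by (auto simp: disjoint_paths_def card_1_singleton_iff)
  obtain vs es where p: "(vs, es) \<in> paths G (S ! ?i) (R ! ?i)"
    "card (branch G (W \<union> set es) I) + 2 * card (comps G (W \<union> set es) I) \<le> card (branch G W I) + 2 * card (comps G W I) + 2"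
    using add_path[OF finI finW _ terminal(3,4,5)[OF i] _ ne] symI inner by blast
  have d: "disjoint_paths G (S ! ?i) (R ! ?i) {(vs, es)}" using p(1) by (simp add: disjoint_paths_def)
  then have l: "linked G (W \<union> set es) (S ! ?i) (R ! ?i) 1" unfolding linked_def by (intro exI[of _ "{(vs, es)}"]) simp
  interpret L: linkage G "S ! ?i" "R ! ?i" "arcs {(vs, es)}" by (rule link(1)[OF i _ d]) simp
  have "L.E = set es" using link(3)[OF i _ d] by simp
  then have th: "thru G (W \<union> set es) I" using L.thru_E[of I] terminal(3,4)[OF i] W(4) by (intro thru_Un) auto
  have sub: "W \<union> set es \<subseteq> edges G" using W(1) p(1) by (auto simp: paths_def traverses_def in_set_conv_nth)
  have "\<forall>k<Suc m. linked G (W \<union> set es) (S ! Suc (Suc k)) (R ! Suc (Suc k)) 1"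
    using W(5) l linked_mono[of G W _ _ 1 "W \<union> set es"] by (auto simp: less_Suc_eq)
  then show ?case
    using sub th W(2,3,6) p(2) linked_mono[of G W _ _ _ "W \<union> set es"] by (intro exI[of _ "W \<union> set es"]) auto
qed

theorem small_subnetwork:
  assumes C: "C = C1 # C2 # replicate n 1" "C1 \<ge> 1" "C2 \<ge> 1"
  shows "\<exists>H. subgraph H G \<and> (H, S, R) \<in> networks C \<and> card (hubs H) \<le> 2 * (C1 * C2 + n)"
proof -
  from extend[OF C order_refl] obtain W where W: "W \<subseteq> edges G" "linked G W (S ! 0) (R ! 0) C1" "linked G W (S ! 1) (R ! 1) C2"
    "thru G W I" "\<forall>k<n. linked G W (S ! Suc (Suc k)) (R ! Suc (Suc k)) 1"
    "card (branch G W I) + 2 * card (comps G W I) \<le> 2 * (C1 * C2 + 1 + n)" by blast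
  let ?H = "G\<lparr>edges := W\<rparr>"
  have fin: "finite W" using W(1) props(1) finite_subset by (auto simp: finite_loopless_def)
  have lk: "linked G W (S ! i) (R ! i) (C ! i) \<and> C ! i \<ge> 1" if i: "i < length C" for i
  proof (cases i)
    case 0 then show ?thesis using W C by simp
  next
    case (Suc j)
    show ?thesis
    proof (cases j)
      case 0 then show ?thesis using W C Suc by simp
    next
      case k: (Suc k)
      then have "k < n" using i C Suc by simp
      then show ?thesis using W(5) C Suc k by simp
    qed
  qed
  have cut: "min_vertex_cut ?H (S ! i) (R ! i) = C ! i" if "i < length C" for i
    using linked_restrict[OF props(1) W(1)] lk[OF that] props(8)[OF that] by (metis antisym)
  have inc: "\<exists>e\<in>W. tail G e = S ! i" "\<exists>e\<in>W. head G e = R ! i" if i: "i < length C" for i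
  proof -
    obtain P where P: "finite P" "disjoint_paths G (S ! i) (R ! i) P" "card P = C ! i" "\<forall>p\<in>P. set (snd p) \<subseteq> W"
      using lk[OF i] by (auto simp: linked_def)
    then obtain p where "p \<in> P" using lk[OF i] by (metis all_not_in_conv card.empty not_one_le_zero)
    moreover obtain vs es where pe: "p = (vs, es)" by force
    ultimately have p: "(vs, es) \<in> paths G (S ! i) (R ! i)" "set es \<subseteq> W" using P(2,4) by (force simp: disjoint_paths_def)+
    then have h: "length vs = Suc (length es)" "hd vs = S ! i" "last vs = R ! i"
      "\<And>i. i < length es \<Longrightarrow> traverses G (vs ! i) (es ! i) (vs ! Suc i)" by (auto simp: paths_def)
    have ne: "vs \<noteq> []" using h(1) by auto
    have e0: "vs ! 0 = S ! i" "vs ! length es = R ! i" using h ne by (simp_all add: hd_conv_nth last_conv_nth)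
    then have l: "0 < length es" using terminal(5)[OF i] by (cases "length es") auto
    have t1: "traverses G (S ! i) (es ! 0) (vs ! 1)" using h(4)[OF l] e0 by simp
    have t2: "traverses G (vs ! (length es - 1)) (es ! (length es - 1)) (R ! i)" using h(4)[of "length es - 1"] e0 l by simp
    have "es ! 0 \<in> W" "es ! (length es - 1) \<in> W" using p(2) l by auto
    moreover have "tail G (es ! 0) = S ! i" using t1 terminal(1)[OF i] by (auto simp: traverses_def sources_def incident_def)
    moreover have "head G (es ! (length es - 1)) = R ! i" using t2 terminal(2)[OF i] by (auto simp: traverses_def sinks_def incident_def)
    ultimately show "\<exists>e\<in>W. tail G e = S ! i" "\<exists>e\<in>W. head G e = R ! i" by blast+
  qed
  \<comment> \<open>A nonterminal vertex that keeps an edge can, by \<open>thru\<close>, still be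
    entered and still be left, so it becomes neither a source nor a sink.\<close>
  have src: "sources ?H = sources G"
  proof (intro equalityI subsetI)
    fix v assume v: "v \<in> sources G"
    then obtain i where "i < length C" "v = S ! i" using props(2,5) by (auto simp: in_set_conv_nth)
    then show "v \<in> sources ?H" using inc(1)[of i] v W(1) by (auto simp: sources_def incident_def)
  next
    fix v assume v: "v \<in> sources ?H"
    then obtain e where e: "e \<in> W" "tail G e = v" by (auto simp: sources_def incident_def)
    have vv: "v \<in> verts G" using v by (simp add: sources_def)
    have "v \<notin> sinks G" using e W(1) out_of_sink[of v e "head G e"] by (auto simp: traverses_def)
    moreover have "v \<notin> I"
    proof
      assume "v \<in> I"
      then have "v \<in> covered G W I" using e by (auto simp: covered_def)
      then obtain u e' where e': "e' \<in> W" "traverses G u e' v" using W(4) by (auto simp: thru_def)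
      then have "\<not> undirected G e'" "tail G e' = v" using v by (auto simp: sources_def incident_def traverses_def)
      then show False using e' W(1) props(1) by (auto simp: traverses_def finite_loopless_def)
    qed
    ultimately show "v \<in> sources G" using vv by (auto simp: I_def terminals_def)
  qed
  have snk: "sinks ?H = sinks G"
  proof (intro equalityI subsetI)
    fix v assume v: "v \<in> sinks G"
    then obtain i where "i < length C" "v = R ! i" using props(3,6) by (auto simp: in_set_conv_nth)
    then show "v \<in> sinks ?H" using inc(2)[of i] v W(1) by (auto simp: sinks_def incident_def)
  next
    fix v assume v: "v \<in> sinks ?H"
    then obtain e where e: "e \<in> W" "head G e = v" by (auto simp: sinks_def incident_def)
    have vv: "v \<in> verts G" using v by (simp add: sinks_def)
    have "v \<notin> sources G" using e W(1) into_source[of v "tail G e" e] by (auto simp: traverses_def)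
    moreover have "v \<notin> I"
    proof
      assume "v \<in> I"
      then have "v \<in> covered G W I" using e by (auto simp: covered_def)
      then obtain u e' where e': "e' \<in> W" "traverses G v e' u" using W(4) by (auto simp: thru_def)
      then have "\<not> undirected G e'" "head G e' = v" using v by (auto simp: sinks_def incident_def traverses_def)
      then show False using e' W(1) props(1) by (auto simp: traverses_def finite_loopless_def)
    qed
    ultimately show "v \<in> sinks G" using vv by (auto simp: I_def terminals_def)
  qed
  have ter: "terminals ?H = terminals G" using src snk by (simp add: terminals_def)
  have "(?H, S, R) \<in> networks C"
    using props W(1) fin cut src snk ter unfolding networks_def by (auto simp: finite_loopless_def)
  moreover have "subgraph ?H G" using W(1) by (simp add: subgraph_def)
  moreover have "hubs ?H = branch G W I"
    by (auto simp: hubs_def branch_def I_def ter degree_def incident_def)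
  \<comment> \<open>The surplus 2 in the estimate is absorbed by one component; without components
    there are no hubs at all.\<close>
  moreover have "card (branch G W I) \<le> 2 * (C1 * C2 + n)"
  proof (cases "comps G W I = {}")
    case True
    then have "covered G W I = {}" by (simp add: comps_def)
    then have no: "{e \<in> W. tail G e = v \<or> head G e = v} = {}" if "v \<in> I" for v using that by (auto simp: covered_def)
    have "branch G W I = {}"
    proof (rule equals0I)
      fix v assume "v \<in> branch G W I"
      then have v: "v \<in> I" "3 \<le> card {e \<in> W. tail G e = v \<or> head G e = v}" by (auto simp: branch_def)
      show False using v(2) unfolding no[OF v(1)] by simp
    qed
    then show ?thesis by simp
  next
    case False
    have "finite I" using props(1) by (auto simp: I_def finite_loopless_def)
    then have "card (comps G W I) \<ge> 1" using False finite_comps by (metis One_nat_def Suc_leI card_gt_0_iff)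
    then show ?thesis using W(6) by simp
  qed
  ultimately show ?thesis by (intro exI[of _ ?H]) simp
qed

end

section \<open>The grid\<close>

text \<open>The easy half of Menger's theorem: each path has a step out of \<open>L\<close>, hence a
  vertex of \<open>X\<close>, and disjoint paths have different ones.\<close>

lemma cut_le:
  assumes fin: "finite_loopless H" "finite X" and L: "s \<in> L" "t \<notin> L" and X: "s \<notin> X" "t \<notin> X"
    and cross: "\<And>u e v. traverses H u e v \<Longrightarrow> u \<in> L \<Longrightarrow> v \<notin> L \<Longrightarrow> u \<in> X \<or> v \<in> X"
  shows "min_vertex_cut H s t \<le> card X"
proof -
  obtain P where P: "finite P" "disjoint_paths H s t P" "card P = min_vertex_cut H s t" by (rule cut_attained[OF fin(1)])
  have "\<exists>x\<in>X. x \<in> set (fst p)" if "p \<in> P" for p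
  proof -
    obtain vs es where pe: "p = (vs, es)" by force
    have "(vs, es) \<in> paths H s t" using that P(2) pe by (auto simp: disjoint_paths_def)
    then have p: "length vs = Suc (length es)" "hd vs = s" "last vs = t"
      and tr: "\<And>i. i < length es \<Longrightarrow> traverses H (vs ! i) (es ! i) (vs ! Suc i)" by (auto simp: paths_def)
    have ne: "vs \<noteq> []" using p(1) by auto
    then have e0: "vs ! 0 = s" "vs ! length es = t" using p by (simp_all add: hd_conv_nth last_conv_nth)
    have "\<exists>k<length es. vs ! k \<in> L \<and> vs ! Suc k \<notin> L"
    proof (rule ccontr)
      assume no: "\<not> ?thesis"
      have "vs ! k \<in> L" if "k \<le> length es" for k
        using that by (induction k) (use e0 L no in auto)
      then show False using e0 L by auto
    qed
    then obtain k where k: "k < length es" "vs ! k \<in> L" "vs ! Suc k \<notin> L" by blast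
    then have "vs ! k \<in> X \<or> vs ! Suc k \<in> X" using cross tr by blast
    moreover have "vs ! k \<in> set vs" "vs ! Suc k \<in> set vs" using k(1) p(1) by simp_all
    ultimately show ?thesis using pe by auto
  qed
  then obtain f where f: "\<And>p. p \<in> P \<Longrightarrow> f p \<in> X \<and> f p \<in> set (fst p)" by metis
  have "inj_on f P"
  proof (rule inj_onI, rule ccontr)
    fix p q assume pq: "p \<in> P" "q \<in> P" "f p = f q" "p \<noteq> q"
    then have "f p \<in> {s, t}" using P(2) f[of p] f[of q] by (force simp: disjoint_paths_def)
    then show False using f[OF pq(1)] X by auto
  qed
  then have "card P \<le> card X" using f fin(2) by (intro card_inj_on_le[of f]) auto
  then show ?thesis using P(3) by simp
qed

text \<open>The crossing of row \<open>i\<close> and column \<open>j\<close> is the segment \<open>EG i j\<close> from \<open>VA i j\<close> to \<open>VB i j\<close>. The edges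
  \<open>EP i j\<close> and \<open>EQ i j\<close> enter it along the row and the column; those with \<open>j = C2\<close> and \<open>i = C1\<close> lead to the sinks.
  The vertices \<open>VC m\<close> subdivide the first edge of row 0, with \<open>EC m\<close> entering \<open>VC m\<close>. The terminals of the first
  two pairs have index 0 and 1; pair \<open>k + 2\<close> is attached at \<open>VC (2 * k)\<close> and \<open>VC (2 * k + 1)\<close>.\<close>

datatype vertex = VA nat nat | VB nat nat | VC nat | Src nat | Snk nat
datatype edge = EG nat nat | EP nat nat | EQ nat nat | EC nat | ES nat | ER nat

instance vertex :: countable by countable_datatype
instance edge :: countable by countable_datatype

abbreviation code :: "'a::countable \<Rightarrow> nat" where "code \<equiv> to_nat"

fun grid_vertex :: "nat \<Rightarrow> nat \<Rightarrow> nat \<Rightarrow> vertex \<Rightarrow> bool" where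
  "grid_vertex C1 C2 n (VA i j) \<longleftrightarrow> i < C1 \<and> j < C2"
| "grid_vertex C1 C2 n (VB i j) \<longleftrightarrow> i < C1 \<and> j < C2"
| "grid_vertex C1 C2 n (VC m) \<longleftrightarrow> m < 2 * n"
| "grid_vertex C1 C2 n (Src k) \<longleftrightarrow> k < Suc (Suc n)"
| "grid_vertex C1 C2 n (Snk k) \<longleftrightarrow> k < Suc (Suc n)"

fun grid_edge :: "nat \<Rightarrow> nat \<Rightarrow> nat \<Rightarrow> edge \<Rightarrow> bool" where
  "grid_edge C1 C2 n (EG i j) \<longleftrightarrow> i < C1 \<and> j < C2"
| "grid_edge C1 C2 n (EP i j) \<longleftrightarrow> i < C1 \<and> j \<le> C2"
| "grid_edge C1 C2 n (EQ i j) \<longleftrightarrow> i \<le> C1 \<and> j < C2"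
| "grid_edge C1 C2 n (EC m) \<longleftrightarrow> m < 2 * n"
| "grid_edge C1 C2 n (ES k) \<longleftrightarrow> k < n"
| "grid_edge C1 C2 n (ER k) \<longleftrightarrow> k < n"

fun grid_org :: "nat \<Rightarrow> edge \<Rightarrow> vertex" where
  "grid_org n (EG i j) = VA i j"
| "grid_org n (EP i j) = (if j = 0 then if i = 0 \<and> n > 0 then VC (2 * n - 1) else Src 0 else VB i (j - 1))"
| "grid_org n (EQ i j) = (if i = 0 then Src 1 else VB (i - 1) j)"
| "grid_org n (EC m) = (if m = 0 then Src 0 else VC (m - 1))"
| "grid_org n (ES k) = Src (Suc (Suc k))"
| "grid_org n (ER k) = VC (2 * k + 1)"

fun grid_dst :: "nat \<Rightarrow> nat \<Rightarrow> edge \<Rightarrow> vertex" where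
  "grid_dst C1 C2 (EG i j) = VB i j"
| "grid_dst C1 C2 (EP i j) = (if j = C2 then Snk 0 else VA i j)"
| "grid_dst C1 C2 (EQ i j) = (if i = C1 then Snk 1 else VA i j)"
| "grid_dst C1 C2 (EC m) = VC m"
| "grid_dst C1 C2 (ES k) = VC (2 * k)"
| "grid_dst C1 C2 (ER k) = Snk (Suc (Suc k))"

fun inner :: "vertex \<Rightarrow> bool" where
  "inner (Src k) \<longleftrightarrow> False" | "inner (Snk k) \<longleftrightarrow> False" | "inner (VA i j) \<longleftrightarrow> True" | "inner (VB i j) \<longleftrightarrow> True" | "inner (VC m) \<longleftrightarrow> True"

fun row :: "vertex \<Rightarrow> nat" where "row (VA i j) = i" | "row (VB i j) = i" | "row _ = 0"
fun col :: "vertex \<Rightarrow> nat" where "col (VA i j) = j" | "col (VB i j) = j" | "col _ = 0"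

section \<open>The grid network and its vertex cuts\<close>

locale grid =
  fixes C1 C2 n :: nat
  assumes C1: "C1 \<ge> 1" and C2: "C2 \<ge> 1"
begin

abbreviation "vertex \<equiv> grid_vertex C1 C2 n"
abbreviation "edge \<equiv> grid_edge C1 C2 n"
abbreviation "org \<equiv> grid_org n"
abbreviation "dst \<equiv> grid_dst C1 C2"

definition G :: "(nat, nat) mixed_graph" where
  "G = \<lparr>verts = code ` Collect vertex, edges = code ` Collect edge,
     tail = (\<lambda>e. code (org (from_nat e))), head = (\<lambda>e. code (dst (from_nat e))),
     undirected = (\<lambda>e. inner (org (from_nat e)) \<and> inner (dst (from_nat e)))\<rparr>"

lemma G_simps [simp]:
  "code v \<in> verts G \<longleftrightarrow> vertex v" "code x \<in> edges G \<longleftrightarrow> edge x"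
  "tail G (code x) = code (org x)" "head G (code x) = code (dst x)"
  "undirected G (code x) \<longleftrightarrow> inner (org x) \<and> inner (dst x)"
  by (auto simp: G_def)

lemma edgeE: assumes "e \<in> edges G" obtains x where "e = code x" "edge x"
  using assms by (auto simp: G_def)

lemma vertexE: assumes "v \<in> verts G" obtains w where "v = code w" "vertex w"
  using assms by (auto simp: G_def)

lemma ends: "edge x \<Longrightarrow> vertex (org x) \<and> vertex (dst x) \<and> org x \<noteq> dst x"
  using C1 C2 by (cases x) auto

lemma org_Snk: "org x \<noteq> Snk k" and dst_Src: "dst x \<noteq> Src k" by (cases x; auto)+

lemma finite_G: "finite_loopless G"
proof -
  let ?I = "{..C1} \<times> {..C2}"
  have "Collect vertex \<subseteq> (\<lambda>(i, j). VA i j) ` ?I \<union> (\<lambda>(i, j). VB i j) ` ?I \<union> VC ` {..2*n} \<union> Src ` {..n+2} \<union> Snk ` {..n+2}"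
  proof
    fix v assume "v \<in> Collect vertex"
    then show "v \<in> (\<lambda>(i, j). VA i j) ` ?I \<union> (\<lambda>(i, j). VB i j) ` ?I \<union> VC ` {..2*n} \<union> Src ` {..n+2} \<union> Snk ` {..n+2}"
      by (cases v) auto
  qed
  then have "finite (Collect vertex)" by (rule finite_subset) auto
  moreover have "Collect edge \<subseteq> (\<lambda>(i, j). EG i j) ` ?I \<union> (\<lambda>(i, j). EP i j) ` ?I \<union> (\<lambda>(i, j). EQ i j) ` ?I \<union> EC ` {..2*n} \<union> ES ` {..n} \<union> ER ` {..n}"
  proof
    fix v assume "v \<in> Collect edge"
    then show "v \<in> (\<lambda>(i, j). EG i j) ` ?I \<union> (\<lambda>(i, j). EP i j) ` ?I \<union> (\<lambda>(i, j). EQ i j) ` ?I \<union> EC ` {..2*n} \<union> ES ` {..n} \<union> ER ` {..n}"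
      by (cases v) auto
  qed
  then have "finite (Collect edge)" by (rule finite_subset) auto
  ultimately show ?thesis using ends unfolding finite_loopless_def
    by (auto simp: G_def)
qed

text \<open>An undirected edge has to be blocked in both directions, a terminal edge only out of
  \<open>L\<close>. The cut is indexed by \<open>I\<close>, so that deleting an index shows at once
  that the cut is smaller.\<close>

lemma grid_cut:
  assumes H: "finite_loopless H" "subgraph H G" and X: "finite I" "\<And>i. inner (p i)" and L: "L (Src k)" "\<not> L (Snk k)"
    and cross: "\<And>x. edge x \<Longrightarrow> code x \<in> edges H \<Longrightarrow>
        L (org x) \<and> \<not> L (dst x) \<or> L (dst x) \<and> \<not> L (org x) \<and> inner (org x) \<and> inner (dst x) \<Longrightarrow>
        org x \<in> p ` I \<or> dst x \<in> p ` I"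
  shows "min_vertex_cut H (code (Src k)) (code (Snk k)) \<le> card I"
proof -
  have ni: "code (Src k) \<notin> code ` p ` I" "code (Snk k) \<notin> code ` p ` I" using X(2) by (auto simp: inj_image_mem_iff) (metis inner.simps(1,2))+
  have "min_vertex_cut H (code (Src k)) (code (Snk k)) \<le> card (code ` p ` I)"
  proof (rule cut_le[OF H(1), where L = "code ` Collect L"])
    fix u e v assume t: "traverses H u e v" "u \<in> code ` Collect L" "v \<notin> code ` Collect L"
    then have e: "e \<in> edges H" by (simp add: traverses_def)
    moreover obtain x where x: "e = code x" "edge x" using H(2) e by (auto simp: subgraph_def elim!: edgeE)
    ultimately have tt: "traverses G u (code x) v" using t(1) H(2) by (auto simp: traverses_def subgraph_def)
    show "u \<in> code ` p ` I \<or> v \<in> code ` p ` I"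
      using cross[of x] x t(2,3) e tt by (auto simp: traverses_def inj_image_mem_iff)
  qed (use X L ni in auto)
  also have "\<dots> \<le> card I" unfolding image_image using X(1) by (rule card_image_le)
  finally show ?thesis .
qed

definition step :: "(vertex \<Rightarrow> nat) \<Rightarrow> nat \<Rightarrow> vertex rel" where
  "step r i = {(org x, dst x) | x. edge x \<and> inner (org x) \<and> inner (dst x) \<and> r (org x) = i \<and> r (dst x) = i}"

text \<open>The function \<open>r\<close> assigns a lane number to each inner vertex. Walks that
  stay in their lane are disjoint, so only reachability within each lane has to be checked.\<close>

lemma grid_lanes:
  assumes st: "\<not> inner s" "\<not> inner t" "s \<noteq> t"
    and first: "\<And>i. i < k \<Longrightarrow> edge (a i) \<and> org (a i) = s \<and> inner (dst (a i)) \<and> r (dst (a i)) = i"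
    and last: "\<And>i. i < k \<Longrightarrow> edge (b i) \<and> (dst (a i), org (b i)) \<in> (step r i)\<^sup>* \<and> dst (b i) = t"
  shows "k \<le> min_vertex_cut G (code s) (code t)"
proof -
  define I where "I = (\<lambda>i. (code (a i), code (dst (a i)))) ` {..<k}"
  define Z where "Z v = code ` {w. inner w \<and> r w = r (from_nat v)}" for v
  have "linked G (edges G) (code s) (code t) (card I)"
  proof (rule lanes)
    show "finite I" by (simp add: I_def)
    show "e \<in> edges G \<and> traverses G (code s) e v" if "(e, v) \<in> I" for e v
      using that first by (auto simp: I_def traverses_def)
    show "Z v \<inter> Z v' = {}" if "(e, v) \<in> I" "(e', v') \<in> I" "(e, v) \<noteq> (e', v')" for e v e' v'
      using that first by (auto simp: I_def Z_def)
    show "v \<in> Z v \<and> code s \<notin> Z v \<and> code t \<notin> Z v \<and>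
        (\<exists>l e'. (v, l) \<in> (walk G (edges G) (Z v))\<^sup>* \<and> e' \<in> edges G \<and> traverses G l e' (code t))" if v: "(e, v) \<in> I" for e v
    proof -
      obtain i where i: "i < k" "v = code (dst (a i))" using v by (auto simp: I_def)
      have Z: "Z v = code ` {w. inner w \<and> r w = i}" using i first by (simp add: Z_def)
      have "(code (dst (a i)), code l) \<in> (walk G (edges G) (Z v))\<^sup>*" if "(dst (a i), l) \<in> (step r i)\<^sup>*" for l
        using that
      proof (induction rule: rtrancl_induct)
        case (step y z)
        then obtain x where x: "edge x" "y = org x" "z = dst x" "inner (org x)" "inner (dst x)" "r (org x) = i" "r (dst x) = i"
          by (auto simp: step_def)
        then have "traverses G (code y) (code x) (code z)" by (simp add: traverses_def)
        moreover have "code y \<in> Z v" "code z \<in> Z v" "code x \<in> edges G" unfolding Z using x by auto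
        ultimately have "(code y, code z) \<in> walk G (edges G) (Z v)" unfolding walk_def by blast
        then show ?case using step.IH by (rule rtrancl.rtrancl_into_rtrancl[rotated])
      qed simp
      then have "(v, code (org (b i))) \<in> (walk G (edges G) (Z v))\<^sup>*" using last[OF i(1)] i by simp
      moreover have "code (b i) \<in> edges G" "traverses G (code (org (b i))) (code (b i)) (code t)"
        using last[OF i(1)] by (auto simp: traverses_def)
      moreover have "v \<in> Z v" "code s \<notin> Z v" "code t \<notin> Z v" unfolding Z using i first[OF i(1)] st by auto
      ultimately show ?thesis by blast
    qed
  qed (use st in auto)
  moreover have "card I = k"
  proof -
    have "inj_on (\<lambda>i. (code (a i), code (dst (a i)))) {..<k}"
      by (rule inj_onI) (use first in \<open>auto; metis\<close>)
    then show ?thesis unfolding I_def by (simp add: card_image)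
  qed
  ultimately show ?thesis using linked_restrict(1)[OF finite_G subset_refl] by simp
qed

lemma step_EG: "i < C1 \<Longrightarrow> j < C2 \<Longrightarrow> r (VA i j) = k \<Longrightarrow> r (VB i j) = k \<Longrightarrow> (VA i j, VB i j) \<in> step r k"
  unfolding step_def by (rule CollectI, rule exI[of _ "EG i j"]) simp

lemma step_EC: "m < 2 * n \<Longrightarrow> m = Suc m' \<Longrightarrow> r (VC m') = k \<Longrightarrow> r (VC m) = k \<Longrightarrow> (VC m', VC m) \<in> step r k"
  unfolding step_def by (rule CollectI, rule exI[of _ "EC m"]) simp

lemma row_walk: "i < C1 \<Longrightarrow> j < C2 \<Longrightarrow> (VA i 0, VB i j) \<in> (step row i)\<^sup>*"
proof (induction j)
  case 0
  then show ?case by (intro r_into_rtrancl step_EG) auto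
next
  case (Suc j)
  have "(VB i j, VA i (Suc j)) \<in> step row i" unfolding step_def
    by (rule CollectI, rule exI[of _ "EP i (Suc j)"]) (use Suc in auto)
  moreover have "(VA i (Suc j), VB i (Suc j)) \<in> step row i" by (rule step_EG) (use Suc in auto)
  ultimately show ?case using Suc by (meson Suc_lessD rtrancl.rtrancl_into_rtrancl)
qed

lemma col_walk: "i < C1 \<Longrightarrow> j < C2 \<Longrightarrow> (VA 0 j, VB i j) \<in> (step col j)\<^sup>*"
proof (induction i)
  case 0
  then show ?case by (intro r_into_rtrancl step_EG) auto
next
  case (Suc i)
  have "(VB i j, VA (Suc i) j) \<in> step col j" unfolding step_def
    by (rule CollectI, rule exI[of _ "EQ (Suc i) j"]) (use Suc in auto)
  moreover have "(VA (Suc i) j, VB (Suc i) j) \<in> step col j" by (rule step_EG) (use Suc in auto)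
  ultimately show ?case using Suc by (meson Suc_lessD rtrancl.rtrancl_into_rtrancl)
qed

lemma chain_walk: "m < 2 * n \<Longrightarrow> (VC 0, VC m) \<in> (step row 0)\<^sup>*"
proof (induction m)
  case (Suc m)
  have "(VC m, VC (Suc m)) \<in> step row 0" by (rule step_EC) (use Suc in auto)
  then show ?case using Suc by (meson Suc_lessD rtrancl.rtrancl_into_rtrancl)
qed simp

lemma cut_row_ge: "C1 \<le> min_vertex_cut G (code (Src 0)) (code (Snk 0))"
proof (rule grid_lanes[where r = row and a = "\<lambda>i. if i = 0 \<and> n > 0 then EC 0 else EP i 0" and b = "\<lambda>i. EP i C2"])
  fix i assume i: "i < C1"
  have w: "(VA i 0, VB i (C2 - 1)) \<in> (step row i)\<^sup>*" by (rule row_walk) (use i C2 in auto)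
  have "(VC 0, VB i (C2 - 1)) \<in> (step row i)\<^sup>*" if c: "i = 0" "n > 0"
  proof -
    have "(VC (2 * n - 1), VA 0 0) \<in> step row 0" unfolding step_def
      by (rule CollectI, rule exI[of _ "EP 0 0"]) (use c C1 C2 in auto)
    moreover have "(VC 0, VC (2 * n - 1)) \<in> (step row 0)\<^sup>*" by (rule chain_walk) (use c in auto)
    ultimately show ?thesis using w c by (meson rtrancl.rtrancl_into_rtrancl rtrancl_trans)
  qed
  then show "edge (EP i C2) \<and> (dst (if i = 0 \<and> n > 0 then EC 0 else EP i 0), org (EP i C2)) \<in> (step row i)\<^sup>* \<and> dst (EP i C2) = Snk 0"
    using i w C2 by auto
qed (use C2 in auto)

lemma cut_col_ge: "C2 \<le> min_vertex_cut G (code (Src 1)) (code (Snk 1))"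
proof (rule grid_lanes[where r = col and a = "\<lambda>j. EQ 0 j" and b = "\<lambda>j. EQ C1 j"])
  fix j assume j: "j < C2"
  have "(VA 0 j, VB (C1 - 1) j) \<in> (step col j)\<^sup>*" by (rule col_walk) (use j C1 in auto)
  then show "edge (EQ C1 j) \<and> (dst (EQ 0 j), org (EQ C1 j)) \<in> (step col j)\<^sup>* \<and> dst (EQ C1 j) = Snk 1"
    using j C1 by auto
qed (use C1 in auto)

lemma cut_unit_ge: assumes "k < n" shows "1 \<le> min_vertex_cut G (code (Src (Suc (Suc k)))) (code (Snk (Suc (Suc k))))"
proof (rule grid_lanes[where r = "\<lambda>_. 0" and a = "\<lambda>_. ES k" and b = "\<lambda>_. ER k"])
  fix i :: nat assume i: "i < 1"
  have "(VC (2 * k), VC (2 * k + 1)) \<in> step (\<lambda>_. 0) i" by (rule step_EC) (use assms i in auto)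
  then show "edge (ER k) \<and> (dst (ES k), org (ER k)) \<in> (step (\<lambda>_. 0) i)\<^sup>* \<and> dst (ER k) = Snk (Suc (Suc k))"
    using assms by auto
qed (use assms in auto)

text \<open>A straight cut across all rows at the edges \<open>EP i j\<close>, from which the rows
  in \<open>D\<close> can be left out. With \<open>D\<close> empty it bounds the cut of the grid
  itself, with one element it shows that \<open>EP i j\<close> is indispensable.\<close>

lemma cut_row_le:
  assumes H: "finite_loopless H" "subgraph H G" and j: "j \<le> C2" and D: "\<And>i. i \<in> D \<Longrightarrow> code (EP i j) \<notin> edges H"
  shows "min_vertex_cut H (code (Src 0)) (code (Snk 0)) \<le> card ({..<C1} - D)"
proof -
  have nb: "j' < j \<or> j < j'" if "code (EP i j') \<in> edges H" "i \<in> D" for i j'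
    using that D by (cases "j' = j") auto
  \<comment> \<open>Other sources lie outside \<open>L\<close> and other sinks inside, so the
    directed edges at other terminals never lead out of \<open>L\<close>. All the cuts for the first
    two pairs use this choice.\<close>
  define L where "L v = (case v of VA i j' \<Rightarrow> j' < j | VB i j' \<Rightarrow> j' < j | VC m \<Rightarrow> True | Src k \<Rightarrow> k = 0 | Snk k \<Rightarrow> k \<noteq> 0)" for v
  show ?thesis
  proof (rule grid_cut[OF H, where L = L and p = "\<lambda>i. if j = 0 then VA i 0 else VB i (j - 1)"], goal_cases)
    case (5 x)
    then show ?case using j C1 C2 by (cases x) (auto simp: L_def image_iff dest: nb split: if_splits)
  qed (auto simp: L_def)
qed

text \<open>Without \<open>EC m\<close> row 0 is severed before it reaches the grid, so the first
  vertices of the other rows form a cut.\<close>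

lemma cut_chain_le:
  assumes H: "finite_loopless H" "subgraph H G" and m: "m < 2 * n" "code (EC m) \<notin> edges H"
  shows "min_vertex_cut H (code (Src 0)) (code (Snk 0)) \<le> card ({..<C1} - {0})"
proof -
  have nb: "m' < m \<or> m < m'" if "code (EC m') \<in> edges H" for m'
    using that m(2) by (cases "m' = m") auto
  define L where "L v = (case v of VA i j \<Rightarrow> False | VB i j \<Rightarrow> False | VC m' \<Rightarrow> m' < m | Src k \<Rightarrow> k = 0 | Snk k \<Rightarrow> k \<noteq> 0)" for v
  show ?thesis
  proof (rule grid_cut[OF H, where L = L and p = "\<lambda>i. VA i 0"], goal_cases)
    case (5 x)
    then show ?case using m(1) C1 C2 by (cases x) (auto simp: L_def image_iff dest: nb split: if_splits)
  qed (auto simp: L_def)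
qed

text \<open>The cut runs through column \<open>j\<close> and passes the gap. The broken row could
  detour over the column, upwards from \<open>VA i j\<close> to \<open>VB (i - 1) j\<close> or
  downwards through \<open>VA (i + 1) j\<close> back to \<open>VB i j\<close>. So above the gap the
  lower ends of the segments are blocked, below it the upper ends.\<close>

lemma cut_segment_le:
  assumes H: "finite_loopless H" "subgraph H G" and ij: "i < C1" "j < C2" "code (EG i j) \<notin> edges H"
  shows "min_vertex_cut H (code (Src 0)) (code (Snk 0)) \<le> card ({..<C1} - {i})"
proof -
  have nb: "i' < i \<or> i < i'" if "code (EG i' j) \<in> edges H" for i'
    using that ij(3) by (cases "i' = i") auto
  define L where "L v = (case v of VA i' j' \<Rightarrow> j' < j \<or> j' = j \<and> i' \<le> i | VB i' j' \<Rightarrow> j' < j | VC m \<Rightarrow> True | Src k \<Rightarrow> k = 0 | Snk k \<Rightarrow> k \<noteq> 0)" for v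
  show ?thesis
  proof (rule grid_cut[OF H, where L = L and p = "\<lambda>i'. if i' < i then VB i' j else VA i' j"], goal_cases)
    case (5 x)
    then show ?case using ij(1,2) C1 C2 by (cases x) (auto simp: L_def image_iff dest: nb split: if_splits)
  qed (auto simp: L_def)
qed

lemma cut_col_le:
  assumes H: "finite_loopless H" "subgraph H G" and i: "i \<le> C1" and D: "\<And>j. j \<in> D \<Longrightarrow> code (EQ i j) \<notin> edges H"
  shows "min_vertex_cut H (code (Src 1)) (code (Snk 1)) \<le> card ({..<C2} - D)"
proof -
  have nb: "i' < i \<or> i < i'" if "code (EQ i' j) \<in> edges H" "j \<in> D" for i' j
    using that D by (cases "i' = i") auto
  \<comment> \<open>For positive \<open>i\<close> the chain lies on the same side as the first row,
    so that \<open>EP 0 0\<close> does not cross the cut.\<close>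
  define L where "L v = (case v of VA i' j \<Rightarrow> i' < i | VB i' j \<Rightarrow> i' < i | VC m \<Rightarrow> i > 0 | Src k \<Rightarrow> k = 1 | Snk k \<Rightarrow> k \<noteq> 1)" for v
  show ?thesis
  proof (rule grid_cut[OF H, where L = L and p = "\<lambda>j. if i = 0 then VA 0 j else VB (i - 1) j"], goal_cases)
    case (5 x)
    then show ?case using i C1 C2 by (cases x) (auto simp: L_def image_iff dest: nb split: if_splits)
  qed (auto simp: L_def)
qed

lemma cut_unit_le:
  assumes H: "finite_loopless H" "subgraph H G"
  shows "min_vertex_cut H (code (Src (Suc (Suc k)))) (code (Snk (Suc (Suc k)))) \<le> 1" (is "?c \<le> 1")
    and "code (ES k) \<notin> edges H \<or> code (ER k) \<notin> edges H \<Longrightarrow> min_vertex_cut H (code (Src (Suc (Suc k)))) (code (Snk (Suc (Suc k)))) = 0"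
proof -
  have "?c \<le> card {()}"
    by (rule grid_cut[OF H, where L = "\<lambda>v. v = Src (Suc (Suc k))" and p = "\<lambda>_. VC (2 * k)"])
      (use dst_Src in \<open>auto elim!: grid_edge.elims split: if_splits\<close>)
  then show "?c \<le> 1" by simp
  assume "code (ES k) \<notin> edges H \<or> code (ER k) \<notin> edges H"
  then have "?c \<le> card ({} :: unit set)"
  proof
    assume e: "code (ES k) \<notin> edges H"
    show ?thesis
      by (rule grid_cut[OF H, where L = "\<lambda>v. v = Src (Suc (Suc k))" and p = "\<lambda>_. VC 0"])
        (use e dst_Src in \<open>auto elim!: grid_edge.elims split: if_splits\<close>)
  next
    assume e: "code (ER k) \<notin> edges H"
    show ?thesis
      by (rule grid_cut[OF H, where L = "\<lambda>v. v \<noteq> Snk (Suc (Suc k))" and p = "\<lambda>_. VC 0"])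
        (use e org_Snk in \<open>auto elim!: grid_edge.elims split: if_splits\<close>)
  qed
  then show "?c = 0" by simp
qed

definition S :: "nat list" where "S = map (\<lambda>k. code (Src k)) [0..<Suc (Suc n)]"
definition R :: "nat list" where "R = map (\<lambda>k. code (Snk k)) [0..<Suc (Suc n)]"

lemma not_inner: "\<not> inner v \<longleftrightarrow> (\<exists>k. v = Src k \<or> v = Snk k)" by (cases v) auto

lemma source_edge: "k < Suc (Suc n) \<Longrightarrow> \<exists>x. edge x \<and> org x = Src k"
proof -
  assume k: "k < Suc (Suc n)"
  consider "k = 0" "n > 0" | "k = 0" "n = 0" | "k = 1" | k' where "k = Suc (Suc k')" by (metis One_nat_def gr0I not0_implies_Suc)
  then show ?thesis
  proof cases
    case 1 then show ?thesis by (intro exI[of _ "EC 0"]) simp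
  next
    case 2 then show ?thesis using C1 by (intro exI[of _ "EP 0 0"]) simp
  next
    case 3 then show ?thesis using C2 by (intro exI[of _ "EQ 0 0"]) simp
  next
    case 4 then show ?thesis using k by (intro exI[of _ "ES k'"]) simp
  qed
qed

lemma sink_edge: "k < Suc (Suc n) \<Longrightarrow> \<exists>x. edge x \<and> dst x = Snk k"
proof -
  assume k: "k < Suc (Suc n)"
  consider "k = 0" | "k = 1" | k' where "k = Suc (Suc k')" by (metis One_nat_def not0_implies_Suc)
  then show ?thesis
  proof cases
    case 1 then show ?thesis using C1 by (intro exI[of _ "EP 0 C2"]) simp
  next
    case 2 then show ?thesis using C2 by (intro exI[of _ "EQ C1 0"]) simp
  next
    case 3 then show ?thesis using k by (intro exI[of _ "ER k'"]) simp
  qed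
qed

lemma inner_edge: "vertex v \<Longrightarrow> inner v \<Longrightarrow> \<exists>x. edge x \<and> (org x = v \<or> dst x = v) \<and> inner (org x) \<and> inner (dst x)"
proof (cases v)
  case (VC m)
  assume v: "vertex v" "inner v"
  show ?thesis
  proof (cases m)
    case 0 then show ?thesis using VC v by (intro exI[of _ "EC 1"]) auto
  next
    case (Suc m') then show ?thesis using VC v by (intro exI[of _ "EC m"]) auto
  qed
next
  case (VA i j)
  assume "vertex v" "inner v"
  then show ?thesis using VA by (intro exI[of _ "EG i j"]) auto
next
  case (VB i j)
  assume "vertex v" "inner v"
  then show ?thesis using VB by (intro exI[of _ "EG i j"]) auto
qed auto

lemma incident_code: "code x \<in> incident G (code v) \<longleftrightarrow> edge x \<and> (org x = v \<or> dst x = v)"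
  by (auto simp: incident_def)

lemma sources_G: "sources G = set S"
proof (intro equalityI subsetI)
  fix v assume v: "v \<in> sources G"
  then obtain w where w: "v = code w" "vertex w" by (auto simp: sources_def elim: vertexE)
  have und: "\<not> (inner (org x) \<and> inner (dst x)) \<and> org x = w" if "edge x" "org x = w \<or> dst x = w" for x
    using v that incident_code[of x w] by (auto simp: sources_def w(1))
  obtain x where x: "edge x" "org x = w \<or> dst x = w"
    using v by (auto simp: sources_def w(1) incident_def elim!: edgeE)
  have "\<not> inner w" using inner_edge[OF w(2)] und by blast
  then obtain k where "w = Src k \<or> w = Snk k" using not_inner by blast
  then have "w = Src k" using und[OF x] org_Snk by blast
  then show "v \<in> set S" using w by (auto simp: S_def)
next
  fix v assume "v \<in> set S"
  then obtain k where k: "k < Suc (Suc n)" "v = code (Src k)" by (auto simp: S_def)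
  obtain x where "edge x" "org x = Src k" using source_edge[OF k(1)] by blast
  then have "code x \<in> incident G v" using k by (simp add: incident_code)
  moreover have "\<not> undirected G e \<and> tail G e = v" if "e \<in> incident G v" for e
  proof -
    have "e \<in> edges G" using that by (simp add: incident_def)
    then obtain y where "e = code y" "edge y" by (rule edgeE)
    then show ?thesis using that dst_Src[of y k] by (auto simp: k(2) incident_code)
  qed
  ultimately show "v \<in> sources G" using k by (auto simp: sources_def)
qed

lemma sinks_G: "sinks G = set R"
proof (intro equalityI subsetI)
  fix v assume v: "v \<in> sinks G"
  then obtain w where w: "v = code w" "vertex w" by (auto simp: sinks_def elim: vertexE)
  have und: "\<not> (inner (org x) \<and> inner (dst x)) \<and> dst x = w" if "edge x" "org x = w \<or> dst x = w" for x
    using v that incident_code[of x w] by (auto simp: sinks_def w(1))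
  obtain x where x: "edge x" "org x = w \<or> dst x = w"
    using v by (auto simp: sinks_def w(1) incident_def elim!: edgeE)
  have "\<not> inner w" using inner_edge[OF w(2)] und by blast
  then obtain k where "w = Src k \<or> w = Snk k" using not_inner by blast
  then have "w = Snk k" using und[OF x] dst_Src by blast
  then show "v \<in> set R" using w by (auto simp: R_def)
next
  fix v assume "v \<in> set R"
  then obtain k where k: "k < Suc (Suc n)" "v = code (Snk k)" by (auto simp: R_def)
  obtain x where "edge x" "dst x = Snk k" using sink_edge[OF k(1)] by blast
  then have "code x \<in> incident G v" using k by (simp add: incident_code)
  moreover have "\<not> undirected G e \<and> head G e = v" if "e \<in> incident G v" for e
  proof -
    have "e \<in> edges G" using that by (simp add: incident_def)
    then obtain y where "e = code y" "edge y" by (rule edgeE)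
    then show ?thesis using that org_Snk[of y k] by (auto simp: k(2) incident_code)
  qed
  ultimately show "v \<in> sinks G" using k by (auto simp: sinks_def)
qed

lemma S_nth: "k < Suc (Suc n) \<Longrightarrow> S ! k = code (Src k)" and R_nth: "k < Suc (Suc n) \<Longrightarrow> R ! k = code (Snk k)"
  by (simp_all add: S_def R_def del: upt_Suc)

abbreviation "C \<equiv> C1 # C2 # replicate n 1"

lemma subgraph_refl: "subgraph G G" by (simp add: subgraph_def)

lemma cut_G: assumes "k < Suc (Suc n)" shows "min_vertex_cut G (S ! k) (R ! k) = C ! k"
proof -
  consider "k = 0" | "k = 1" | k' where "k = Suc (Suc k')" by (metis One_nat_def not0_implies_Suc)
  then show ?thesis
  proof cases
    case 1
    have "min_vertex_cut G (code (Src 0)) (code (Snk 0)) \<le> card ({..<C1} - {})"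
      by (rule cut_row_le[OF finite_G subgraph_refl, of 0]) auto
    then show ?thesis using 1 cut_row_ge by (simp add: S_nth R_nth)
  next
    case 2
    have "min_vertex_cut G (code (Src 1)) (code (Snk 1)) \<le> card ({..<C2} - {})"
      by (rule cut_col_le[OF finite_G subgraph_refl, of 0]) auto
    then show ?thesis using 2 cut_col_ge by (simp add: S_nth R_nth)
  next
    case 3
    then show ?thesis using assms cut_unit_le(1)[OF finite_G subgraph_refl, of k'] cut_unit_ge[of k'] by (simp add: S_nth R_nth)
  qed
qed

lemma terminals_G: "terminals G = set S \<union> set R"
  by (simp add: terminals_def sources_G sinks_G)

lemma grid_network: "(G, S, R) \<in> networks C"
proof -
  have "distinct (S @ R)" by (auto simp: S_def R_def distinct_map inj_on_def)
  moreover have "undirected G e" if "e \<in> edges G" "tail G e \<notin> terminals G" "head G e \<notin> terminals G" for e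
  proof -
    note e = that
    obtain x where x: "e = code x" "edge x" by (rule edgeE[OF e(1)])
    have "inner v" if "vertex v" "code v \<notin> terminals G" for v
      using that by (cases v) (auto simp: terminals_G S_def R_def simp del: upt_Suc)
    then show ?thesis using e ends[OF x(2)] x by auto
  qed
  ultimately show ?thesis unfolding networks_def
    using finite_G sources_G sinks_G cut_G by (auto simp: S_def R_def)
qed

text \<open>The first pair needs all segments, row edges and chain edges, the second pair all column
  edges, and each further pair its own two terminal edges.\<close>

lemma rigid:
  assumes H: "subgraph H G" "(H, S, R) \<in> networks C" and x: "edge x"
  shows "code x \<in> edges H"
proof (rule ccontr)
  assume no: "code x \<notin> edges H"
  have fin: "finite_loopless H" using H(2) by (auto simp: networks_def)
  have cut: "min_vertex_cut H (S ! k) (R ! k) = C ! k" if "k < Suc (Suc n)" for k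
    using H(2) that by (auto simp: networks_def)
  have c0: "C1 \<le> card ({..<C1} - {i})" if "min_vertex_cut H (code (Src 0)) (code (Snk 0)) \<le> card ({..<C1} - {i})" for i
    using cut[of 0] that by (simp add: S_nth R_nth)
  have c1: "C2 \<le> card ({..<C2} - {j})" if "min_vertex_cut H (code (Src 1)) (code (Snk 1)) \<le> card ({..<C2} - {j})" for j
    using cut[of 1] that by (simp add: S_nth R_nth)
  have ck: "min_vertex_cut H (code (Src (Suc (Suc k)))) (code (Snk (Suc (Suc k)))) = 1" if "k < n" for k
    using cut[of "Suc (Suc k)"] that by (simp add: S_nth R_nth)
  have small: "\<not> C \<le> card ({..<C} - {i})" if "i < C" for C i :: nat using that by simp
  show False
  proof (cases x)
    case (EG i j)
    then show False using x c0[OF cut_segment_le[OF fin H(1), of i j]] small[of i C1] no by simp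
  next
    case (EP i j)
    then show False using x c0[OF cut_row_le[OF fin H(1), of j "{i}"]] small[of i C1] no by simp
  next
    case (EQ i j)
    then show False using x c1[OF cut_col_le[OF fin H(1), of i "{j}"]] small[of j C2] no by simp
  next
    case (EC m)
    then show False using x c0[OF cut_chain_le[OF fin H(1), of m]] small[of 0 C1] C1 no by simp
  next
    case (ES k)
    then show False using x ck[of k] cut_unit_le(2)[OF fin H(1), of k] no by simp
  next
    case (ER k)
    then show False using x ck[of k] cut_unit_le(2)[OF fin H(1), of k] no by simp
  qed
qed

lemma three_edges:
  assumes "vertex v" "inner v"
  shows "\<exists>X. card X = 3 \<and> (\<forall>x\<in>X. edge x \<and> (org x = v \<or> dst x = v))"
proof (cases v)
  case (VA i j)
  show ?thesis by (rule exI[of _ "{EG i j, EP i j, EQ i j}"]) (use VA assms in auto)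
next
  case (VB i j)
  show ?thesis by (rule exI[of _ "{EG i j, EP i (Suc j), EQ (Suc i) j}"]) (use VB assms in auto)
next
  case (VC m)
  \<comment> \<open>At a chain vertex, \<open>EC m\<close> comes in along row 0, \<open>w\<close>
    continues the row, and \<open>u\<close> joins a terminal of a further pair: a source for even
    \<open>m\<close>, a sink for odd \<open>m\<close>.\<close>
  define u where "u = (if even m then ES (m div 2) else ER (m div 2))"
  define w where "w = (if Suc m = 2 * n then EP 0 0 else EC (Suc m))"
  have u: "edge u \<and> (org u = v \<or> dst u = v)" using VC assms by (auto simp: u_def elim!: evenE oddE)
  have w: "edge w \<and> org w = v" using VC assms C1 by (auto simp: w_def)
  have c: "card {EC m, u, w} = 3" by (auto simp: u_def w_def)
  show ?thesis by (rule exI[of _ "{EC m, u, w}"]) (use VC assms u w c in auto)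
qed (use assms in auto)

lemma card_inner: "card {v. vertex v \<and> inner v} = 2 * (C1 * C2 + n)"
proof -
  let ?I = "{..<C1} \<times> {..<C2}"
  let ?a = "(\<lambda>(i, j). VA i j) ` ?I" and ?b = "(\<lambda>(i, j). VB i j) ` ?I" and ?c = "VC ` {..<2 * n}"
  have eq: "{v. vertex v \<and> inner v} = ?a \<union> (?b \<union> ?c)"
  proof (intro equalityI subsetI)
    fix v assume "v \<in> {v. vertex v \<and> inner v}"
    then show "v \<in> ?a \<union> (?b \<union> ?c)" by (cases v) auto
  qed auto
  have "card ?a = C1 * C2" by (subst card_image) (auto simp: inj_on_def card_cartesian_product)
  moreover have "card ?b = C1 * C2" by (subst card_image) (auto simp: inj_on_def card_cartesian_product)
  moreover have "card ?c = 2 * n" by (subst card_image) (auto simp: inj_on_def)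
  moreover have "card (?b \<union> ?c) = card ?b + card ?c" by (rule card_Un_disjoint) auto
  moreover have "card (?a \<union> (?b \<union> ?c)) = card ?a + card (?b \<union> ?c)" by (rule card_Un_disjoint) auto
  ultimately show ?thesis unfolding eq by simp
qed

lemma many_hubs:
  assumes H: "subgraph H G" "(H, S, R) \<in> networks C"
  shows "2 * (C1 * C2 + n) \<le> card (hubs H)"
proof -
  have fin: "finite_loopless H" using H(2) by (auto simp: networks_def)
  have ter: "terminals H = set S \<union> set R" using H(2) by (auto simp: networks_def terminals_def)
  have "code v \<in> hubs H" if v: "vertex v" "inner v" for v
  proof -
    obtain X where X: "card X = 3" "\<And>x. x \<in> X \<Longrightarrow> edge x \<and> (org x = v \<or> dst x = v)" using three_edges[OF v] by blast
    have inc: "code x \<in> incident H (code v)" if "x \<in> X" for x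
    proof -
      have "code x \<in> edges H" using rigid[OF H] X(2)[OF that] by blast
      then show ?thesis using X(2)[OF that] H(1) by (auto simp: subgraph_def incident_def)
    qed
    obtain x where "x \<in> X" using X(1) by fastforce
    then have "code v \<in> verts H" using inc[of x] fin by (auto simp: incident_def finite_loopless_def)
    moreover have "code v \<notin> terminals H" using v(2) unfolding ter by (auto simp: S_def R_def)
    moreover have "card (code ` X) \<le> card (incident H (code v))"
      using inc fin by (intro card_mono) (auto simp: incident_def finite_loopless_def)
    then have "degree H (code v) \<ge> 3" using X(1) by (simp add: degree_def card_image)
    ultimately show ?thesis by (simp add: hubs_def)
  qed
  then have "code ` {v. vertex v \<and> inner v} \<subseteq> hubs H" by blast
  moreover have "finite (hubs H)" using fin by (simp add: hubs_def finite_loopless_def)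
  ultimately have "card (code ` {v. vertex v \<and> inner v}) \<le> card (hubs H)" by (intro card_mono)
  then show ?thesis by (simp add: card_image card_inner)
qed

end

theorem theorem6p2:
  fixes n C1 C2 :: nat
  assumes "C1 \<ge> 1" and "C2 \<ge> 1"
  shows "hub_number (C1 # C2 # replicate n 1) = enat (2 * (C1 * C2 + n))"
proof (rule antisym)
  let ?C = "C1 # C2 # replicate n 1"
  show "hub_number ?C \<le> enat (2 * (C1 * C2 + n))"
    unfolding hub_number_def
  proof (rule SUP_least, clarify)
    fix G S R assume "(G, S, R) \<in> networks ?C"
    then interpret network G S R ?C by unfold_locales
    obtain H where "subgraph H G" "(H, S, R) \<in> networks ?C" "card (hubs H) \<le> 2 * (C1 * C2 + n)"
      using small_subnetwork[OF refl assms] by blast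
    then show "(INF H \<in> {H. subgraph H G \<and> (H, S, R) \<in> networks ?C}. enat (card (hubs H))) \<le> enat (2 * (C1 * C2 + n))"
      by (intro INF_lower2[of H]) auto
  qed
  interpret grid C1 C2 n by unfold_locales (use assms in auto)
  have "enat (2 * (C1 * C2 + n)) \<le> (INF H \<in> {H. subgraph H G \<and> (H, S, R) \<in> networks ?C}. enat (card (hubs H)))"
    by (rule INF_greatest) (use many_hubs in auto)
  then show "enat (2 * (C1 * C2 + n)) \<le> hub_number ?C"
    unfolding hub_number_def by (intro SUP_upper2[OF grid_network]) simp
qed

end
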